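(* Let $p\ge1$ be an integer. All dead ends in $F(p+1)$ have depth $2$ with respect to $X=\{x_0,\dots,x_p\}$. Equivalently, there are no $k$-pockets in $F(p+1)$ with respect to $X$ for $k\ne2$.
   Context: For an integer $p\ge1$, $F(p+1)$ is the group of piecewise-linear orientation-preserving homeomorphisms of $[0,1]$ with finitely many breakpoints, all in $\mathbb{Z}[\frac1{p+1}]$, and with slopes in the multiplicative group generated by $p+1$; the product is $fg=f\circ g$. Standard finite generating set $X=\{x_0,\dots,x_p\}$: for $0\le i\le p-1$, in the domain divide $[0,1]$ into $p+1$ equal intervals and divide the last of these again into $p+1$ equal intervals; in the range divide $[0,1]$ into $p+1$ equal intervals and divide the $(i+1)$-st (from the left) of these again into $p+1$ equal intervals; $x_i$ maps the $j$-th domain interval affinely and increasingly onto the $j$-th range interval, for each $j=1,\dots,2p+1$. The generator $x_p$ is the identity on $[0,\frac p{p+1}]$ and $x_p(t)=\frac{p+x_0((p+1)t-p)}{p+1}$ on $[\frac p{p+1},1]$. $|w|$ denotes word length with respect to $X$. An element $w$ is a dead end with respect to $X$ if $|wg^{\pm1}|\le|w|$ for all $g\in X$. For a dead end $w$ with $|w|=n$, its depth is the smallest integer $m$ such that all paths of length $m$ or less in the Cayley graph emanating from $w$ remain in the ball $B_n$ of radius $n$ about the identity, but there exists a path of length $m+1$ from $w$ which leaves $B_n$, i.e. there are $g_1,\dots,g_{m+1}\in X\cup X^{-1}$ with $|wg_1\cdots g_{m+1}|>n$ (infinite depth if no such $m$ exists). A dead end of depth $k$ is also called a $k$-pocket.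 *)

theory Defs
  imports "HOL-Analysis.Analysis" "HOL-Algebra.Bij" "HOL-Library.Extended_Nat"
begin

section \<open>The groups $F(N)$\<close>

definition N_adic :: "nat \<Rightarrow> real set" where
  "N_adic N = {real_of_int a / real N ^ n | a n. True}"

definition has_local_slope :: "(real \<Rightarrow> real) \<Rightarrow> real \<Rightarrow> real \<Rightarrow> bool" where
  "has_local_slope f x m \<longleftrightarrow> (\<exists>c. \<forall>\<^sub>F y in nhds x. f y = m * y + c)"

definition breakpoints :: "(real \<Rightarrow> real) \<Rightarrow> real set" where
  "breakpoints f = {x \<in> {0<..<1}. \<nexists>m. has_local_slope f x m}"

text \<open>A homeomorphism of the interval is represented by a function that is
  \<^const>\<open>undefined\<close> outside the interval, as in \<^const>\<open>BijGroup\<close>. A continuous function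
  with finitely many breakpoints is affine between consecutive ones, so that
  finiteness of \<^const>\<open>breakpoints\<close> expresses piecewise linearity.\<close>

definition thompson_carrier :: "nat \<Rightarrow> (real \<Rightarrow> real) set" where
  "thompson_carrier N =
    {f \<in> extensional {0..1}.
       (\<exists>g. homeomorphism {0..1} {0..1} f g) \<and> strict_mono_on {0..1} f \<and>
       finite (breakpoints f) \<and> breakpoints f \<subseteq> N_adic N \<and>
       (\<forall>x\<in>{0<..<1}. \<forall>m. has_local_slope f x m \<longrightarrow> (\<exists>k::int. m = real N powi k))}"

definition thompson_group :: "nat \<Rightarrow> (real \<Rightarrow> real) monoid" where
  "thompson_group N = BijGroup {0..1} \<lparr>carrier := thompson_carrier N\<rparr>"


section \<open>The standard finite generating set of $F(p+1)$\<close>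

text \<open>\<open>subdiv_point p i 0 < subdiv_point p i 1 < \<dots> < subdiv_point p i (2 * p + 1)\<close> are the end points of the intervals
  obtained by dividing the unit interval into \<open>p + 1\<close> equal intervals and the \<open>(i + 1)\<close>-st
  of these again into \<open>p + 1\<close> equal intervals.\<close>

definition subdiv_point :: "nat \<Rightarrow> nat \<Rightarrow> nat \<Rightarrow> real" where
  "subdiv_point p i j =
    (if j \<le> i then real j / real (p + 1)
     else if j \<le> i + p + 1 then real i / real (p + 1) + real (j - i) / real (p + 1) ^ 2
     else real (j - p) / real (p + 1))"

text \<open>The intervals are counted from \<open>0\<close> here: \<open>j\<close> is the index of the domain interval
  \<open>{subdiv_point p p j..subdiv_point p p (j + 1)}\<close> containing \<open>t\<close>.\<close>

definition gen_low :: "nat \<Rightarrow> nat \<Rightarrow> real \<Rightarrow> real" where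
  "gen_low p i = (\<lambda>t\<in>{0..1}.
     let j = (LEAST j. t \<le> subdiv_point p p (j + 1))
     in subdiv_point p i j +
         (subdiv_point p i (j + 1) - subdiv_point p i j) /
         (subdiv_point p p (j + 1) - subdiv_point p p j) * (t - subdiv_point p p j))"

lemma subdiv_point_less:
  assumes "i \<le> p"
  shows "subdiv_point p i j < subdiv_point p i (Suc j)"
proof -
  define N where "N = real (p + 1)"
  have N: "N > 0" "real p = N - 1" by (simp_all add: N_def)
  have eq: "subdiv_point p i k =
    (if k \<le> i then real k / N
     else if k \<le> i + p + 1 then real i / N + (real k - real i) / N ^ 2
     else (real k - real p) / N)" for k
    by (simp only: subdiv_point_def N_def) (simp add: of_nat_diff)
  consider "Suc j \<le> i" | "i \<le> j" "Suc j \<le> i + p + 1" | "j = i + p + 1" | "j > i + p + 1"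
    by linarith
  then show ?thesis
  proof cases
    case 1
    with N(1) show ?thesis by (simp add: eq divide_strict_right_mono)
  next
    case 2
    then have "subdiv_point p i j = real i / N + (real j - real i) / N ^ 2"
      "subdiv_point p i (Suc j) = real i / N + (real j + 1 - real i) / N ^ 2"
      by (auto simp: eq)
    with N(1) show ?thesis by (simp add: divide_strict_right_mono)
  next
    case 3
    then have "subdiv_point p i j = real i / N + N / N ^ 2"
      "subdiv_point p i (Suc j) = (real i + 2) / N"
      by (simp_all add: eq N_def)
    moreover have "real i / N + N / N ^ 2 = (real i + 1) / N"
      using N(1) by (simp add: power2_eq_square add_divide_distrib)
    ultimately show ?thesis using N(1) by (simp add: divide_strict_right_mono)
  next
    case 4
    with N(1) show ?thesis by (simp add: eq divide_strict_right_mono)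
  qed
qed

lemma gen_low_affine:
  assumes "j \<le> 2 * p" and "t \<in> {subdiv_point p p j..subdiv_point p p (j + 1)}"
  shows "gen_low p i t = subdiv_point p i j +
    (subdiv_point p i (j + 1) - subdiv_point p i j) /
    (subdiv_point p p (j + 1) - subdiv_point p p j) * (t - subdiv_point p p j)"
proof -
  let ?d = "subdiv_point p p"
  have sm: "strict_mono ?d"
    by (simp add: strict_mono_Suc_iff subdiv_point_less)
  have d0: "?d 0 = 0" by (simp add: subdiv_point_def)
  have d1: "?d (2 * p + 1) = 1"
  proof -
    have "real p + 1 \<noteq> 0" by linarith
    then show ?thesis by (simp add: subdiv_point_def power2_eq_square field_simps del: of_nat_Suc)
  qed
  have "?d 0 \<le> ?d j" "?d (j + 1) \<le> ?d (2 * p + 1)"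
    using assms(1) by (auto simp: strict_mono_less_eq[OF sm])
  with assms(2) d0 d1 have t: "t \<in> {0..1}" by auto
  define l where "l = (LEAST j. t \<le> ?d (j + 1))"
  have l: "t \<le> ?d (l + 1)" "l \<le> j"
    unfolding l_def using assms(2) by (auto intro: LeastI Least_le)
  show ?thesis
  proof (cases "l = j")
    case True
    then show ?thesis using t by (simp add: gen_low_def l_def Let_def)
  next
    case False
    with l have "l + 1 \<le> j" by simp
    then have "?d (l + 1) \<le> ?d j" by (simp add: strict_mono_less_eq[OF sm])
    with l assms(2) have tj: "t = ?d j" "?d (l + 1) = ?d j" by auto
    have lj: "j = l + 1" using tj(2) by (simp only: strict_mono_eq[OF sm])
    have "?d (l + 1) - ?d l \<noteq> 0" using subdiv_point_less[of p p l] by simp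
    moreover have "gen_low p i t = subdiv_point p i l +
      (subdiv_point p i (l + 1) - subdiv_point p i l) / (?d (l + 1) - ?d l) * (t - ?d l)"
      using t by (simp add: gen_low_def l_def Let_def)
    ultimately have "gen_low p i t = subdiv_point p i j"
      using tj(1) lj by simp
    then show ?thesis using tj(1) by simp
  qed
qed

definition gen_last :: "nat \<Rightarrow> real \<Rightarrow> real" where
  "gen_last p = (\<lambda>t\<in>{0..1}.
     if t \<le> real p / real (p + 1) then t
     else (real p + gen_low p 0 (real (p + 1) * t - real p)) / real (p + 1))"

definition std_gens :: "nat \<Rightarrow> (real \<Rightarrow> real) set" where
  "std_gens p = gen_low p ` {0..<p} \<union> {gen_last p}"


section \<open>Word length, dead ends and their depth\<close>

definition letters :: "('a, 'b) monoid_scheme \<Rightarrow> 'a set \<Rightarrow> 'a set" where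
  "letters G X = X \<union> m_inv G ` X"

definition word_prod :: "('a, 'b) monoid_scheme \<Rightarrow> 'a list \<Rightarrow> 'a" where
  "word_prod G gs = foldr (mult G) gs (one G)"

text \<open>The length is \<open>\<infinity>\<close> for elements outside the subgroup generated by \<open>X\<close>.\<close>

definition word_length :: "('a, 'b) monoid_scheme \<Rightarrow> 'a set \<Rightarrow> 'a \<Rightarrow> enat" where
  "word_length G X w =
    Inf {enat (length gs) | gs. gs \<in> lists (letters G X) \<and> word_prod G gs = w}"

definition dead_end :: "('a, 'b) monoid_scheme \<Rightarrow> 'a set \<Rightarrow> 'a \<Rightarrow> bool" where
  "dead_end G X w \<longleftrightarrow>
    w \<in> carrier G \<and> (\<forall>g\<in>letters G X. word_length G X (w \<otimes>\<^bsub>G\<^esub> g) \<le> word_length G X w)"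

definition dead_end_depth :: "('a, 'b) monoid_scheme \<Rightarrow> 'a set \<Rightarrow> 'a \<Rightarrow> enat" where
  "dead_end_depth G X w =
    Inf {enat m | m.
      (\<forall>gs\<in>lists (letters G X). length gs \<le> m \<longrightarrow>
         word_length G X (w \<otimes>\<^bsub>G\<^esub> word_prod G gs) \<le> word_length G X w) \<and>
      (\<exists>gs\<in>lists (letters G X). length gs = m + 1 \<and>
         word_length G X (w \<otimes>\<^bsub>G\<^esub> word_prod G gs) > word_length G X w)}"

definition pocket :: "('a, 'b) monoid_scheme \<Rightarrow> 'a set \<Rightarrow> enat \<Rightarrow> 'a \<Rightarrow> bool" where
  "pocket G X k w \<longleftrightarrow> dead_end G X w \<and> dead_end_depth G X w = k"

end

theory Submission imports Defs begin

text \<open>Put \<open>N = p + 1\<close>. Conjugation by the map \<open>H\<close> from the line onto the open unit interval turns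
\<open>x\<^sub>0\<close> into the translation by \<open>- p\<close> and \<open>x\<^sub>i\<close>, for \<open>1 \<le> i \<le> p\<close>, into \<open>merge (i - 1)\<close>, where
\<open>merge i\<close> squeezes the \<open>N\<close> unit intervals that start at \<open>i\<close> into the interval from \<open>i\<close> to \<open>i + 1\<close> and
translates everything beyond by \<open>- p\<close>. For an element \<open>w\<close>, let \<open>f\<close> be the conjugate of its
inverse; multiplying \<open>w\<close> on the right by a generator composes \<open>f\<close> with one of these maps, or with
an inverse of one, on the left. A composite \<open>f\<close> is pictured as an infinite row of \<open>N\<close>-ary trees, one over
each unit interval, with a pointer at \<open>0\<close>: the translation moves the pointer across \<open>p\<close> trees,
\<open>merge i\<close> joins \<open>N\<close> consecutive trees by a new root, and its inverse \<open>expand i\<close> removes a root.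

The argument follows a single point, a stop, along a word. Stops are the elements of
\<open>p * Z[1/N]\<close>; the pointer only rests at stops, and every caret (a node with its \<open>N\<close> children)
has exactly one stop among the gaps between its children. A forward move, translation or merge, that is applied while the
stop lies below \<open>p\<close> concerns only what is to the right of the stop. If the stop
lies above \<open>p\<close>, the move concerns only the left side. If it lies at \<open>p\<close>, the move concerns neither
side: either the pointer crosses the stop, or the caret that owns the stop is created.
This is \<open>right_part_fwd\<close> and \<open>left_part_fwd\<close>; inverse moves are treated as these moves run backwards.
So a word splits into a right word, a left word and a number of crossings, and the two words
can be put together again in an order that needs fewer crossings.

Two facts result. If tree \<open>p - 1\<close> is trivial, expanding it makes the element longer
(\<open>shorten_expand\<close>): the expansion leaves only trivial trees between the stops \<open>p\<close> and \<open>2 p\<close>, and a word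
for the longer element is shortened by leaving out what it spends there. If tree \<open>2 p - 1\<close> is not trivial, then
\<open>merge (p - 1)\<close> makes the element longer (\<open>shorten_merge\<close>): a word for the merged element has to cross
the stop \<open>p\<close> in order to create the new root. If there are further crossings, fewer of them suffice without
the new root. If there are none, then the work to the right of the stop can be done without crossing it,
before it becomes exposed.

At a dead end the second fact says that tree \<open>2 p - 1\<close> is trivial. A translation makes it
tree \<open>p - 1\<close>, and expanding it twice lengthens twice by the first fact. As the translation
shortens the element by at most one, this path of length \<open>3\<close> leaves the ball (\<open>leaves_ball\<close>). Shorter
paths do not: the parity of the length of a word is visible in the translation that it induces
near \<open>\<infinity>\<close> (\<open>word_parity\<close>), so each generator changes the length by exactly one, and at a dead end
it decreases it.

Elements outside the subgroup generated by the \<open>x\<^sub>i\<close> would be dead ends of infinite depth, so it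
also has to be shown that there are none. A map that sends each unit interval to a standard
interval \<open>[a / N ^ k, (a + 1) / N ^ k]\<close> is a product of moves (\<open>partition_word\<close>), by induction on
the number of intervals that shrink. Every element of the group differs by two such maps from
the identity (\<open>carrier_word\<close>), because it sends all sufficiently short standard intervals to standard
intervals (\<open>carrier_affine_std\<close>).\<close>

section \<open>Piecewise affine maps of the unit interval\<close>

lemma segment_bounds:
  assumes "a < (b::real)" "0 \<le> x" "x \<le> 1"
  shows "a \<le> a + x * (b - a)" "a + x * (b - a) \<le> b"
proof -
  define d where "d = b - a"
  have "0 \<le> x * d" "x * d \<le> d"
    using assms mult_left_le_one_le[of d x] by (auto simp: d_def)
  then show "a \<le> a + x * (b - a)" "a + x * (b - a) \<le> b" unfolding d_def[symmetric] by (auto simp: d_def)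
qed

text \<open>The points \<open>s j\<close> and \<open>r j\<close> subdivide the domain and the range. The setting is symmetric in the two
subdivisions, so that every fact also applies to the inverse map.\<close>

locale piecewise_affine =
  fixes m :: nat and s r :: "nat \<Rightarrow> real" and f :: "real \<Rightarrow> real"
  assumes s: "s 0 = 0" "s m = 1" "\<And>j. j < m \<Longrightarrow> s j < s (Suc j)"
    and r: "r 0 = 0" "r m = 1" "\<And>j. j < m \<Longrightarrow> r j < r (Suc j)"
    and ext: "f \<in> extensional {0..1}"
    and piece: "\<And>j t. j < m \<Longrightarrow> s j \<le> t \<Longrightarrow> t \<le> s (Suc j) \<Longrightarrow>
      f t = r j + (r (Suc j) - r j) / (s (Suc j) - s j) * (t - s j)"
begin

lemma mono_points:
  assumes "\<And>j. j < m \<Longrightarrow> q j < (q (Suc j) :: real)" "i \<le> j" "j \<le> m"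
  shows "q i \<le> q j"
  using assms(2,3) by (induction j rule: dec_induct) (use assms(1) in \<open>auto intro: order_trans[OF _ less_imp_le]\<close>)

lemma s_in: "j \<le> m \<Longrightarrow> s j \<in> {0..1}"
  using mono_points[of s 0 j] mono_points[of s j m] s by auto

lemma r_in: "j \<le> m \<Longrightarrow> r j \<in> {0..1}"
  using mono_points[of r 0 j] mono_points[of r j m] r by auto

lemma find_piece:
  assumes "q 0 = 0" "q m = (1::real)" "0 \<le> t" "t \<le> 1"
  shows "\<exists>j<m. q j \<le> t \<and> t \<le> q (Suc j)"
proof -
  have m: "m > 0" using assms by (cases m) auto
  have "\<exists>j<m. q j \<le> t \<and> t \<le> q (Suc j)" if "k \<le> m" "t \<le> q k" "k > 0" for k
    using that
  proof (induction k)
    case (Suc k)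
    show ?case
    proof (cases "t \<le> q k")
      case True
      show ?thesis
      proof (cases "k = 0")
        case True
        then have "q k \<le> t" using assms by simp
        then show ?thesis using Suc.prems by (intro exI[of _ k]) auto
      qed (use Suc True in auto)
    next
      case False
      then show ?thesis using Suc.prems by (intro exI[of _ k]) auto
    qed
  qed simp
  from this[of m] show ?thesis using assms m by simp
qed

lemma f_piece:
  assumes "j < m" "0 \<le> x" "x \<le> 1"
  shows "f (s j + x * (s (Suc j) - s j)) = r j + x * (r (Suc j) - r j)"
proof -
  have d: "s (Suc j) - s j > 0" using s(3)[OF assms(1)] by simp
  have "0 \<le> x * (s (Suc j) - s j)" "x * (s (Suc j) - s j) \<le> 1 * (s (Suc j) - s j)"
    using assms d by (auto intro!: mult_right_mono)
  then have "f (s j + x * (s (Suc j) - s j)) = r j + (r (Suc j) - r j) / (s (Suc j) - s j) * (x * (s (Suc j) - s j))"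
    using piece[OF assms(1), of "s j + x * (s (Suc j) - s j)"] by simp
  then show ?thesis using d by simp
qed

lemma piece_param:
  assumes "j < m" "s j \<le> t" "t \<le> s (Suc j)"
  obtains x where "0 \<le> x" "x \<le> 1" "t = s j + x * (s (Suc j) - s j)"
proof
  have d: "s (Suc j) - s j > 0" using s(3)[OF assms(1)] by simp
  let ?x = "(t - s j) / (s (Suc j) - s j)"
  show "0 \<le> ?x" "?x \<le> 1" using assms d by (auto simp: field_simps)
  show "t = s j + ?x * (s (Suc j) - s j)" using d by simp
qed

lemma f_in_piece:
  assumes "j < m" "s j \<le> t" "t \<le> s (Suc j)"
  shows "r j \<le> f t" "f t \<le> r (Suc j)"
proof -
  obtain x where x: "0 \<le> x" "x \<le> 1" "t = s j + x * (s (Suc j) - s j)" using piece_param[OF assms] .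
  have d: "r (Suc j) - r j > 0" using r(3)[OF assms(1)] by simp
  have "0 \<le> x * (r (Suc j) - r j)" "x * (r (Suc j) - r j) \<le> 1 * (r (Suc j) - r j)"
    using x d by (auto intro!: mult_right_mono)
  then show "r j \<le> f t" "f t \<le> r (Suc j)" using f_piece[OF assms(1) x(1,2)] x(3) by auto
qed

lemma f_less:
  assumes "0 \<le> t" "t < u" "u \<le> 1"
  shows "f t < f u"
proof -
  obtain j where j: "j < m" "s j \<le> t" "t \<le> s (Suc j)" using find_piece[of s t] s assms by auto
  obtain k where k: "k < m" "s k \<le> u" "u \<le> s (Suc k)" using find_piece[of s u] s assms by auto
  have same: "f v < f w" if "i < m" "s i \<le> v" "v < w" "w \<le> s (Suc i)" for i v w
  proof -
    let ?k = "(r (Suc i) - r i) / (s (Suc i) - s i)"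
    have vw: "v \<le> s (Suc i)" "s i \<le> w" using that by auto
    note fv = piece[OF that(1,2) vw(1)] and fw = piece[OF that(1) vw(2) that(4)]
    have "?k > 0" using r(3)[OF that(1)] s(3)[OF that(1)] by simp
    then have "?k * (v - s i) < ?k * (w - s i)" using that by (intro mult_strict_left_mono) auto
    then show ?thesis unfolding fv fw by (rule add_strict_left_mono)
  qed
  show ?thesis
  proof (cases "u \<le> s (Suc j)")
    case True
    then show ?thesis using same[OF j(1,2) assms(2)] by simp
  next
    case False
    have jk: "Suc j \<le> k"
    proof (rule ccontr)
      assume "\<not> Suc j \<le> k"
      then have "s (Suc k) \<le> s (Suc j)" using j by (intro mono_points[of s] s) auto
      then show False using False k by simp
    qed
    have a: "f t \<le> r (Suc j)" using f_in_piece[OF j] by simp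
    have b: "r (Suc j) \<le> r k" using jk k by (intro mono_points[of r] r) auto
    have c: "r k \<le> f u" using f_in_piece[OF k] by simp
    show ?thesis
    proof (cases "t = s (Suc j)")
      case False
      then have "f t < f (s (Suc j))" using j s(3)[OF j(1)] by (intro same) auto
      moreover have "f (s (Suc j)) = r (Suc j)" using f_piece[OF j(1), of 1] by simp
      ultimately show ?thesis using b c by simp
    next
      case True
      show ?thesis
      proof (cases "Suc j = k")
        case True2: True
        have "f (s k) < f u" using k True True2 assms by (intro same) auto
        then show ?thesis using True True2 by simp
      next
        case False
        have "r (Suc j) < r (Suc (Suc j))" using jk k by (intro r) simp
        also have "\<dots> \<le> r k" using False jk k by (intro mono_points[of r] r) auto
        finally show ?thesis using a c by simp
      qed
    qed
  qed
qed

lemma strict_mono_f: "strict_mono_on {0..1} f"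
  by (auto intro!: strict_mono_onI f_less)

lemma f_image: "f ` {0..1} = {0..1}"
proof
  show "f ` {0..1} \<subseteq> {0..1}"
  proof (safe)
    fix t :: real assume t: "t \<in> {0..1}"
    then obtain j where j: "j < m" "s j \<le> t" "t \<le> s (Suc j)" using find_piece[of s t] s by auto
    then show "f t \<in> {0..1}" using f_in_piece[OF j] r_in[of j] r_in[of "Suc j"] by auto
  qed
next
  show "{0..1} \<subseteq> f ` {0..1}"
  proof
    fix y :: real assume y: "y \<in> {0..1}"
    then obtain j where j: "j < m" "r j \<le> y" "y \<le> r (Suc j)" using find_piece[of r y] r by auto
    let ?x = "(y - r j) / (r (Suc j) - r j)"
    have d: "r (Suc j) - r j > 0" using r(3)[OF j(1)] by simp
    have x: "0 \<le> ?x" "?x \<le> 1" using j d by (auto simp: field_simps)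
    have "f (s j + ?x * (s (Suc j) - s j)) = y" using f_piece[OF j(1) x] d by simp
    moreover have "s j + ?x * (s (Suc j) - s j) \<in> {0..1}"
    proof -
      note b = segment_bounds[OF s(3)[OF j(1)] x]
      have "0 \<le> s j" "s (Suc j) \<le> 1" using s_in[of j] s_in[of "Suc j"] j by auto
      then show ?thesis using b unfolding atLeastAtMost_iff by linarith
    qed
    ultimately show "y \<in> f ` {0..1}" by (metis image_eqI)
  qed
qed

lemma bij_f: "bij_betw f {0..1} {0..1}"
  using f_image strict_mono_f by (simp add: bij_betw_def strict_mono_on_imp_inj_on)

lemma cont_f: "continuous_on {0..1} f"
proof -
  have "continuous_on {s j..s (Suc j)} f" if "j < m" for j
  proof -
    have "continuous_on {s j..s (Suc j)} (\<lambda>t. r j + (r (Suc j) - r j) / (s (Suc j) - s j) * (t - s j))"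
      by (intro continuous_intros)
    then show ?thesis using piece[OF that] by (auto cong: continuous_on_cong_simp)
  qed
  then have "continuous_on (\<Union>j\<in>{..<m}. {s j..s (Suc j)}) f"
    by (intro continuous_on_closed_Union) auto
  moreover have "{0..1} \<subseteq> (\<Union>j\<in>{..<m}. {s j..s (Suc j)})"
  proof
    fix t :: real assume t: "t \<in> {0..1}"
    then obtain j where "j < m" "s j \<le> t" "t \<le> s (Suc j)" using find_piece[of s t] s by auto
    then show "t \<in> (\<Union>j\<in>{..<m}. {s j..s (Suc j)})" by auto
  qed
  ultimately show ?thesis by (rule continuous_on_subset)
qed

lemma local_slope_inside:
  assumes "j < m" "s j < x" "x < s (Suc j)"
  shows "has_local_slope f x ((r (Suc j) - r j) / (s (Suc j) - s j))"
proof -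
  let ?k = "(r (Suc j) - r j) / (s (Suc j) - s j)"
  have "\<forall>\<^sub>F y in nhds x. y \<in> {s j<..<s (Suc j)}" using assms by (intro eventually_nhds_in_open) auto
  then have "\<forall>\<^sub>F y in nhds x. f y = ?k * y + (r j - ?k * s j)"
    by eventually_elim (use piece[OF assms(1)] in \<open>auto simp: right_diff_distrib\<close>)
  then show ?thesis unfolding has_local_slope_def by blast
qed

lemma breakpoints_f: "breakpoints f \<subseteq> s ` {..m}"
proof
  fix x assume x: "x \<in> breakpoints f"
  then obtain j where j: "j < m" "s j \<le> x" "x \<le> s (Suc j)" using find_piece[of s x] s by (auto simp: breakpoints_def)
  have "\<not> (s j < x \<and> x < s (Suc j))" using local_slope_inside[OF j(1)] x by (auto simp: breakpoints_def)
  then have "x = s j \<or> x = s (Suc j)" using j by auto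
  then show "x \<in> s ` {..m}" using j by auto
qed

text \<open>At a division point that is not a breakpoint, the slope is that of either of the two adjacent pieces.\<close>

lemma local_slope_cases:
  assumes "x \<in> {0<..<1}" "has_local_slope f x k"
  shows "\<exists>j<m. k = (r (Suc j) - r j) / (s (Suc j) - s j)"
proof -
  obtain j where j: "j < m" "s j \<le> x" "x \<le> s (Suc j)" using find_piece[of s x] s assms(1) by auto
  let ?k = "(r (Suc j) - r j) / (s (Suc j) - s j)"
  obtain c S where S: "open S" "x \<in> S" "\<And>y. y \<in> S \<Longrightarrow> f y = k * y + c"
    using assms(2) unfolding has_local_slope_def eventually_nhds by blast
  then obtain e where e: "e > 0" "\<And>y. \<bar>y - x\<bar> < e \<Longrightarrow> y \<in> S"
    using open_real by (metis (no_types, opaque_lifting) S(1,2) open_dist dist_real_def)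
  \<comment> \<open>a second point of the same piece inside the neighbourhood\<close>
  have "\<exists>y. y \<noteq> x \<and> \<bar>y - x\<bar> < e \<and> s j \<le> y \<and> y \<le> s (Suc j)"
  proof (cases "x < s (Suc j)")
    case True
    then show ?thesis using e j by (intro exI[of _ "x + min (e / 2) (s (Suc j) - x)"]) auto
  next
    case False
    then show ?thesis using e j s(3)[OF j(1)] by (intro exI[of _ "x - min (e / 2) (x - s j)"]) auto
  qed
  then obtain y where y: "y \<noteq> x" "\<bar>y - x\<bar> < e" "s j \<le> y" "y \<le> s (Suc j)" by blast
  have "f y - f x = k * (y - x)" using S(3)[OF e(2)[OF y(2)]] S(3)[OF S(2)] by (simp add: algebra_simps)
  moreover have "f y - f x = ?k * (y - x)"
    using piece[OF j(1) y(3,4)] piece[OF j] by (simp only: right_diff_distrib)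
  ultimately have "k * (y - x) = ?k * (y - x)" by (simp only:)
  then have "k = ?k" using y(1) mult_right_cancel[of "y - x" k ?k] by simp
  then show ?thesis using j by blast
qed

lemma in_thompson_carrier:
  assumes "\<And>j. j \<le> m \<Longrightarrow> s j \<in> N_adic n"
    and "\<And>j. j < m \<Longrightarrow> \<exists>k::int. (r (Suc j) - r j) / (s (Suc j) - s j) = real n powi k"
  shows "f \<in> thompson_carrier n"
  unfolding thompson_carrier_def
proof (intro CollectI conjI)
  show "\<exists>g. homeomorphism {0..1} {0..1} f g"
    using homeomorphism_compact[OF compact_Icc cont_f f_image] bij_f by (simp add: bij_betw_def)
  show "finite (breakpoints f)" using breakpoints_f finite_subset by blast
  show "breakpoints f \<subseteq> N_adic n" using breakpoints_f assms(1) by blast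
  show "\<forall>x\<in>{0<..<1}. \<forall>k. has_local_slope f x k \<longrightarrow> (\<exists>i::int. k = real n powi i)"
    using local_slope_cases assms(2) by metis
qed (fact ext strict_mono_f)+

definition inv_f :: "real \<Rightarrow> real" where
  "inv_f = (\<lambda>y\<in>{0..1}. inv_into {0..1} f y)"

lemma piecewise_affine_inverse: "piecewise_affine m r s inv_f"
proof
  fix j t assume j: "j < m" and t: "r j \<le> t" "t \<le> r (Suc j)"
  have d: "r (Suc j) - r j > 0" "s (Suc j) - s j > 0" using r(3)[OF j] s(3)[OF j] by auto
  let ?x = "(t - r j) / (r (Suc j) - r j)" let ?u = "s j + ?x * (s (Suc j) - s j)"
  have x: "0 \<le> ?x" "?x \<le> 1" using t d by (auto simp: field_simps)
  have fu: "f ?u = t" using f_piece[OF j x] d by simp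
  have "0 \<le> s j" "s (Suc j) \<le> 1" using s_in[of j] s_in[of "Suc j"] j by auto
  then have u: "?u \<in> {0..1}" using segment_bounds[OF s(3)[OF j] x] unfolding atLeastAtMost_iff by linarith
  have "t \<in> {0..1}" using r_in[of j] r_in[of "Suc j"] t j by auto
  then have "inv_f t = inv_into {0..1} f t" by (simp add: inv_f_def)
  also have "\<dots> = inv_into {0..1} f (f ?u)" by (simp only: fu)
  also have "\<dots> = ?u" by (rule inv_into_f_f[OF bij_betw_imp_inj_on[OF bij_f] u])
  finally show "inv_f t = s j + (s (Suc j) - s j) / (r (Suc j) - r j) * (t - r j)" by (simp add: mult.commute)
qed (auto simp: s r inv_f_def)

end

lemma local_form_unique:
  fixes f :: "real \<Rightarrow> real"
  assumes "\<forall>\<^sub>F y in nhds x. f y = m * y + c" "\<forall>\<^sub>F y in nhds x. f y = n * y + d"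
  shows "m = n" "c = d"
proof -
  have "\<forall>\<^sub>F y in nhds x. m * y + c = n * y + d" using assms by eventually_elim simp
  then obtain S where S: "open S" "x \<in> S" "\<And>y. y \<in> S \<Longrightarrow> m * y + c = n * y + d"
    unfolding eventually_nhds by blast
  then obtain e where e: "e > 0" "ball x e \<subseteq> S" by (meson openE)
  have "x + e / 2 \<in> S" using e by (auto simp: dist_real_def subset_iff)
  then have a: "m * (x + e / 2) + c = n * (x + e / 2) + d" using S by blast
  have b: "m * x + c = n * x + d" using S by blast
  have "m * (x + e / 2) + c - (m * x + c) = n * (x + e / 2) + d - (n * x + d)" using a b by simp
  then have "m * (e / 2) = n * (e / 2)" by (simp add: distrib_left)
  then show "m = n" using e by simp
  then show "c = d" using b by simp
qed

text \<open>Near every point that is not a breakpoint the map has a unique affine form, and this form is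
locally constant; hence it is constant on a connected set without breakpoints. Continuity extends
it to the end points.\<close>

lemma affine_between_breakpoints:
  fixes f :: "real \<Rightarrow> real"
  assumes cont: "continuous_on {u..v} f" and uv: "u < v" "0 \<le> u" "v \<le> 1"
    and nb: "breakpoints f \<inter> {u<..<v} = {}"
  obtains m c where "\<And>x. u \<le> x \<Longrightarrow> x \<le> v \<Longrightarrow> f x = m * x + c"
    "\<exists>x\<in>{0<..<1}. has_local_slope f x m"
proof -
  have loc: "\<exists>m c. \<forall>\<^sub>F y in nhds x. f y = m * y + c" if "x \<in> {u<..<v}" for x
  proof -
    have "x \<in> {0<..<1}" "x \<notin> breakpoints f" using that nb uv by auto
    then show ?thesis by (auto simp: breakpoints_def has_local_slope_def)
  qed
  let ?x0 = "(u + v) / 2"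
  have x0: "?x0 \<in> {u<..<v}" using uv by auto
  obtain m c where mc: "\<forall>\<^sub>F y in nhds ?x0. f y = m * y + c" using loc[OF x0] by blast
  have "\<forall>\<^sub>F y in nhds x. f y = m * y + c" if x: "x \<in> {u<..<v}" for x
  proof (rule connected_induction_simple[of "{u<..<v}" ?x0 x "\<lambda>x. \<forall>\<^sub>F y in nhds x. f y = m * y + c"])
    fix a assume a: "a \<in> {u<..<v}"
    obtain n d where "\<forall>\<^sub>F y in nhds a. f y = n * y + d" using loc[OF a] by blast
    then obtain S where S: "open S" "a \<in> S" "\<And>y. y \<in> S \<Longrightarrow> f y = n * y + d"
      unfolding eventually_nhds by blast
    have ev: "\<forall>\<^sub>F y in nhds z. f y = n * y + d" if "z \<in> S" for z
      unfolding eventually_nhds using S that by blast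
    have "\<forall>\<^sub>F w in nhds z. f w = m * w + c" if y: "y \<in> S" "\<forall>\<^sub>F w in nhds y. f w = m * w + c" and z: "z \<in> S" for y z
      using local_form_unique[OF y(2) ev[OF y(1)]] ev[OF z] by simp
    then show "\<exists>T. openin (top_of_set {u<..<v}) T \<and> a \<in> T \<and>
        (\<forall>x\<in>T. \<forall>y\<in>T. (\<forall>\<^sub>F y in nhds x. f y = m * y + c) \<longrightarrow> (\<forall>\<^sub>F z in nhds y. f z = m * z + c))"
      using S a by (intro exI[of _ "{u<..<v} \<inter> S"]) (auto simp: openin_open_Int)
  qed (use x x0 mc in auto)
  then have "f x = m * x + c" if "x \<in> {u<..<v}" for x using that eventually_nhds_x_imp_x by fast
  then have eq: "f x - (m * x + c) = 0" if "x \<in> {u<..<v}" for x using that by simp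
  have cl: "closure {u<..<v} = {u..v}" using uv by simp
  have "f x - (m * x + c) = 0" if "x \<in> {u..v}" for x
    by (rule continuous_constant_on_closure[of "{u<..<v}" "\<lambda>x. f x - (m * x + c)"])
      (use cont that eq cl in \<open>auto intro!: continuous_intros\<close>)
  then have "f x = m * x + c" if "u \<le> x" "x \<le> v" for x using that by simp
  moreover have "\<exists>x\<in>{0<..<1}. has_local_slope f x m"
    using mc x0 uv unfolding has_local_slope_def by (intro bexI[of _ ?x0]) auto
  ultimately show thesis by (rule that)
qed

lemma thompson_carrierD:
  assumes "w \<in> thompson_carrier n"
  shows "continuous_on {0..1} w" "strict_mono_on {0..1} w" "w ` {0..1} = {0..1}" "bij_betw w {0..1} {0..1}"
    "w 0 = 0" "w 1 = 1" "w \<in> extensional {0..1}"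
proof -
  obtain g where g: "homeomorphism {0..1} {0..1} w g" using assms by (auto simp: thompson_carrier_def)
  show c: "continuous_on {0..1} w" "w ` {0..1} = {0..1}" using g by (auto simp: homeomorphism_def)
  show sm: "strict_mono_on {0..1} w" and "w \<in> extensional {0..1}" using assms by (auto simp: thompson_carrier_def)
  show "bij_betw w {0..1} {0..1}" using sm c(2) by (simp add: bij_betw_def strict_mono_on_imp_inj_on)
  have mono: "w x \<le> w y" if "0 \<le> x" "x \<le> y" "y \<le> 1" for x y
    using strict_mono_onD[OF sm, of x y] that by (cases "x = y") auto
  obtain a where a: "a \<in> {0..1}" "w a = 0" using c(2) by (metis atLeastAtMost_iff imageE zero_le_one order_refl)
  obtain b where b: "b \<in> {0..1}" "w b = 1" using c(2) by (metis atLeastAtMost_iff imageE zero_le_one order_refl)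
  have "w 0 \<in> {0..1}" "w 1 \<in> {0..1}" using c(2) by (metis image_eqI atLeastAtMost_iff zero_le_one order_refl)+
  then show "w 0 = 0" "w 1 = 1" using mono[of 0 a] mono[of b 1] a b by auto
qed

section \<open>The line model\<close>

text \<open>\<open>Merge i\<close> stands for the image of \<open>x\<^sub>i\<^sub>+\<^sub>1\<close> under the conjugation, \<open>Shift\<close> for that of \<open>x\<^sub>0\<close>.\<close>

datatype move = Shift | Merge int

locale tree_line =
  fixes p :: nat
  assumes p_pos: "p \<ge> 1"
begin

abbreviation P :: real where "P \<equiv> real p"

definition N :: real where "N = P + 1"

text \<open>The index \<open>i\<close> may be any integer, although only \<open>0 \<le> i < p\<close> occurs in words: the others are
conjugates by translations.\<close>

definition merge :: "int \<Rightarrow> real \<Rightarrow> real" where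
  "merge i x = (if x \<le> i then x else if x \<le> i + N then i + (x - i) / N else x - P)"

definition expand :: "int \<Rightarrow> real \<Rightarrow> real" where
  "expand i x = (if x \<le> i then x else if x \<le> i + 1 then i + (x - i) * N else x + P)"

fun fwd :: "move \<Rightarrow> real \<Rightarrow> real" where
  "fwd Shift x = x - P"
| "fwd (Merge i) x = merge i x"

fun bwd :: "move \<Rightarrow> real \<Rightarrow> real" where
  "bwd Shift x = x + P"
| "bwd (Merge i) x = expand i x"

definition moves :: "move set" where
  "moves = insert Shift (Merge ` {0..<int p})"

definition act :: "move \<times> bool \<Rightarrow> real \<Rightarrow> real" where
  "act l = (if snd l then fwd (fst l) else bwd (fst l))"

text \<open>The first letter of a word acts first. If \<open>g\<close> is the product \<open>g\<^sub>1 \<dots> g\<^sub>n\<close> in the group, then the word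
of the inverses \<open>g\<^sub>1, \<dots>, g\<^sub>n\<close>, in this order, acts as the inverse of \<open>g\<close>.\<close>

fun wact :: "(move \<times> bool) list \<Rightarrow> real \<Rightarrow> real" where
  "wact [] x = x"
| "wact (l # ws) x = wact ws (act l x)"

definition inv_word :: "(move \<times> bool) list \<Rightarrow> (move \<times> bool) list" where
  "inv_word ws = rev (map (\<lambda>(a, s). (a, \<not> s)) ws)"

definition words :: "(move \<times> bool) list set" where
  "words = {ws. \<forall>l\<in>set ws. fst l \<in> moves}"

lemma N_gt: "N > 0" "N > 1" "N \<ge> 2" "P \<ge> 1" "P > 0" "N \<noteq> 0"
  using p_pos by (auto simp: N_def)

lemma N_neq_0 [simp]: "N \<noteq> 0"
  using N_gt by simp

lemma P_eq: "P = N - 1"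
  by (simp add: N_def)

lemma merge_expand [simp]: "merge i (expand i x) = x"
proof -
  consider "x \<le> i" | "x > i" "x \<le> i + 1" | "x > i + 1" by linarith
  then show ?thesis
  proof cases
    case 2
    then have "0 < (x - i) * N" "(x - i) * N \<le> 1 * N"
      using N_gt by (auto intro!: mult_right_mono)
    moreover from this have "\<not> (x - i) * N \<le> 0" by linarith
    ultimately show ?thesis using 2 N_gt by (auto simp: merge_def expand_def P_eq)
  qed (use N_gt in \<open>auto simp: merge_def expand_def P_eq\<close>)
qed

lemma expand_merge [simp]: "expand i (merge i x) = x"
proof -
  consider "x \<le> i" | "x > i" "x \<le> i + N" | "x > i + N" by linarith
  then show ?thesis
  proof cases
    case 2
    then have "0 < (x - i) / N" "(x - i) / N \<le> 1" using N_gt by (auto simp: field_simps)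
    then have "\<not> (x - i) / N \<le> 0" by linarith
    with 2 N_gt \<open>(x - i) / N \<le> 1\<close> show ?thesis by (auto simp: merge_def expand_def P_eq)
  qed (use N_gt in \<open>auto simp: merge_def expand_def P_eq\<close>)
qed

lemma merge_strict_mono: "x < y \<Longrightarrow> merge i x < merge i y"
proof -
  assume xy: "x < y"
  have a: "z > i \<Longrightarrow> z \<le> i + N \<Longrightarrow> merge i z > i \<and> merge i z \<le> i + 1" for z :: real
    using N_gt by (auto simp: merge_def field_simps)
  have b: "z > i + N \<Longrightarrow> merge i z > i + 1" for z :: real
    using N_gt by (auto simp: merge_def P_eq)
  have c: "z \<le> i \<Longrightarrow> merge i z = z" for z :: real by (auto simp: merge_def)
  consider "y \<le> i" | "x \<le> i" "y > i" | "x > i" "y \<le> i + N" | "x > i" "x \<le> i + N" "y > i + N" | "x > i + N" 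
    by linarith
  then show ?thesis
  proof cases
    case 1 then show ?thesis using xy c by auto
  next
    case 2 then show ?thesis using c[of x] a[of y] b[of y] by linarith
  next
    case 3 then show ?thesis using xy N_gt by (auto simp: merge_def divide_strict_right_mono)
  next
    case 4 then show ?thesis using a[of x] b[of y] by linarith
  next
    case 5 then show ?thesis using xy N_gt by (auto simp: merge_def)
  qed
qed

lemma fwd_bwd [simp]: "fwd a (bwd a x) = x" "bwd a (fwd a x) = x"
  by (cases a; simp)+

lemma fwd_less: "x < y \<Longrightarrow> fwd a x < fwd a y"
  by (cases a) (auto simp: merge_strict_mono)

lemma fwd_le_iff [simp]: "fwd a x \<le> fwd a y \<longleftrightarrow> x \<le> y"
  using fwd_less[of x y a] fwd_less[of y x a] by (cases x y rule: linorder_cases) auto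

lemma bwd_le_iff [simp]: "bwd a x \<le> bwd a y \<longleftrightarrow> x \<le> y"
  using fwd_le_iff[of a "bwd a x" "bwd a y"] by (simp del: fwd_le_iff)

lemma merge_le_iff [simp]: "merge i x \<le> merge i y \<longleftrightarrow> x \<le> y"
  using fwd_le_iff[of "Merge i"] by simp

lemma expand_le_iff [simp]: "expand i x \<le> expand i y \<longleftrightarrow> x \<le> y"
  using bwd_le_iff[of "Merge i"] by simp

lemma act_le_iff [simp]: "act l x \<le> act l y \<longleftrightarrow> x \<le> y"
  by (simp add: act_def)

lemma act_flip [simp]: "act (a, \<not> s) (act (a, s) x) = x"
  by (simp add: act_def)

lemma wact_append [simp]: "wact (vs @ ws) x = wact ws (wact vs x)"
  by (induction vs arbitrary: x) auto

lemma wact_le_iff [simp]: "wact ws x \<le> wact ws y \<longleftrightarrow> x \<le> y"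
  by (induction ws arbitrary: x y) auto

lemma wact_eq_iff [simp]: "wact ws x = wact ws y \<longleftrightarrow> x = y"
  by (metis wact_le_iff order_antisym order_refl)

lemma wact_inv_word [simp]: "wact (inv_word ws) (wact ws x) = x"
  by (induction ws arbitrary: x) (auto simp: inv_word_def)

lemma inv_word_inv_word [simp]: "inv_word (inv_word ws) = ws"
  by (simp add: inv_word_def rev_map comp_def case_prod_beta)

lemma wact_inv_word' [simp]: "wact ws (wact (inv_word ws) x) = x"
  using wact_inv_word[of "inv_word ws"] by simp

lemma words_simps [simp]:
  "[] \<in> words" "l # ws \<in> words \<longleftrightarrow> fst l \<in> moves \<and> ws \<in> words"
  "vs @ ws \<in> words \<longleftrightarrow> vs \<in> words \<and> ws \<in> words"
  by (auto simp: words_def)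

lemma inv_word_words: "ws \<in> words \<Longrightarrow> inv_word ws \<in> words"
  by (simp add: words_def inv_word_def case_prod_beta)

section \<open>Stops\<close>

text \<open>The exponent \<open>k\<close> measures how deep below the roots a stop may lie. Recursions on stops use that expanding
the tree around a stop decreases it.\<close>

definition stops_upto :: "nat \<Rightarrow> real set" where
  "stops_upto k = {P * of_int b / N ^ k | b. True}"

definition stops :: "real set" where "stops = (\<Union>k. stops_upto k)"

lemma stops_upto_Suc: "x \<in> stops_upto k \<Longrightarrow> x \<in> stops_upto (Suc k)"
proof -
  assume "x \<in> stops_upto k"
  then obtain b where b: "x = P * of_int b / N ^ k" by (auto simp: stops_upto_def)
  have "x = P * of_int (b * (int p + 1)) / N ^ Suc k"
    unfolding b using N_gt by (simp add: field_simps) (simp add: N_def field_simps)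
  then show ?thesis unfolding stops_upto_def by blast
qed

lemma stops_upto_mono: "k \<le> l \<Longrightarrow> x \<in> stops_upto k \<Longrightarrow> x \<in> stops_upto l"
  by (induction l rule: dec_induct) (auto intro: stops_upto_Suc)

lemma stops_upto_shift: "x \<in> stops_upto k \<Longrightarrow> x + P * of_int q \<in> stops_upto k"
proof -
  assume "x \<in> stops_upto k"
  then obtain b where b: "x = P * of_int b / N ^ k" by (auto simp: stops_upto_def)
  have "x + P * of_int q = P * of_int (b + q * (int p + 1) ^ k) / N ^ k"
    unfolding b using N_gt by (simp add: field_simps) (simp add: N_def field_simps)
  then show ?thesis unfolding stops_upto_def by blast
qed

lemma stops_upto_sub: "x \<in> stops_upto k \<Longrightarrow> x - P \<in> stops_upto k"
  using stops_upto_shift[of x k "-1"] by simp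

lemma stops_upto_add: "x \<in> stops_upto k \<Longrightarrow> x + P \<in> stops_upto k"
  using stops_upto_shift[of x k "1"] by simp

lemma stops_upto_div: "x \<in> stops_upto k \<Longrightarrow> x / N \<in> stops_upto (Suc k)"
  by (auto simp: stops_upto_def mult.commute)

lemma stops_upto_scale:
  assumes "x \<in> stops_upto k"
  shows "of_int i + (x - of_int i) / N \<in> stops_upto (Suc k)"
proof -
  have eq: "of_int i + (x - of_int i) / N = (x + P * of_int i) / N"
    unfolding P_eq using N_gt(1) by (simp add: diff_divide_distrib add_divide_distrib left_diff_distrib)
  show ?thesis unfolding eq by (intro stops_upto_div stops_upto_shift assms)
qed

lemma stops_upto_unscale:
  assumes "x \<in> stops_upto k"
  shows "of_int i + (x - of_int i) * N \<in> stops_upto k" and "k > 0 \<Longrightarrow> of_int i + (x - of_int i) * N \<in> stops_upto (k - 1)"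
proof -
  obtain b where b: "x = P * of_int b / N ^ k" using assms by (auto simp: stops_upto_def)
  have eq: "of_int i + (x - of_int i) * N = x * N + P * of_int (- i)"
    by (simp add: N_def algebra_simps)
  have "x * N = P * of_int (b * (int p + 1)) / N ^ k"
    unfolding b by (simp add: N_def field_simps)
  then have "x * N \<in> stops_upto k" unfolding stops_upto_def by blast
  then show "of_int i + (x - of_int i) * N \<in> stops_upto k" unfolding eq by (rule stops_upto_shift)
  assume "k > 0"
  then obtain l where l: "k = Suc l" by (cases k) auto
  have "x * N = P * of_int b / N ^ l" unfolding b l using N_gt by simp
  then have "x * N \<in> stops_upto l" unfolding stops_upto_def by blast
  then show "of_int i + (x - of_int i) * N \<in> stops_upto (k - 1)" unfolding eq l diff_Suc_1 by (rule stops_upto_shift)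
qed

lemma stops_upto_merge: "x \<in> stops_upto k \<Longrightarrow> merge i x \<in> stops_upto (Suc k)"
  using stops_upto_scale[of x k i] stops_upto_Suc[of x k] stops_upto_Suc[of "x - P" k] stops_upto_sub[of x k] by (auto simp: merge_def)

lemma stops_upto_expand: "x \<in> stops_upto k \<Longrightarrow> expand i x \<in> stops_upto k"
  using stops_upto_unscale(1)[of x k i] stops_upto_add[of x k] by (auto simp: expand_def)

lemma stops_upto_fwd: "x \<in> stops_upto k \<Longrightarrow> fwd a x \<in> stops_upto (Suc k)"
  by (cases a) (auto simp: stops_upto_merge stops_upto_sub intro: stops_upto_Suc)

lemma stops_upto_bwd: "x \<in> stops_upto k \<Longrightarrow> bwd a x \<in> stops_upto k"
  by (cases a) (auto simp: stops_upto_expand stops_upto_add)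

lemma stops_fwd [simp]: "fwd a x \<in> stops \<longleftrightarrow> x \<in> stops"
  using stops_upto_fwd[of x _ a] stops_upto_bwd[of "fwd a x" _ a] by (auto simp: stops_def)

lemma stops_bwd [simp]: "bwd a x \<in> stops \<longleftrightarrow> x \<in> stops"
  using stops_fwd[of a "bwd a x"] by (simp del: stops_fwd)

lemma stops_act [simp]: "act l x \<in> stops \<longleftrightarrow> x \<in> stops"
  by (simp add: act_def)

lemma stops_wact [simp]: "wact ws x \<in> stops \<longleftrightarrow> x \<in> stops"
  by (induction ws arbitrary: x) auto

lemma stops_multiple [simp]: "P * of_int q \<in> stops"
proof -
  have "P * of_int q \<in> stops_upto 0" by (auto simp: stops_upto_def)
  then show ?thesis by (auto simp: stops_def)
qed

lemma stops_mult_p [simp]: "P \<in> stops" "2 * P \<in> stops" "0 \<in> stops"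
  using stops_multiple[of 1] stops_multiple[of 2] stops_multiple[of 0] by (simp_all add: mult.commute)

lemma coprime_N: "coprime (int p) ((int p + 1) ^ k)"
  by (simp add: coprime_power_right_iff)

lemma stops_fracD:
  assumes "of_int a / N ^ k \<in> stops"
  shows "int p dvd a"
proof -
  obtain l b where "of_int a / N ^ k = P * of_int b / N ^ l" using assms by (auto simp: stops_def stops_upto_def)
  then have "of_int a * N ^ l = P * of_int b * N ^ k" using N_gt by (simp add: field_simps)
  then have "real_of_int (a * (int p + 1) ^ l) = real_of_int (int p * b * (int p + 1) ^ k)"
    by (simp add: N_def)
  then have "a * (int p + 1) ^ l = int p * b * (int p + 1) ^ k" by (simp only: of_int_eq_iff)
  then have "int p dvd a * (int p + 1) ^ l" by simp
  then show ?thesis using coprime_N coprime_dvd_mult_left_iff by blast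
qed

lemma stops_int: "of_int a \<in> stops \<Longrightarrow> int p dvd a"
  using stops_fracD[of a 0] by simp

text \<open>Because of \<open>N = 1\<close> modulo \<open>p\<close>, an integer is a stop only if it is a multiple of \<open>p\<close>. So a stop strictly
between two multiples of \<open>p\<close> is interior to a tree.\<close>

lemma stops_noninteger:
  assumes "e \<in> stops" "0 < e" "e < P"
  shows "of_int \<lfloor>e\<rfloor> < e" "e < of_int \<lfloor>e\<rfloor> + 1" "0 \<le> \<lfloor>e\<rfloor>" "\<lfloor>e\<rfloor> < int p"
proof -
  show b: "0 \<le> \<lfloor>e\<rfloor>" "\<lfloor>e\<rfloor> < int p" "e < of_int \<lfloor>e\<rfloor> + 1" using assms by linarith+
  have "of_int \<lfloor>e\<rfloor> \<noteq> e"
  proof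
    assume eq: "of_int \<lfloor>e\<rfloor> = e"
    then have "int p dvd \<lfloor>e\<rfloor>" using assms(1) stops_int by metis
    with b have "\<lfloor>e\<rfloor> = 0" using zdvd_not_zless[of "\<lfloor>e\<rfloor>" "int p"] by linarith
    with eq assms(2) show False by simp
  qed
  then show "of_int \<lfloor>e\<rfloor> < e" using of_int_floor_le[of e] by linarith
qed

lemma stops_upto_subset: "x \<in> stops_upto k \<Longrightarrow> x \<in> stops" by (auto simp: stops_def)

lemma stops_upto_0: "e \<in> stops_upto 0 \<Longrightarrow> 0 \<le> e \<Longrightarrow> e < P \<Longrightarrow> e = 0"
proof (rule ccontr)
  assume e: "e \<in> stops_upto 0" "0 \<le> e" "e < P" "e \<noteq> 0"
  then obtain b where "e = of_int (int p * b)" by (auto simp: stops_upto_def)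
  moreover have "of_int \<lfloor>e\<rfloor> < e" using e by (intro stops_noninteger) (auto simp: stops_def)
  ultimately show False by (simp only: floor_of_int)
qed

lemma expand_interior:
  assumes "e \<in> stops_upto (Suc k)" "0 < e" "e < P"
  shows "expand \<lfloor>e\<rfloor> e \<in> stops_upto k" "of_int \<lfloor>e\<rfloor> < expand \<lfloor>e\<rfloor> e" "expand \<lfloor>e\<rfloor> e < of_int \<lfloor>e\<rfloor> + N" 
    "expand \<lfloor>e\<rfloor> e < 2 * P"
proof -
  note j = stops_noninteger[OF stops_upto_subset[OF assms(1)] assms(2,3)]
  have eq: "expand \<lfloor>e\<rfloor> e = of_int \<lfloor>e\<rfloor> + (e - of_int \<lfloor>e\<rfloor>) * N"
    using j by (auto simp: expand_def)
  show "expand \<lfloor>e\<rfloor> e \<in> stops_upto k" unfolding eq using stops_upto_unscale(2)[OF assms(1)] by simp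
  show "of_int \<lfloor>e\<rfloor> < expand \<lfloor>e\<rfloor> e" unfolding eq using j N_gt by simp
  have "e - of_int \<lfloor>e\<rfloor> < 1" using j by linarith
  from mult_strict_right_mono[OF this N_gt(1)]
  show l: "expand \<lfloor>e\<rfloor> e < of_int \<lfloor>e\<rfloor> + N" unfolding eq by simp
  have "of_int \<lfloor>e\<rfloor> \<le> P - 1" using j(4) by linarith
  with l show "expand \<lfloor>e\<rfloor> e < 2 * P" by (simp add: N_def)
qed

section \<open>What a stop leaves on its right and on its left\<close>

text \<open>Fix a stop \<open>e\<close> in \<open>[0, p)\<close>. The map \<open>right_rest k e\<close> straightens what the stop leaves on its right: it
sends \<open>[e, \<infinity>)\<close> to \<open>[0, \<infinity>)\<close>. If \<open>e > 0\<close>, the stop lies inside the tree over \<open>[j, j + 1]\<close>;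
expanding this tree moves \<open>e\<close> to \<open>e'\<close>. The root that is removed owns the stop \<open>p\<close>. If \<open>e' < p\<close>, that
stop lies to the right of \<open>e\<close>, and the root is put back at the same index after the recursive
call. Otherwise it lies at \<open>e\<close> or to its left, and the root disappears from the right side.

Similarly \<open>left_rest k e\<close>, for a stop \<open>e\<close> in \<open>(0, p]\<close>, sends \<open>(-\<infinity>, e]\<close> to \<open>(-\<infinity>, p]\<close>, and here the root
is put back if its stop is to the left of \<open>e\<close>. In both cases \<open>k\<close> bounds the depth of the stop,
and the values do not depend on the bound.\<close>

primrec right_rest :: "nat \<Rightarrow> real \<Rightarrow> real \<Rightarrow> real" where
  "right_rest 0 e t = t"
| "right_rest (Suc k) e t = (if e = 0 then t else
     (let j = \<lfloor>e\<rfloor>; e' = expand j e in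
      if e' < P then merge j (right_rest k e' (expand j t)) else right_rest k (e' - P) (expand j t - P)))"

primrec left_rest :: "nat \<Rightarrow> real \<Rightarrow> real \<Rightarrow> real" where
  "left_rest 0 e t = t"
| "left_rest (Suc k) e t = (if e = P then t else
     (let j = \<lfloor>e\<rfloor>; e' = expand j e in
      if e' \<le> P then left_rest k e' (expand j t) else merge j (P + left_rest k (e' - P) (expand j t - P))))"

lemma right_rest_0 [simp]: "right_rest k 0 t = t"
  by (cases k) auto

lemma left_rest_P [simp]: "left_rest k P t = t"
  by (cases k) auto

lemma expand_less: "t \<le> of_int i \<Longrightarrow> expand i t = t"
  by (simp add: expand_def)

lemma expand_ge: "t \<ge> of_int i + 1 \<Longrightarrow> expand i t = t + P"
  by (cases "t = of_int i + 1") (auto simp: expand_def N_def)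

lemma merge_less: "t \<le> of_int i \<Longrightarrow> merge i t = t"
  by (simp add: merge_def)

lemma merge_ge: "t \<ge> of_int i + N \<Longrightarrow> merge i t = t - P"
  using N_gt by (cases "t = of_int i + N") (auto simp: merge_def N_def)

lemma right_rest_mono: "t \<le> u \<Longrightarrow> right_rest k e t \<le> right_rest k e u"
  by (induction k arbitrary: e t u) (auto simp: Let_def)

lemma left_rest_mono: "t \<le> u \<Longrightarrow> left_rest k e t \<le> left_rest k e u"
  by (induction k arbitrary: e t u) (auto simp: Let_def)

text \<open>Trees further to the right keep their index: the roots that the recursion puts back leave exactly
\<open>\<lfloor>e\<rfloor> + 1\<close> trees of the part that is cut.\<close>

lemma right_rest_id: "e \<in> stops_upto k \<Longrightarrow> 0 \<le> e \<Longrightarrow> e < P \<Longrightarrow> t \<ge> of_int \<lfloor>e\<rfloor> + 1 \<Longrightarrow> right_rest k e t = t"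
proof (induction k arbitrary: e t)
  case (Suc k)
  show ?case
  proof (cases "e = 0")
    case False
    then have e: "0 < e" using Suc.prems by simp
    let ?j = "\<lfloor>e\<rfloor>" and ?e = "expand \<lfloor>e\<rfloor> e"
    note i = expand_interior[OF Suc.prems(1) e Suc.prems(3)]
    note j = stops_noninteger[OF stops_upto_subset[OF Suc.prems(1)] e Suc.prems(3)]
    have t: "expand ?j t = t + P" using Suc.prems by (simp add: expand_ge)
    have j0: "0 \<le> real_of_int ?j" "real_of_int ?j + 1 \<le> P" using j by linarith+
    show ?thesis
    proof (cases "?e < P")
      case True
      have "right_rest k ?e (t + P) = t + P"
        using True i j0 Suc.prems(4) by (intro Suc.IH) linarith+
      moreover have "merge ?j (t + P) = t" using Suc.prems(4) by (subst merge_ge) (auto simp: N_def)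
      ultimately show ?thesis using False True t by (simp add: Let_def)
    next
      case False2: False
      have "?e - P < of_int ?j + 1" using i by (simp add: N_def)
      then have "\<lfloor>?e - P\<rfloor> \<le> ?j" by linarith
      then have "right_rest k (?e - P) t = t"
        using False2 i j0 Suc.prems(4) by (intro Suc.IH stops_upto_sub) linarith+
      then show ?thesis using False False2 t by (simp add: Let_def)
    qed
  qed simp
qed simp

lemma left_rest_id: "e \<in> stops_upto k \<Longrightarrow> 0 < e \<Longrightarrow> e \<le> P \<Longrightarrow> t \<le> of_int \<lfloor>e\<rfloor> \<Longrightarrow> left_rest k e t = t"
proof (induction k arbitrary: e t)
  case (Suc k)
  show ?case
  proof (cases "e = P")
    case False
    then have e: "e < P" using Suc.prems by simp
    let ?j = "\<lfloor>e\<rfloor>" and ?e = "expand \<lfloor>e\<rfloor> e"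
    note i = expand_interior[OF Suc.prems(1,2) e]
    note j = stops_noninteger[OF stops_upto_subset[OF Suc.prems(1)] Suc.prems(2) e]
    have t: "expand ?j t = t" using Suc.prems by (simp add: expand_less)
    have j0: "0 \<le> real_of_int ?j" "real_of_int ?j + 1 \<le> P" using j by linarith+
    show ?thesis
    proof (cases "?e \<le> P")
      case True
      have "?j \<le> \<lfloor>?e\<rfloor>" using i by linarith
      then have "left_rest k ?e t = t"
        using True i j0 Suc.prems(4) by (intro Suc.IH) linarith+
      then show ?thesis using False True t by (simp add: Let_def)
    next
      case False2: False
      have "0 \<le> \<lfloor>?e - P\<rfloor>" using False2 by linarith
      then have "left_rest k (?e - P) (t - P) = t - P"
        using False2 i j0 Suc.prems(4) by (intro Suc.IH stops_upto_sub) linarith+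
      then show ?thesis using False False2 t Suc.prems(4) by (simp add: Let_def merge_less)
    qed
  qed simp
qed simp

lemma right_rest_Suc: "e \<in> stops_upto k \<Longrightarrow> 0 \<le> e \<Longrightarrow> e < P \<Longrightarrow> right_rest (Suc k) e t = right_rest k e t"
proof (induction k arbitrary: e t)
  case 0
  then show ?case using stops_upto_0 by auto
next
  case (Suc k)
  show ?case
  proof (cases "e = 0")
    case False
    then have e: "0 < e" using Suc.prems by simp
    note i = expand_interior[OF Suc.prems(1) e Suc.prems(3)]
    note j = stops_noninteger[OF stops_upto_subset[OF Suc.prems(1)] e Suc.prems(3)]
    let ?j = "\<lfloor>e\<rfloor>" and ?e = "expand \<lfloor>e\<rfloor> e"
    have j0: "0 \<le> real_of_int ?j" using j by linarith
    have A: "right_rest (Suc k) ?e s = right_rest k ?e s" if "?e < P" for s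
      using i j0 that by (intro Suc.IH) linarith+
    have B: "right_rest (Suc k) (?e - P) s = right_rest k (?e - P) s" if "\<not> ?e < P" for s
      using i j0 that by (intro Suc.IH stops_upto_sub) linarith+
    show ?thesis using False A B by (simp add: right_rest.simps(2)[of "Suc k"] right_rest.simps(2)[of k e] Let_def del: right_rest.simps)
  qed simp
qed

lemma left_rest_Suc: "e \<in> stops_upto k \<Longrightarrow> 0 < e \<Longrightarrow> e \<le> P \<Longrightarrow> left_rest (Suc k) e t = left_rest k e t"
proof (induction k arbitrary: e t)
  case 0
  then have "e = P" using stops_upto_0[of e] by (cases "e = P") auto
  then show ?case by simp
next
  case (Suc k)
  show ?case
  proof (cases "e = P")
    case False
    then have e: "e < P" using Suc.prems by simp
    note i = expand_interior[OF Suc.prems(1,2) e]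
    note j = stops_noninteger[OF stops_upto_subset[OF Suc.prems(1)] Suc.prems(2) e]
    let ?j = "\<lfloor>e\<rfloor>" and ?e = "expand \<lfloor>e\<rfloor> e"
    have j0: "0 \<le> real_of_int ?j" using j by linarith
    have A: "left_rest (Suc k) ?e s = left_rest k ?e s" if "?e \<le> P"  for s
      using i j0 that by (intro Suc.IH) linarith+
    have B: "left_rest (Suc k) (?e - P) s = left_rest k (?e - P) s" if "\<not> ?e \<le> P" for s
      using i j0 that by (intro Suc.IH stops_upto_sub) linarith+
    show ?thesis using False A B by (simp add: left_rest.simps(2)[of "Suc k"] left_rest.simps(2)[of k e] Let_def del: left_rest.simps)
  qed simp
qed

lemma right_rest_level: "k \<le> l \<Longrightarrow> e \<in> stops_upto k \<Longrightarrow> 0 \<le> e \<Longrightarrow> e < P \<Longrightarrow> right_rest l e t = right_rest k e t"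
  by (induction l rule: dec_induct) (simp_all add: right_rest_Suc stops_upto_mono del: right_rest.simps)

lemma left_rest_level: "k \<le> l \<Longrightarrow> e \<in> stops_upto k \<Longrightarrow> 0 < e \<Longrightarrow> e \<le> P \<Longrightarrow> left_rest l e t = left_rest k e t"
  by (induction l rule: dec_induct) (simp_all add: left_rest_Suc stops_upto_mono del: left_rest.simps)

text \<open>The map \<open>right_part d\<close> straightens \<open>[d, \<infinity>)\<close> for an arbitrary stop. On the right side of the stop the
pointer is at \<open>0\<close>; if the pointer is to the left of the stop, it is drawn at the left end. For
\<open>left_part d\<close> the pointer is drawn \<open>p\<close> trees before the right end if it is further to the right,
as this is the last position from which it acts on the left side.\<close>

definition right_part :: "real \<Rightarrow> real \<Rightarrow> real" where
  "right_part d t = (let q = \<lfloor>d / P\<rfloor> in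
     right_rest (LEAST k. d \<in> stops_upto k) (d - P * q) (t - P * q) + min 0 (P * q))"

definition left_part :: "real \<Rightarrow> real \<Rightarrow> real" where
  "left_part d t = (let q = \<lceil>d / P\<rceil> - 1 in
     left_rest (LEAST k. d \<in> stops_upto k) (d - P * q) (t - P * q) + max 0 (P * q))"

lemma right_part_eq:
  assumes "d \<in> stops_upto k" "P * of_int q \<le> d" "d < P * of_int q + P"
  shows "right_part d t = right_rest k (d - P * q) (t - P * q) + min 0 (P * q)"
proof -
  have q: "\<lfloor>d / P\<rfloor> = q"
    using assms(2,3) N_gt(5) by (intro floor_unique) (auto simp: field_simps)
  let ?l = "LEAST k. d \<in> stops_upto k"
  have l: "d \<in> stops_upto ?l" "?l \<le> k" using assms(1) by (auto intro: LeastI Least_le)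
  have "d + P * of_int (- q) \<in> stops_upto ?l" by (rule stops_upto_shift) (rule l)
  then have "d - P * q \<in> stops_upto ?l" by simp
  then have "right_rest k (d - P * q) s = right_rest ?l (d - P * q) s" for s
    using l(2) assms by (intro right_rest_level) auto
  then show ?thesis by (simp add: right_part_def q)
qed

lemma left_part_eq:
  assumes "d \<in> stops_upto k" "P * of_int q < d" "d \<le> P * of_int q + P"
  shows "left_part d t = left_rest k (d - P * q) (t - P * q) + max 0 (P * q)"
proof -
  have q: "\<lceil>d / P\<rceil> = q + 1"
    using assms(2,3) N_gt(5) by (intro ceiling_unique) (auto simp: field_simps)
  let ?l = "LEAST k. d \<in> stops_upto k"
  have l: "d \<in> stops_upto ?l" "?l \<le> k" using assms(1) by (auto intro: LeastI Least_le)
  have "d + P * of_int (- q) \<in> stops_upto ?l" by (rule stops_upto_shift) (rule l)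
  then have "d - P * q \<in> stops_upto ?l" by simp
  then have "left_rest k (d - P * q) s = left_rest ?l (d - P * q) s" for s
    using l(2) assms by (intro left_rest_level) auto
  then show ?thesis by (simp add: left_part_def q)
qed

lemma block_exists: "\<exists>q. P * of_int q \<le> d \<and> d < P * of_int q + P"
  using floor_divide_lower[OF N_gt(5), of d] floor_divide_upper[OF N_gt(5), of d]
  by (intro exI[of _ "\<lfloor>d / P\<rfloor>"]) (auto simp: algebra_simps)

lemma block_exists': "\<exists>q. P * of_int q < d \<and> d \<le> P * of_int q + P"
  using ceiling_divide_lower[OF N_gt(5), of d] ceiling_divide_upper[OF N_gt(5), of d]
  by (intro exI[of _ "\<lceil>d / P\<rceil> - 1"]) (auto simp: algebra_simps)

lemma mult_P_cases: "(q::int) \<le> -1 \<and> P * q \<le> - P \<or> q = 0 \<and> P * q = 0 \<or> q \<ge> 1 \<and> P * q \<ge> P"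
proof -
  consider "q \<le> -1" | "q = 0" | "q \<ge> 1" by linarith
  then show ?thesis
  proof cases
    case 1
    then have "P * q \<le> P * (-1)" using N_gt by (intro mult_left_mono) auto
    with 1 show ?thesis by simp
  next
    case 3
    then have "P * 1 \<le> P * q" using N_gt by (intro mult_left_mono) auto
    with 3 show ?thesis by simp
  qed simp
qed

lemma mult_P_ge2: "(q::int) \<ge> 2 \<Longrightarrow> P * q \<ge> 2 * P"
  using mult_left_mono[of 2 "real_of_int q" P] N_gt(5) by (simp add: mult.commute)

lemma interior_merge:
  assumes "of_int i < d" "d < of_int i + N"
  shows "of_int i < merge i d" "merge i d < of_int i + 1" "\<lfloor>merge i d\<rfloor> = i"
proof -
  show A: "of_int i < merge i d" "merge i d < of_int i + 1"
    using assms N_gt by (auto simp: merge_def field_simps)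
  then show "\<lfloor>merge i d\<rfloor> = i" by (intro floor_unique) linarith+
qed

text \<open>A move that is performed while the stop is below \<open>p\<close> acts in the same way on the right side, and one that
is performed while the stop is at \<open>p\<close> or above is invisible there. For a merge of the trees around the stop
this is the recursion that defines \<open>right_rest\<close>.\<close>

lemma right_part_fwd:
  assumes "a \<in> moves" "d \<in> stops" "d \<le> t"
  shows "right_part (fwd a d) (fwd a t) = (if d < P then fwd a (right_part d t) else right_part d t)"
proof -
  obtain k where k: "d \<in> stops_upto k" using assms(2) by (auto simp: stops_def)
  obtain q where q: "P * of_int q \<le> d" "d < P * of_int q + P" using block_exists by blast
  have eq: "right_part d s = right_rest k (d - P * q) (s - P * q) + min 0 (P * q)" for s
    using right_part_eq[OF k q] .
  note qc = mult_P_cases[of q]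
  show ?thesis
  proof (cases a)
    case Shift
    have "right_part (d - P) (t - P) = right_rest k (d - P - P * of_int (q - 1)) (t - P - P * of_int (q - 1)) + min 0 (P * of_int (q - 1))"
      using q by (intro right_part_eq stops_upto_sub k) (auto simp: algebra_simps)
    also have "\<dots> = right_rest k (d - P * q) (t - P * q) + min 0 (P * q - P)"
      by (simp add: algebra_simps)
    finally have *: "right_part (d - P) (t - P) = right_rest k (d - P * q) (t - P * q) + min 0 (P * q - P)" .
    consider "P * q \<le> 0" "d < P" | "P * q \<ge> P" "\<not> d < P" using qc q N_gt(5) by (smt (verit))
    then show ?thesis using N_gt(5) unfolding Shift fwd.simps * eq by cases auto
  next
    case (Merge i)
    then have i: "0 \<le> i" "i < int p" using assms(1) by (auto simp: moves_def)
    then have i': "0 \<le> real_of_int i" "real_of_int i + 1 \<le> P" by linarith+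
    consider "d < 0" | "0 \<le> d" "d \<le> i" | "of_int i < d" "d < P" | "P \<le> d" "d < i + N" | "d \<ge> i + N"
      by linarith
    then show ?thesis
    proof cases
      case 1
      then have q1: "q \<le> -1" "P * q \<le> - P" using qc q N_gt(5) by (smt (verit))+
      have e: "d - P * q \<in> stops_upto k" using stops_upto_shift[OF k, of "-q"] by simp
      have fl: "of_int \<lfloor>d - P * q\<rfloor> + 1 \<le> P" 
      proof -
        have "\<lfloor>d - P * q\<rfloor> < int p" using q(2) by linarith
        then show ?thesis by linarith
      qed
      have X: "right_part d s = s" if "s \<ge> 0" for s
      proof -
        have "right_rest k (d - P * q) (s - P * q) = s - P * q"
          using e q fl that q1 by (intro right_rest_id) linarith+
        then show ?thesis using q1 N_gt by (simp add: eq min_def)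
      qed
      have d: "merge i d = d" using 1 i' by (intro merge_less) linarith
      show ?thesis
      proof (cases "t \<ge> 0")
        case True
        then have "merge i t \<ge> merge i 0" by simp
        then have "merge i t \<ge> 0" using i' by (simp add: merge_less)
        then show ?thesis using X True d 1 Merge N_gt(5) by simp
      next
        case False
        have "right_part d t \<le> right_part d 0" unfolding eq using False by (intro add_right_mono right_rest_mono) simp
        then have "right_part d t \<le> 0" using X[of 0] by simp
        then show ?thesis using False d 1 Merge N_gt(5) i' by (simp add: merge_less)
      qed
    next
      case 2
      then have q0: "q = 0" using qc q i' by (smt (verit))
      have d: "merge i d = d" using 2 by (simp add: merge_less)
      have lt: "d < P" using 2 i' by linarith
      show ?thesis
      proof (cases "d = 0")
        case True
        then show ?thesis using d lt q0 eq[of t] eq[of "merge i t"] by (simp add: Merge)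
      next
        case False
        then have "0 < d" using 2 by simp
        note j = stops_noninteger[OF assms(2) this lt]
        have "\<lfloor>d\<rfloor> < i" using 2 j(1) by linarith
        then have ji: "real_of_int \<lfloor>d\<rfloor> + 1 \<le> i" by linarith
        have X: "right_part d s = s" if "s \<ge> of_int \<lfloor>d\<rfloor> + 1" for s
          using that 2 lt k q0 by (simp add: eq right_rest_id)
        show ?thesis
        proof (cases "t \<ge> of_int \<lfloor>d\<rfloor> + 1")
          case True
          then have "merge i t \<ge> merge i (of_int \<lfloor>d\<rfloor> + 1)" by simp
          then have "merge i t \<ge> of_int \<lfloor>d\<rfloor> + 1" using ji by (simp add: merge_less)
          then show ?thesis using X True d lt Merge by simp
        next
          case f: False
          have "right_part d t \<le> right_part d (of_int \<lfloor>d\<rfloor> + 1)" unfolding eq using f by (intro add_right_mono right_rest_mono) simp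
          then have "right_part d t \<le> i" using X[of "of_int \<lfloor>d\<rfloor> + 1"] ji by simp
          then show ?thesis using f d lt Merge ji by (simp add: merge_less)
        qed
      qed
    next
      case 3
      then have q0: "q = 0" using qc q i' by (smt (verit))
      note m = interior_merge[of i d]
      have m': "of_int i < merge i d" "merge i d < of_int i + 1" "\<lfloor>merge i d\<rfloor> = i"
        using 3 i' m by (auto simp: N_def)
      have "right_part (merge i d) s = right_rest (Suc k) (merge i d) s" for s
        using right_part_eq[OF stops_upto_merge[OF k], of 0 i s] m' i' by auto
      also have "right_rest (Suc k) (merge i d) s = merge i (right_rest k d (expand i s))" for s
        using m' i' 3 by (auto simp: Let_def)
      finally show ?thesis using Merge 3 q0 eq by simp
    next
      case 4
      then have q0: "q = 1"
        using qc q i' N_def mult_P_ge2[of q] by (smt (verit))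
      note m = interior_merge[of i d]
      have m': "of_int i < merge i d" "merge i d < of_int i + 1" "\<lfloor>merge i d\<rfloor> = i"
        using 4 i' m by auto
      have "right_part (merge i d) s = right_rest (Suc k) (merge i d) s" for s
        using right_part_eq[OF stops_upto_merge[OF k], of 0 i s] m' i' by auto
      also have "right_rest (Suc k) (merge i d) s = right_rest k (d - P) (expand i s - P)" for s
        using m' i' 4 by (auto simp: Let_def)
      finally show ?thesis using Merge 4 q0 eq N_gt by simp
    next
      case 5
      have g: "q \<ge> 1" "P * q \<ge> P" using 5 i' qc q N_def by (smt (verit))+
      have d: "merge i d = d - P" "merge i t = t - P" using 5 assms(3) by (auto simp: merge_ge)
      have "right_part (d - P) (t - P) = right_rest k (d - P - P * of_int (q - 1)) (t - P - P * of_int (q - 1)) + min 0 (P * of_int (q - 1))"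
        using q by (intro right_part_eq stops_upto_sub k) (auto simp: algebra_simps)
      also have "\<dots> = right_rest k (d - P * q) (t - P * q) + min 0 (P * q - P)"
        by (simp add: algebra_simps)
      finally show ?thesis using d g 5 q N_gt(5) i' unfolding Merge eq by (auto simp: N_def)
    qed
  qed
qed


text \<open>The mirror image of the preceding lemma. At the stop \<open>p\<close> itself the move is invisible on both
sides.\<close>

lemma left_part_fwd:
  assumes "a \<in> moves" "d \<in> stops" "t \<le> d"
  shows "left_part (fwd a d) (fwd a t) = (if d > P then fwd a (left_part d t) else left_part d t)"
proof -
  obtain k where k: "d \<in> stops_upto k" using assms(2) by (auto simp: stops_def)
  obtain q where q: "P * of_int q < d" "d \<le> P * of_int q + P" using block_exists' by blast
  have eq: "left_part d s = left_rest k (d - P * q) (s - P * q) + max 0 (P * q)" for s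
    using left_part_eq[OF k q] .
  note qc = mult_P_cases[of q]
  have prev: "left_part (d - P) s = left_rest k (d - P * q) (s + P - P * q) + max 0 (P * q - P)" for s
  proof -
    have "left_part (d - P) s = left_rest k (d - P - P * of_int (q - 1)) (s - P * of_int (q - 1)) + max 0 (P * of_int (q - 1))"
      using q by (intro left_part_eq stops_upto_sub k) (auto simp: algebra_simps)
    then show ?thesis by (simp add: algebra_simps)
  qed
  show ?thesis
  proof (cases a)
    case Shift
    consider "P * q \<le> 0" "\<not> d > P" | "P * q \<ge> P" "d > P" using qc q N_gt(5) by (smt (verit))
    then show ?thesis using N_gt(5) unfolding Shift fwd.simps prev eq by cases auto
  next
    case (Merge i)
    then have i: "0 \<le> i" "i < int p" using assms(1) by (auto simp: moves_def)
    then have i': "0 \<le> real_of_int i" "real_of_int i + 1 \<le> P" by linarith+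
    consider "d \<le> i" | "of_int i < d" "d \<le> P" | "P < d" "d < i + N" | "d \<ge> i + N"
      by linarith
    then show ?thesis
    proof cases
      case 1
      then have "merge i d = d" "merge i t = t" "\<not> d > P" using assms(3) i' by (auto simp: merge_less)
      then show ?thesis by (simp add: Merge)
    next
      case 2
      then have q0: "P * q = 0" using qc q i' by (smt (verit))
      note m = interior_merge[of i d]
      have m': "of_int i < merge i d" "merge i d < of_int i + 1" "\<lfloor>merge i d\<rfloor> = i"
        using 2 i' m by (auto simp: N_def)
      have "left_part (merge i d) s = left_rest (Suc k) (merge i d) s" for s
        using left_part_eq[OF stops_upto_merge[OF k], of 0 i s] m' i' by auto
      also have "left_rest (Suc k) (merge i d) s = left_rest k d (expand i s)" for s
        using m' i' 2 by (auto simp: Let_def)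
      finally show ?thesis using Merge 2 eq q0 by simp
    next
      case 3
      have q0: "P * q = P"
      proof -
        have "P * q < 2 * P" using q 3 i' unfolding N_def by linarith
        moreover have "P * q > 0" using q 3 by linarith
        ultimately have "q \<ge> 1" "\<not> q \<ge> 2" using qc N_gt(5) mult_P_ge2[of q] by (smt (verit))+
        then have "q = 1" by linarith
        then show ?thesis by simp
      qed
      note m = interior_merge[of i d]
      have m': "of_int i < merge i d" "merge i d < of_int i + 1" "\<lfloor>merge i d\<rfloor> = i"
        using 3 i' m by auto
      have "left_part (merge i d) s = left_rest (Suc k) (merge i d) s" for s
        using left_part_eq[OF stops_upto_merge[OF k], of 0 i s] m' i' by auto
      also have "left_rest (Suc k) (merge i d) s = merge i (P + left_rest k (d - P) (expand i s - P))" for s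
        using m' i' 3 by (auto simp: Let_def)
      finally show ?thesis using Merge 3 eq q0 N_gt by (simp add: add.commute)
    next
      case 4
      then have dP: "d > P" using i' by (simp add: N_def)
      then have g: "q \<ge> 1" "P * q \<ge> P" using qc q N_gt(5) by (smt (verit))+
      have d: "merge i d = d - P" using 4 by (auto simp: merge_ge)
      let ?X = "left_part (d - P)"
      have e: "d - P * q \<in> stops_upto k" using stops_upto_shift[OF k, of "-q"] by simp
      have X: "?X s = s" if "s \<le> of_int i + 1" for s
      proof -
        have "left_rest k (d - P * q) (s + P - P * q) = s + P - P * q"
        proof (cases "d - P * q = P")
          case False
          have "s + P - P * q \<le> of_int \<lfloor>d - P * q\<rfloor>"
          proof (cases "q = 1")
            case True
            then have "i + 1 \<le> \<lfloor>d - P * q\<rfloor>" using 4 unfolding le_floor_iff by (simp add: N_def)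
            then have "of_int (i + 1) \<le> real_of_int \<lfloor>d - P * q\<rfloor>" by (simp only: of_int_le_iff)
            then show ?thesis using that True by simp
          next
            case False
            then have "P * q \<ge> 2 * P" using mult_P_ge2[of q] g by linarith
            moreover have "0 \<le> \<lfloor>d - P * q\<rfloor>" using q by simp
            ultimately show ?thesis using that i' by linarith
          qed
          then show ?thesis using e q by (intro left_rest_id) auto
        qed simp
        then show ?thesis using g by (simp add: prev)
      qed
      have mono: "?X s \<le> ?X u" if "s \<le> u" for s u
        unfolding prev using that by (intro add_right_mono left_rest_mono) simp
      have Ld: "left_part d t = P + ?X (t - P)" unfolding eq prev using g N_gt(5) by simp
      have "?X (merge i t) = merge i (P + ?X (t - P))"
      proof (cases "t \<le> of_int i + N")
        case True
        then have "merge i t \<le> merge i (of_int i + N)" by simp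
        then have "merge i t \<le> of_int i + 1" by (simp add: merge_ge N_def)
        moreover have "t - P \<le> of_int i + 1" using True by (simp add: N_def)
        ultimately show ?thesis using X by simp
      next
        case False
        have "?X (of_int i + 1) \<le> ?X (t - P)" using False by (intro mono) (simp add: N_def)
        then have "?X (t - P) \<ge> of_int i + 1" using X by simp
        then have "merge i (P + ?X (t - P)) = ?X (t - P)" by (subst merge_ge) (auto simp: N_def)
        moreover have "merge i t = t - P" using False by (simp add: merge_ge)
        ultimately show ?thesis by simp
      qed
      then show ?thesis using d dP Ld Merge by simp
    qed
  qed
qed

lemma right_part_multiple:
  "right_part (P * of_int q) t = t - P * of_int q + min 0 (P * of_int q)"
proof -
  have "P * of_int q \<in> stops_upto 0" by (auto simp: stops_upto_def)
  from right_part_eq[OF this, of q t] show ?thesis using N_gt(5) by simp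
qed

lemma left_part_multiple:
  "left_part (P * of_int q) t = t - P * of_int q + max P (P * of_int q)"
proof -
  have "P * of_int q \<in> stops_upto 0" by (auto simp: stops_upto_def)
  from left_part_eq[OF this, of "q - 1" t] show ?thesis using N_gt(5) by (simp add: algebra_simps max_def)
qed

section \<open>Cutting words at a stop\<close>

text \<open>The position of the stop that decides which side a letter belongs to. An inverse move is a move
run backwards, so the position after it counts.\<close>

definition key :: "move \<times> bool \<Rightarrow> real \<Rightarrow> real" where
  "key l d = (if snd l then d else act l d)"

fun right_word :: "real \<Rightarrow> (move \<times> bool) list \<Rightarrow> (move \<times> bool) list" where
  "right_word d [] = []"
| "right_word d (l # ws) = (if key l d < P then [l] else []) @ right_word (act l d) ws"

fun left_word :: "real \<Rightarrow> (move \<times> bool) list \<Rightarrow> (move \<times> bool) list" where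
  "left_word d [] = []"
| "left_word d (l # ws) = (if key l d > P then [l] else []) @ left_word (act l d) ws"

fun crossings :: "real \<Rightarrow> (move \<times> bool) list \<Rightarrow> nat" where
  "crossings d [] = 0"
| "crossings d (l # ws) = (if key l d = P then 1 else 0) + crossings (act l d) ws"

lemma right_word_words [simp]: "ws \<in> words \<Longrightarrow> right_word d ws \<in> words"
  by (induction ws arbitrary: d) auto

lemma left_word_words [simp]: "ws \<in> words \<Longrightarrow> left_word d ws \<in> words"
  by (induction ws arbitrary: d) auto

lemma crossings_append: "crossings d (vs @ ws) = crossings d vs + crossings (wact vs d) ws"
  by (induction vs arbitrary: d) auto

lemma key_mono: "d \<le> e \<Longrightarrow> key l d \<le> key l e"
  by (simp add: key_def)

text \<open>The two stops may be different: a letter cannot belong to the left of \<open>d\<close> and to the right of a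
stop \<open>e \<ge> d\<close>, and if it crosses \<open>d\<close> it does not belong to the right of \<open>e\<close> either.\<close>

lemma length_parts:
  "d \<le> e \<Longrightarrow> length (left_word d ws) + length (right_word e ws) + crossings d ws \<le> length ws"
proof (induction ws arbitrary: d e)
  case (Cons l ws)
  have "act l d \<le> act l e" using Cons.prems by simp
  from Cons.IH[OF this] key_mono[OF Cons.prems, of l] show ?case by auto
qed simp

lemma right_part_act:
  assumes "fst l \<in> moves" "d \<in> stops" "d \<le> t"
  shows "right_part (act l d) (act l t) =
    (if key l d < P then act l (right_part d t) else right_part d t)"
proof (cases "snd l")
  case True
  with right_part_fwd[OF assms] show ?thesis by (simp add: act_def key_def)
next
  case False
  from right_part_fwd[of "fst l" "bwd (fst l) d" "bwd (fst l) t"] assms False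
  show ?thesis by (auto simp: act_def key_def)
qed

lemma left_part_act:
  assumes "fst l \<in> moves" "d \<in> stops" "t \<le> d"
  shows "left_part (act l d) (act l t) =
    (if key l d > P then act l (left_part d t) else left_part d t)"
proof (cases "snd l")
  case True
  with left_part_fwd[OF assms] show ?thesis by (simp add: act_def key_def)
next
  case False
  from left_part_fwd[of "fst l" "bwd (fst l) d" "bwd (fst l) t"] assms False
  show ?thesis by (auto simp: act_def key_def)
qed

lemma right_part_wact:
  "ws \<in> words \<Longrightarrow> d \<in> stops \<Longrightarrow> d \<le> t \<Longrightarrow>
    right_part (wact ws d) (wact ws t) = wact (right_word d ws) (right_part d t)"
  by (induction ws arbitrary: d t) (auto simp: right_part_act)

lemma left_part_wact:
  "ws \<in> words \<Longrightarrow> d \<in> stops \<Longrightarrow> t \<le> d \<Longrightarrow>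
    left_part (wact ws d) (wact ws t) = wact (left_word d ws) (left_part d t)"
  by (induction ws arbitrary: d t) (auto simp: left_part_act)

text \<open>The left end of the right side and the right end of the left side of a stop.\<close>

definition right_edge :: "real \<Rightarrow> real" where "right_edge d = min 0 (P * \<lfloor>d / P\<rfloor>)"
definition left_edge :: "real \<Rightarrow> real" where "left_edge d = max P (P * \<lceil>d / P\<rceil>)"

lemma right_edge_nonneg: "0 \<le> d \<Longrightarrow> right_edge d = 0"
  using N_gt(5) by (simp add: right_edge_def)

lemma left_edge_le: "d \<le> P \<Longrightarrow> left_edge d = P"
proof -
  assume "d \<le> P"
  then have "\<lceil>d / P\<rceil> \<le> 1" using N_gt(5) by (simp add: ceiling_le_iff)
  then have "P * \<lceil>d / P\<rceil> \<le> P * 1" using N_gt(5) by (intro mult_left_mono) auto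
  then show ?thesis by (simp add: left_edge_def)
qed

lemma right_edge_minus: "d < P \<Longrightarrow> right_edge (d - P) = right_edge d - P"
proof -
  assume d: "d < P"
  have "(d - P) / P = d / P - 1" using N_gt(5) by (simp add: field_simps)
  then have "\<lfloor>(d - P) / P\<rfloor> = \<lfloor>d / P\<rfloor> - 1" by simp
  moreover have "\<lfloor>d / P\<rfloor> \<le> 0" using d N_gt(5) by (simp add: floor_le_iff)
  then have "P * \<lfloor>d / P\<rfloor> \<le> 0" using N_gt(5) by (simp add: mult_nonneg_nonpos)
  ultimately show ?thesis using N_gt(5) by (simp add: right_edge_def right_diff_distrib)
qed

lemma left_edge_minus: "d > P \<Longrightarrow> left_edge (d - P) = left_edge d - P"
proof -
  assume d: "d > P"
  have "(d - P) / P = d / P - 1" using N_gt(5) by (simp add: field_simps)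
  then have "\<lceil>(d - P) / P\<rceil> = \<lceil>d / P\<rceil> - 1" by simp
  moreover have "\<lceil>d / P\<rceil> \<ge> 2" using d N_gt(5) by (simp add: le_ceiling_iff)
  then have "P * \<lceil>d / P\<rceil> \<ge> 2 * P" by (rule mult_P_ge2)
  ultimately show ?thesis using N_gt(5) by (simp add: left_edge_def right_diff_distrib)
qed

lemma left_edge_ge: "left_edge d \<ge> d" "d > P \<Longrightarrow> left_edge d \<ge> 2 * P"
proof -
  have "d / P \<le> \<lceil>d / P\<rceil>" by simp
  then have "d / P * P \<le> \<lceil>d / P\<rceil> * P" using N_gt(5) by (intro mult_right_mono) auto
  then have "d \<le> P * \<lceil>d / P\<rceil>" using N_gt(5) by (simp add: mult.commute)
  then show "left_edge d \<ge> d" by (simp add: left_edge_def)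
  assume "d > P"
  then have "\<lceil>d / P\<rceil> \<ge> 2" using N_gt(5) by (simp add: le_ceiling_iff)
  from mult_P_ge2[OF this] show "left_edge d \<ge> 2 * P" by (simp add: left_edge_def)
qed

lemma moves_cases:
  assumes "a \<in> moves"
  obtains "a = Shift" | i where "a = Merge i" "0 \<le> real_of_int i" "real_of_int i + 1 \<le> P" "0 \<le> i" "i < int p"
proof -
  consider "a = Shift" | i where "a = Merge i" "0 \<le> i" "i < int p"
    using assms by (auto simp: moves_def)
  then show thesis
  proof cases
    case 2
    then have "0 \<le> real_of_int i" "real_of_int i + 1 \<le> P" by linarith+
    with 2 that(2) show ?thesis by blast
  qed (use that in blast)
qed

lemma merge_middle:
  assumes "of_int i < d" "d < of_int i + N"
  shows "of_int i < merge i d" "merge i d < of_int i + 1"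
  using interior_merge[OF assms] by auto

lemma right_edge_fwd:
  assumes "a \<in> moves"
  shows "d < P \<Longrightarrow> t \<le> right_edge d \<Longrightarrow> fwd a t = t + (right_edge (fwd a d) - right_edge d)"
    and "d \<ge> P \<Longrightarrow> right_edge (fwd a d) = right_edge d"
proof -
  have e0: "right_edge d \<le> 0" by (simp add: right_edge_def)
  show "fwd a t = t + (right_edge (fwd a d) - right_edge d)" if "d < P" "t \<le> right_edge d"
    using assms
  proof (cases rule: moves_cases)
    case (2 i)
    have "right_edge (merge i d) = right_edge d"
    proof (cases "d \<le> of_int i")
      case False
      then have "merge i d \<ge> merge i i" by (simp del: merge_le_iff add: merge_le_iff)
      then have "merge i d \<ge> 0" using 2 by (simp add: merge_less)
      then show ?thesis using False 2 by (simp add: right_edge_nonneg)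
    qed (simp add: merge_less)
    then show ?thesis using 2 that e0 by (simp add: merge_less)
  qed (use that in \<open>simp add: right_edge_minus\<close>)
  show "right_edge (fwd a d) = right_edge d" if "d \<ge> P"
    using assms
  proof (cases rule: moves_cases)
    case 1
    then show ?thesis using that by (simp add: right_edge_nonneg)
  next
    case (2 i)
    have "merge i d \<ge> merge i i" using 2 that by simp
    then have "merge i d \<ge> 0" using 2 by (simp add: merge_less)
    then show ?thesis using that 2 N_gt(5) by (simp add: right_edge_nonneg)
  qed
qed

lemma left_edge_fwd:
  assumes "a \<in> moves"
  shows "d > P \<Longrightarrow> t \<ge> left_edge d \<Longrightarrow> fwd a t = t + (left_edge (fwd a d) - left_edge d)"
    and "d \<le> P \<Longrightarrow> left_edge (fwd a d) = left_edge d"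
proof -
  show "fwd a t = t + (left_edge (fwd a d) - left_edge d)" if d: "d > P" "t \<ge> left_edge d"
    using assms
  proof (cases rule: moves_cases)
    case (2 i)
    note e = left_edge_ge[of d] left_edge_minus[OF d(1)]
    have "left_edge (merge i d) = left_edge d - P"
    proof (cases "d < of_int i + N")
      case True
      then have "merge i d < of_int i + 1" using d 2 by (intro merge_middle) auto
      then have A: "left_edge (merge i d) = P" using 2 by (simp add: left_edge_le)
      have "d - P \<le> P" using True 2 by (simp add: N_def)
      then show ?thesis using A e(3) by (simp add: left_edge_le)
    qed (simp add: merge_ge e)
    moreover have "t \<ge> of_int i + N" using e(2) d 2 by (simp add: N_def)
    ultimately show ?thesis using 2 by (simp add: merge_ge)
  qed (use d in \<open>simp add: left_edge_minus\<close>)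
  show "left_edge (fwd a d) = left_edge d" if "d \<le> P"
    using assms
  proof (cases rule: moves_cases)
    case 1
    then show ?thesis using that by (simp add: left_edge_le)
  next
    case (2 i)
    have "merge i d \<le> P"
    proof (cases "d \<le> of_int i")
      case True
      then show ?thesis using that by (simp add: merge_less)
    next
      case False
      then have "merge i d < of_int i + 1" using 2 that by (intro merge_middle) (auto simp: N_def)
      then show ?thesis using 2 by simp
    qed
    then show ?thesis using that 2 by (simp add: left_edge_le)
  qed
qed

lemma right_edge_act:
  assumes "fst l \<in> moves"
  shows "key l d < P \<Longrightarrow> t \<le> right_edge d \<Longrightarrow> act l t = t + (right_edge (act l d) - right_edge d)"
    and "key l d \<ge> P \<Longrightarrow> right_edge (act l d) = right_edge d"
proof -
  show "act l t = t + (right_edge (act l d) - right_edge d)" if "key l d < P" "t \<le> right_edge d"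
  proof (cases "snd l")
    case True
    with right_edge_fwd(1)[OF assms] that show ?thesis by (simp add: act_def key_def)
  next
    case False
    let ?a = "fst l" and ?s = "t + (right_edge (bwd (fst l) d) - right_edge d)"
    have "fwd ?a ?s = ?s + (right_edge (fwd ?a (bwd ?a d)) - right_edge (bwd ?a d))"
      using that False by (intro right_edge_fwd assms) (auto simp: act_def key_def)
    then have "bwd ?a (fwd ?a ?s) = bwd ?a t" by (simp del: fwd_bwd(2))
    then show ?thesis using False by (simp add: act_def)
  qed
  show "right_edge (act l d) = right_edge d" if "key l d \<ge> P"
    using right_edge_fwd(2)[OF assms, of d] right_edge_fwd(2)[OF assms, of "bwd (fst l) d"] that
    by (auto simp: act_def key_def split: if_splits)
qed

lemma left_edge_act:
  assumes "fst l \<in> moves"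
  shows "key l d > P \<Longrightarrow> t \<ge> left_edge d \<Longrightarrow> act l t = t + (left_edge (act l d) - left_edge d)"
    and "key l d \<le> P \<Longrightarrow> left_edge (act l d) = left_edge d"
proof -
  show "act l t = t + (left_edge (act l d) - left_edge d)" if "key l d > P" "t \<ge> left_edge d"
  proof (cases "snd l")
    case True
    with left_edge_fwd(1)[OF assms] that show ?thesis by (simp add: act_def key_def)
  next
    case False
    let ?a = "fst l" and ?s = "t + (left_edge (bwd (fst l) d) - left_edge d)"
    have "fwd ?a ?s = ?s + (left_edge (fwd ?a (bwd ?a d)) - left_edge (bwd ?a d))"
      using that False by (intro left_edge_fwd assms) (auto simp: act_def key_def)
    then have "bwd ?a (fwd ?a ?s) = bwd ?a t" by (simp del: fwd_bwd(2))
    then show ?thesis using False by (simp add: act_def)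
  qed
  show "left_edge (act l d) = left_edge d" if "key l d \<le> P"
    using left_edge_fwd(2)[OF assms, of d] left_edge_fwd(2)[OF assms, of "bwd (fst l) d"] that
    by (auto simp: act_def key_def split: if_splits)
qed

text \<open>Beyond the end of its side, the word of a side only moves the pointer and therefore
acts as a translation. This makes the two words commute when they are put together.\<close>

lemma right_word_below:
  "ws \<in> words \<Longrightarrow> t \<le> right_edge d \<Longrightarrow>
    wact (right_word d ws) t = t + (right_edge (wact ws d) - right_edge d)"
proof (induction ws arbitrary: d t)
  case (Cons l ws)
  show ?case
  proof (cases "key l d < P")
    case True
    then have "act l t = t + (right_edge (act l d) - right_edge d)"
      using Cons.prems by (intro right_edge_act) auto
    then show ?thesis using True Cons by auto
  next
    case False
    then have "right_edge (act l d) = right_edge d"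
      using Cons.prems by (intro right_edge_act) auto
    then show ?thesis using False Cons by auto
  qed
qed simp

lemma left_word_above:
  "ws \<in> words \<Longrightarrow> t \<ge> left_edge d \<Longrightarrow>
    wact (left_word d ws) t = t + (left_edge (wact ws d) - left_edge d)"
proof (induction ws arbitrary: d t)
  case (Cons l ws)
  show ?case
  proof (cases "key l d > P")
    case True
    then have "act l t = t + (left_edge (act l d) - left_edge d)"
      using Cons.prems by (intro left_edge_act) auto
    then show ?thesis using True Cons by auto
  next
    case False
    then have "left_edge (act l d) = left_edge d"
      using Cons.prems by (intro left_edge_act) auto
    then show ?thesis using False Cons by auto
  qed
qed simp

text \<open>The stop is exposed, that is, not inside a tree, and the pointer is to the left of it. A letter
crosses the stop precisely if it changes this property, so the crossings along a path are
counted modulo \<open>2\<close> by the end points.\<close>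

definition ahead :: "real \<Rightarrow> bool" where
  "ahead d \<longleftrightarrow> (\<exists>q. q \<ge> (1::int) \<and> d = P * of_int q)"

lemma ahead_ge: "ahead d \<Longrightarrow> d \<ge> P"
  using mult_P_cases N_gt(5) unfolding ahead_def by force

lemma ahead_minus: "ahead (d - P) \<longleftrightarrow> ahead d \<and> d \<noteq> P"
proof
  assume "ahead (d - P)"
  then obtain q :: int where q: "q \<ge> 1" "d - P = P * q" by (auto simp: ahead_def)
  then have "d = P * of_int (q + 1)" by (simp add: algebra_simps)
  moreover have "d \<noteq> P" using q N_gt(5) by auto
  ultimately show "ahead d \<and> d \<noteq> P" using q(1) unfolding ahead_def by (intro conjI exI[of _ "q + 1"]) auto
next
  assume a: "ahead d \<and> d \<noteq> P"
  then obtain q :: int where q: "q \<ge> 1" "d = P * q" by (auto simp: ahead_def)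
  then have "d - P = P * of_int (q - 1)" by (simp add: algebra_simps)
  moreover have "q - 1 \<ge> 1" using a q by (cases "q = 1") auto
  ultimately show "ahead (d - P)" unfolding ahead_def by blast
qed

lemma ahead_less_2P: "ahead d \<Longrightarrow> d < 2 * P \<Longrightarrow> d = P"
proof -
  assume a: "ahead d" "d < 2 * P"
  then obtain q :: int where q: "q \<ge> 1" "d = P * q" by (auto simp: ahead_def)
  with a(2) mult_P_ge2[of q] have "\<not> q \<ge> 2" by linarith
  with q have "q = 1" by linarith
  with q show "d = P" by simp
qed

lemma ahead_fwd:
  assumes "a \<in> moves"
  shows "ahead (fwd a d) \<longleftrightarrow> ahead d \<and> d \<noteq> P"
  using assms
proof (cases rule: moves_cases)
  case (2 i)
  consider "d \<le> i" | "of_int i < d" "d < i + N" | "d \<ge> i + N" by linarith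
  then show ?thesis
  proof cases
    case 1
    then have "\<not> ahead d" using ahead_ge[of d] 2 by auto
    then show ?thesis using 1 2 by (simp add: merge_less)
  next
    case b: 2
    then have "\<not> ahead (merge i d)" using ahead_ge[of "merge i d"] 2 merge_middle[OF b] by linarith
    moreover have "d < 2 * P" using b 2 unfolding N_def by linarith
    ultimately show ?thesis using ahead_less_2P 2 by auto
  next
    case 3
    then show ?thesis using 2 by (simp add: merge_ge ahead_minus)
  qed
qed (simp add: ahead_minus)

lemma ahead_P: "ahead P" unfolding ahead_def by (intro exI[of _ 1]) auto

lemma ahead_act:
  assumes "fst l \<in> moves"
  shows "key l d = P \<longleftrightarrow> ahead d \<noteq> ahead (act l d)"
proof (cases "snd l")
  case True
  then show ?thesis using ahead_fwd[OF assms, of d] ahead_P by (auto simp: act_def key_def)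
next
  case False
  then show ?thesis using ahead_fwd[OF assms, of "bwd (fst l) d"] ahead_P by (auto simp: act_def key_def)
qed

lemma even_crossings:
  "ws \<in> words \<Longrightarrow> even (crossings d ws) \<longleftrightarrow> ahead d = ahead (wact ws d)"
  by (induction ws arbitrary: d) (auto simp: ahead_act)

lemma right_word_ahead:
  "ws \<in> words \<Longrightarrow> ahead d \<Longrightarrow> crossings d ws = 0 \<Longrightarrow> d \<le> e \<Longrightarrow> right_word e ws = []"
proof (induction ws arbitrary: d e)
  case (Cons l ws)
  then have k: "key l d \<noteq> P" by (auto split: if_splits)
  then have a: "ahead (act l d)" using ahead_act[of l d] Cons.prems by auto
  have "key l d \<ge> P" using a Cons.prems(2) ahead_ge by (auto simp: key_def)
  then have "\<not> key l e < P" using key_mono[OF Cons.prems(4), of l] by linarith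
  then show ?case using Cons.IH[of "act l d" "act l e"] a Cons.prems k by simp
qed simp

lemma behind_stays:
  "ws \<in> words \<Longrightarrow> d = P * of_int q \<Longrightarrow> q \<le> 0 \<Longrightarrow> crossings d ws = 0 \<Longrightarrow>
    \<exists>r\<le>0. wact ws d = P * of_int r"
proof (induction ws arbitrary: d q)
  case (Cons l ws)
  have k: "key l d \<noteq> P" and c: "crossings (act l d) ws = 0" using Cons.prems by (auto split: if_splits)
  have d0: "d \<le> 0" using Cons.prems N_gt(5) by (simp add: mult_nonneg_nonpos)
  have l: "fst l \<in> moves" using Cons.prems by simp
  have "\<exists>r\<le>0. act l d = P * of_int r"
    using l
  proof (cases rule: moves_cases)
    case 1
    show ?thesis
    proof (cases "snd l")
      case True
      then have "act l d = P * of_int (q - 1)" using 1 Cons.prems by (simp add: act_def algebra_simps)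
      then show ?thesis using Cons.prems(3) by (intro exI[of _ "q - 1"]) simp
    next
      case False
      then have eq: "act l d = P * of_int (q + 1)" using 1 Cons.prems by (simp add: act_def algebra_simps)
      moreover have "q \<noteq> 0" using k False eq by (auto simp: key_def)
      ultimately show ?thesis using Cons.prems(3) by (intro exI[of _ "q + 1"]) simp
    qed
  next
    case (2 i)
    then have "act l d = d" using d0 by (simp add: act_def merge_less expand_less)
    then show ?thesis using Cons.prems by auto
  qed
  then show ?case using Cons.IH c Cons.prems by auto
qed auto

section \<open>Standard intervals along a path\<close>

lemma of_int_N: "N = of_int (int p + 1)"
  by (simp add: N_def)

lemma N_pow: "N ^ k = of_int ((int p + 1) ^ k)"
  by (simp add: N_def)

definition affine_std :: "(real \<Rightarrow> real) \<Rightarrow> int \<Rightarrow> nat \<Rightarrow> int \<Rightarrow> nat \<Rightarrow> bool" where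
  "affine_std f a k b l \<longleftrightarrow> (\<forall>x\<in>{0..1}. f ((of_int a + x) / N ^ k) = (of_int b + x) / N ^ l)"

lemma affine_stdD: "affine_std f a k b l \<Longrightarrow> 0 \<le> x \<Longrightarrow> x \<le> 1 \<Longrightarrow>
    f ((of_int a + x) / N ^ k) = (of_int b + x) / N ^ l"
  by (simp add: affine_std_def)

lemma affine_std_comp: "affine_std f a k b l \<Longrightarrow> affine_std g b l c m \<Longrightarrow> affine_std (\<lambda>t. g (f t)) a k c m"
  by (simp add: affine_std_def)

lemma std_bounds:
  assumes "0 \<le> x" "x \<le> (1::real)"
  shows "(a::int) \<ge> i * (int p + 1) ^ k \<Longrightarrow> (of_int a + x) / N ^ k \<ge> of_int i"
    and "a + 1 \<le> i * (int p + 1) ^ k \<Longrightarrow> (of_int a + x) / N ^ k \<le> of_int i"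
proof -
  have N: "N ^ k > 0" using N_gt by simp
  assume "a \<ge> i * (int p + 1) ^ k"
  then have "real_of_int a \<ge> of_int (i * (int p + 1) ^ k)" by (simp only: of_int_le_iff)
  then have "of_int i * N ^ k \<le> of_int a + x" using assms by (simp add: N_pow)
  then show "(of_int a + x) / N ^ k \<ge> of_int i" using N by (simp add: field_simps)
next
  have N: "N ^ k > 0" using N_gt by simp
  assume "a + 1 \<le> i * (int p + 1) ^ k"
  then have "real_of_int (a + 1) \<le> of_int (i * (int p + 1) ^ k)" by (simp only: of_int_le_iff)
  then have "of_int a + x \<le> of_int i * N ^ k" using assms by (simp add: N_pow)
  then show "(of_int a + x) / N ^ k \<le> of_int i" using N by (simp add: field_simps)
qed

lemma affine_std_add: "affine_std (\<lambda>t. t + of_int c) a k (a + c * (int p + 1) ^ k) k"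
  using N_gt by (simp add: affine_std_def N_pow add_divide_distrib N_def)

lemma affine_std_cong:
  assumes "affine_std f a k b l" "\<And>x. 0 \<le> x \<Longrightarrow> x \<le> 1 \<Longrightarrow> g ((of_int a + x) / N ^ k) = f ((of_int a + x) / N ^ k)"
  shows "affine_std g a k b l"
  using assms by (simp add: affine_std_def)

lemma affine_std_merge: "\<exists>b l. affine_std (merge i) a k b l"
proof -
  let ?n = "(int p + 1) ^ k"
  have n: "?n > 0" by simp
  consider "a + 1 \<le> i * ?n" | "a \<ge> i * ?n" "a + 1 \<le> (i + (int p + 1)) * ?n" | "a \<ge> (i + (int p + 1)) * ?n"
    by linarith
  then show ?thesis
  proof cases
    case 1
    have "affine_std (merge i) a k a k"
      unfolding affine_std_def using std_bounds(2)[OF _ _ 1] by (auto simp: merge_less)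
    then show ?thesis by blast
  next
    case 2
    have "merge i ((of_int a + x) / N ^ k) = (of_int (a + i * int p * ?n) + x) / N ^ Suc k" if x: "0 \<le> x" "x \<le> 1" for x
    proof -
      have "of_int i \<le> (of_int a + x) / N ^ k" "(of_int a + x) / N ^ k \<le> of_int (i + (int p + 1))"
        using std_bounds(1)[OF x 2(1)] std_bounds(2)[OF x 2(2)] by auto
      then have "merge i ((of_int a + x) / N ^ k) = of_int i + ((of_int a + x) / N ^ k - of_int i) / N"
        using N_gt by (cases "(of_int a + x) / N ^ k = of_int i") (auto simp: merge_def N_def)
      also have "\<dots> = (of_int (a + i * int p * ?n) + x) / N ^ Suc k"
        unfolding power_Suc using N_gt by (simp add: N_pow[symmetric] divide_simps) (simp add: N_pow[symmetric] N_def algebra_simps)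
      finally show ?thesis .
    qed
    then have "affine_std (merge i) a k (a + i * int p * ?n) (Suc k)" by (simp add: affine_std_def)
    then show ?thesis by blast
  next
    case 3
    have "affine_std (merge i) a k (a + (- int p) * ?n) k"
      by (rule affine_std_cong[OF affine_std_add])
        (use std_bounds(1)[OF _ _ 3] in \<open>auto simp: merge_ge N_def\<close>)
    then show ?thesis by blast
  qed
qed

lemma affine_std_expand: "k = 0 \<and> a = i \<or> (\<exists>b l. affine_std (expand i) a k b l)"
proof -
  let ?n = "(int p + 1) ^ k"
  have n: "?n > 0" by simp
  consider "a + 1 \<le> i * ?n" | "a \<ge> i * ?n" "a + 1 \<le> (i + 1) * ?n" | "a \<ge> (i + 1) * ?n"
    by linarith
  then show ?thesis
  proof cases
    case 1
    have "affine_std (expand i) a k a k"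
      unfolding affine_std_def using std_bounds(2)[OF _ _ 1] by (auto simp: expand_less)
    then show ?thesis by blast
  next
    case 2
    show ?thesis
    proof (cases k)
      case 0
      then show ?thesis using 2 by simp
    next
      case (Suc m)
      have "expand i ((of_int a + x) / N ^ k) = (of_int (a - i * int p * (int p + 1) ^ m) + x) / N ^ m" if x: "0 \<le> x" "x \<le> 1" for x
      proof -
        have "of_int i \<le> (of_int a + x) / N ^ k" "(of_int a + x) / N ^ k \<le> of_int (i + 1)"
          using std_bounds(1)[OF x 2(1)] std_bounds(2)[OF x 2(2)] by auto
        then have "expand i ((of_int a + x) / N ^ k) = of_int i + ((of_int a + x) / N ^ k - of_int i) * N"
          using N_gt by (cases "(of_int a + x) / N ^ k = of_int i") (auto simp: expand_def)
        also have "\<dots> = (of_int (a - i * int p * (int p + 1) ^ m) + x) / N ^ m"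
          unfolding Suc power_Suc using N_gt by (simp add: N_pow[symmetric] divide_simps) (simp add: N_pow[symmetric] N_def algebra_simps)
        finally show ?thesis .
      qed
      then have "affine_std (expand i) a k (a - i * int p * (int p + 1) ^ m) m" by (simp add: affine_std_def)
      then show ?thesis by blast
    qed
  next
    case 3
    have "affine_std (expand i) a k (a + int p * ?n) k"
      by (rule affine_std_cong[OF affine_std_add])
        (use std_bounds(1)[OF _ _ 3] in \<open>auto simp: expand_ge\<close>)
    then show ?thesis by blast
  qed
qed

lemma affine_std_act:
  assumes "\<And>i. \<not> (l = (Merge i, False) \<and> k = 0 \<and> a = i)"
  shows "\<exists>b m. affine_std (act l) a k b m"
proof (cases "fst l")
  case Shift
  then have "act l = (\<lambda>t. t + of_int (if snd l then - int p else int p))"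
    by (auto simp: act_def)
  then show ?thesis using affine_std_add by metis
next
  case (Merge i)
  show ?thesis
  proof (cases "snd l")
    case True
    then have "act l = merge i" using Merge by (auto simp: act_def fun_eq_iff)
    then show ?thesis using affine_std_merge by simp
  next
    case False
    then have "act l = expand i" using Merge by (auto simp: act_def fun_eq_iff)
    moreover have "l = (Merge i, False)" using Merge False by (cases l) auto
    ultimately show ?thesis using affine_std_expand[of k a i] assms by auto
  qed
qed

text \<open>A letter maps standard intervals to standard intervals, with one exception: an expansion applied to
exactly the unit interval that it expands. So a tree keeps its contents along a word until its root is
removed.\<close>

lemma affine_std_wact:
  "(\<exists>b l. affine_std (wact ws) a k b l) \<or>
   (\<exists>us j vs. ws = us @ (Merge j, False) # vs \<and> affine_std (wact us) a k j 0)"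
proof (induction ws arbitrary: a k)
  case Nil
  have "affine_std (wact []) a k a k" by (simp add: affine_std_def)
  then show ?case by blast
next
  case (Cons l ws)
  show ?case
  proof (cases "\<exists>i. l = (Merge i, False) \<and> k = 0 \<and> a = i")
    case True
    then have "l # ws = [] @ (Merge a, False) # ws" "affine_std (wact []) a k a 0"
      by (auto simp: affine_std_def)
    then show ?thesis by blast
  next
    case False
    then obtain b m where b: "affine_std (act l) a k b m" using affine_std_act by blast
    have w: "wact (l # us) = (\<lambda>t. wact us (act l t))" for us by (simp add: fun_eq_iff)
    from Cons.IH[of b m] show ?thesis
    proof (elim disjE exE conjE)
      fix c n assume "affine_std (wact ws) b m c n"
      from affine_std_comp[OF b this] show ?thesis unfolding w by blast
    next
      fix us j vs assume ws: "ws = us @ (Merge j, False) # vs" and "affine_std (wact us) b m j 0"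
      from affine_std_comp[OF b this(2)] have "affine_std (wact (l # us)) a k j 0" unfolding w .
      moreover have "l # ws = (l # us) @ (Merge j, False) # vs" using ws by simp
      ultimately show ?thesis by blast
    qed
  qed
qed

text \<open>Multiplication by \<open>N ^ (l + 1)\<close> turns this into an equation between integers. Modulo \<open>N\<close> its left-hand side is
\<open>r\<close>, which is not \<open>0\<close>, so \<open>l = 0\<close>; and then \<open>r\<close> and \<open>s\<close> agree modulo \<open>N\<close>.\<close>

lemma interior_unique:
  assumes "(of_int b + of_int r / N) / N ^ l = of_int j + of_int s / N"
    and "1 \<le> r" "r \<le> int p" "0 \<le> s" "s \<le> int p"
  shows "l = 0 \<and> b = j \<and> r = s"
proof -
  have "(of_int b * N + of_int r) = (of_int j * N + of_int s) * N ^ l"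
  proof -
    have "of_int b + of_int r / N = (of_int j + of_int s / N) * N ^ l"
      using assms(1) N_gt by (simp add: divide_eq_eq)
    then have "(of_int b + of_int r / N) * N = (of_int j + of_int s / N) * N * N ^ l"
      by simp
    moreover have "(of_int x + of_int y / N) * N = of_int x * N + of_int y" for x y
      using N_gt by (simp add: distrib_right)
    ultimately show ?thesis by (simp only:)
  qed
  then have "real_of_int (b * (int p + 1) + r) = of_int ((j * (int p + 1) + s) * (int p + 1) ^ l)"
    by (simp add: N_def)
  then have eq: "b * (int p + 1) + r = (j * (int p + 1) + s) * (int p + 1) ^ l"
    by (simp only: of_int_eq_iff)
  have l: "l = 0"
  proof (rule ccontr)
    assume "l \<noteq> 0"
    then have "int p + 1 dvd (j * (int p + 1) + s) * (int p + 1) ^ l" by (simp add: dvd_power)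
    then have "int p + 1 dvd b * (int p + 1) + r" using eq by simp
    then have "int p + 1 dvd r" by (simp add: dvd_add_right_iff)
    then show False using assms(2,3) zdvd_imp_le[of "int p + 1" r] by simp
  qed
  have "(b * (int p + 1) + r) mod (int p + 1) = (j * (int p + 1) + s) mod (int p + 1)"
    using eq l by simp
  then have "r = s" using assms by (simp add: mod_pos_pos_trivial)
  moreover have "b = j" using eq l calculation p_pos by simp
  ultimately show ?thesis using l by simp
qed

text \<open>Once common factors \<open>N\<close> are cancelled, the stop appears as an inner division point of a standard interval,
that of the caret which owns the stop.\<close>

lemma stops_noninteger_interior:
  assumes "d \<in> stops" "\<And>z. d \<noteq> of_int z"
  obtains a k r where "d = (of_int a + of_int r / N) / N ^ k" "1 \<le> r" "r \<le> int p"
proof -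
  have *: "(\<exists>z. d = of_int z) \<or> (\<exists>a k r. d = (of_int a + of_int r / N) / N ^ k \<and> 1 \<le> r \<and> r \<le> int p)"
    if "d = of_int c / N ^ m" for c m
    using that
  proof (induction m arbitrary: c)
    case (Suc m)
    let ?a = "c div (int p + 1)" and ?r = "c mod (int p + 1)"
    have "c = ?a * (int p + 1) + ?r" by (rule div_mult_mod_eq[symmetric])
    then have c: "real_of_int c = of_int ?a * N + of_int ?r"
      by (metis of_int_N of_int_add of_int_mult)
    have d: "d = (of_int ?a + of_int ?r / N) / N ^ m"
      unfolding Suc.prems c using N_gt by (simp add: field_simps)
    have r: "0 \<le> ?r" "?r \<le> int p" using pos_mod_bound[of "int p + 1" c] by auto
    show ?case
    proof (cases "?r = 0")
      case True
      then show ?thesis using Suc.IH[of ?a] d by simp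
    next
      case False
      then have "1 \<le> ?r" using r(1) by linarith
      then show ?thesis using d r by blast
    qed
  qed auto
  obtain k b where "d = P * of_int b / N ^ k" using assms(1) by (auto simp: stops_def stops_upto_def)
  then have "d = of_int (int p * b) / N ^ k" by simp
  from *[OF this] show thesis using assms(2) that by blast
qed

lemma interior_in_D:
  assumes "of_int j + of_int r / N \<in> stops" "0 \<le> j" "j < int p" "1 \<le> r" "r \<le> int p"
  shows "j + r = int p"
proof -
  have "of_int j + of_int r / N = of_int (j * (int p + 1) + r) / N ^ 1"
    using N_gt by (simp add: field_simps) (simp add: N_def algebra_simps)
  then have "int p dvd j * (int p + 1) + r" using assms(1) stops_fracD[of _ 1] by metis
  moreover have "j * (int p + 1) + r = int p * j + (j + r)" by (simp add: algebra_simps)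
  ultimately have "int p dvd j + r" by (simp add: dvd_add_right_iff)
  then obtain q where q: "j + r = int p * q" by (auto simp: dvd_def)
  have "q > 0" using q assms by (smt (verit) mult_nonneg_nonpos of_nat_0_le_iff)
  moreover have "\<not> q \<ge> 2"
  proof
    assume "q \<ge> 2"
    then have "int p * q \<ge> int p * 2" by (intro mult_left_mono) auto
    then show False using q assms by linarith
  qed
  ultimately have "q = 1" by linarith
  then show ?thesis using q by simp
qed

section \<open>Two moves that lengthen\<close>

abbreviation Last :: move where "Last \<equiv> Merge (int p - 1)"

text \<open>The position of the stop \<open>p\<close> after \<open>merge (p - 1)\<close>.\<close>

definition qlast :: real where "qlast = of_int (int p - 1) + of_int 1 / N"

lemma Last_moves [simp]: "Last \<in> moves" "Shift \<in> moves"
  using p_pos by (auto simp: moves_def)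

lemma merge_P: "0 \<le> i \<Longrightarrow> i < int p \<Longrightarrow> merge i P = of_int i + of_int (int p - i) / N"
  by (auto simp: merge_def N_def)

lemma qlast_eq: "merge (int p - 1) P = qlast"
  using p_pos by (simp add: merge_P qlast_def)

lemma expand_qlast: "expand (int p - 1) qlast = P"
  by (simp add: qlast_eq[symmetric])

lemma qlast_D: "qlast \<in> stops"
  using stops_fwd[of Last P] by (simp add: qlast_eq)

lemma qlast_bounds: "P - 1 < qlast" "qlast < P"
  using N_gt by (auto simp: qlast_def)

lemma right_part_qlast:
  assumes "t \<ge> qlast"
  shows "right_part qlast t = expand (int p - 1) t - P"
proof -
  have "expand (int p - 1) t \<ge> expand (int p - 1) qlast" using assms by simp
  then have "P \<le> expand (int p - 1) t" by (simp only: expand_qlast)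
  from right_part_fwd[OF Last_moves(1) _ this] have
    "right_part qlast t = right_part P (expand (int p - 1) t)" by (simp add: qlast_eq)
  then show ?thesis using right_part_multiple[of 1] N_gt(5) by simp
qed

lemma left_part_qlast:
  assumes "t \<le> qlast"
  shows "left_part qlast t = expand (int p - 1) t"
proof -
  have "expand (int p - 1) t \<le> expand (int p - 1) qlast" using assms by simp
  then have "expand (int p - 1) t \<le> P" by (simp only: expand_qlast)
  from left_part_fwd[OF Last_moves(1) _ this] have
    "left_part qlast t = left_part P (expand (int p - 1) t)" by (simp add: qlast_eq)
  then show ?thesis using left_part_multiple[of 1] N_gt(5) by simp
qed

lemma not_ahead_qlast: "\<not> ahead qlast"
  using ahead_ge qlast_bounds by force

lemma right_edge_multiple: "right_edge (P * of_int k) = min 0 (P * of_int k)"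
  using N_gt(5) by (simp add: right_edge_def)

lemma left_edge_multiple: "left_edge (P * of_int k) = max P (P * of_int k)"
  using N_gt(5) by (simp add: left_edge_def)

lemma edge_qlast: "right_edge qlast = 0" "left_edge qlast = P"
proof -
  have "0 \<le> qlast" using qlast_bounds N_gt by linarith
  then show "right_edge qlast = 0" by (rule right_edge_nonneg)
  show "left_edge qlast = P" using qlast_bounds by (intro left_edge_le) linarith
qed

lemma act_simps [simp]:
  "act (Shift, True) t = t - P" "act (Shift, False) t = t + P"
  "act (Merge i, True) t = merge i t" "act (Merge i, False) t = expand i t"
  by (simp_all add: act_def)

text \<open>If the stop starts exposed with the pointer to its left and ends inside the root created by
\<open>merge (p - 1)\<close>, then undoing this merge at the end gives a map that does first all the work on the left, then
crosses the stop, does the work on the right, and crosses back.\<close>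

lemma cut_ahead:
  assumes ws: "ws \<in> words" and k: "k \<ge> (1::int)" and q: "wact ws (P * of_int k) = qlast"
  shows "wact (left_word (P * of_int k) ws @ (Shift, True) # right_word (P * of_int k) ws @ [(Shift, False)]) t
    = expand (int p - 1) (wact ws t)"
proof -
  let ?d = "P * of_int k"
  let ?l = "wact (left_word ?d ws)" and ?r = "wact (right_word ?d ws)"
  have dP: "?d \<ge> P" using mult_P_cases[of k] k by auto
  show ?thesis
  proof (cases "t \<le> ?d")
    case True
    then have le: "wact ws t \<le> qlast" using q by (simp flip: q)
    have "?l t = left_part qlast (wact ws t)"
      using left_part_wact[OF ws stops_multiple True] dP by (simp add: q left_part_multiple)
    also have "\<dots> = expand (int p - 1) (wact ws t)" by (rule left_part_qlast[OF le])
    finally have l: "?l t = expand (int p - 1) (wact ws t)" .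
    have "expand (int p - 1) (wact ws t) \<le> expand (int p - 1) qlast" using le by simp
    then have "?l t \<le> P" unfolding l by (simp only: expand_qlast)
    then have "?r (?l t - P) = ?l t - P"
      using right_word_below[OF ws, of "?l t - P" ?d] dP N_gt(5) by (simp add: right_edge_multiple q edge_qlast)
    then show ?thesis using l by simp
  next
    case False
    then have ge: "wact ws t \<ge> qlast" using q by (simp flip: q)
    have "?l t = t + (P - ?d)"
      using left_word_above[OF ws, of ?d t] False dP by (simp add: left_edge_multiple q edge_qlast)
    then have l: "?l t - P = t - ?d" by simp
    have "?r (t - ?d) = right_part qlast (wact ws t)"
      using right_part_wact[OF ws stops_multiple[of k], of t] False dP N_gt(5) by (simp add: q right_part_multiple)
    also have "\<dots> = expand (int p - 1) (wact ws t) - P" by (rule right_part_qlast[OF ge])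
    finally show ?thesis using l by simp
  qed
qed

text \<open>Here the pointer starts on the right of the stop, so the work on the right comes first and one
crossing is enough.\<close>

lemma cut_behind:
  assumes ws: "ws \<in> words" and k: "k \<le> (0::int)" and q: "wact ws (P * of_int k) = qlast"
  shows "wact (right_word (P * of_int k) ws @ (Shift, False) # left_word (P * of_int k) ws) t
    = expand (int p - 1) (wact ws t)"
proof -
  let ?d = "P * of_int k"
  let ?l = "wact (left_word ?d ws)" and ?r = "wact (right_word ?d ws)"
  have dP: "?d \<le> 0" using k N_gt(5) by (simp add: mult_nonneg_nonpos)
  show ?thesis
  proof (cases "t \<le> ?d")
    case True
    then have le: "wact ws t \<le> qlast" using q by (simp flip: q)
    have r: "?r t = t - ?d"
      using right_word_below[OF ws, of t ?d] dP True by (simp add: right_edge_multiple q edge_qlast)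
    have "?l (t - ?d + P) = left_part qlast (wact ws t)"
      using left_part_wact[OF ws stops_multiple True] dP by (simp add: q left_part_multiple)
    also have "\<dots> = expand (int p - 1) (wact ws t)" by (rule left_part_qlast[OF le])
    finally show ?thesis using r by simp
  next
    case False
    then have ge: "wact ws t \<ge> qlast" using q by (simp flip: q)
    have "?r t = right_part qlast (wact ws t)"
      using right_part_wact[OF ws stops_multiple[of k], of t] False dP by (simp add: q right_part_multiple)
    also have "\<dots> = expand (int p - 1) (wact ws t) - P" by (rule right_part_qlast[OF ge])
    finally have r: "?r t + P = expand (int p - 1) (wact ws t)" by simp
    have "expand (int p - 1) (wact ws t) \<ge> expand (int p - 1) qlast" using ge by simp
    then have "?r t + P \<ge> P" unfolding r by (simp only: expand_qlast)
    then have "?l (?r t + P) = ?r t + P"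
      using left_word_above[OF ws, of ?d "?r t + P"] dP N_gt(5) by (simp add: left_edge_multiple q edge_qlast)
    then show ?thesis using r by simp
  qed
qed

text \<open>Applied to the standard interval of the caret that owns the stop: either the caret survives the whole word, or
its root is removed at some time, and at that time the stop becomes exposed at \<open>p\<close>.\<close>

lemma interior_path:
  assumes ws: "ws \<in> words" and D: "(of_int a + of_int r / N) / N ^ k \<in> stops" and r: "1 \<le> r" "r \<le> int p"
  shows "(\<exists>b l. affine_std (wact ws) a k b l) \<or>
   (\<exists>us vs. ws = us @ (Merge (int p - r), False) # vs \<and> affine_std (wact us) a k (int p - r) 0
      \<and> wact (us @ [(Merge (int p - r), False)]) ((of_int a + of_int r / N) / N ^ k) = P)"
proof -
  have x: "0 \<le> real_of_int r / N" "real_of_int r / N \<le> 1" using r N_gt by (auto simp: N_def)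
  { fix us j vs assume us: "ws = us @ (Merge j, False) # vs" "affine_std (wact us) a k j 0"
    have w: "wact us ((of_int a + of_int r / N) / N ^ k) = of_int j + of_int r / N"
      using affine_stdD[OF us(2) x] by simp
    have j: "0 \<le> j" "j < int p" using ws us(1) by (auto simp: moves_def)
    have "of_int j + of_int r / N \<in> stops" using D w by (metis stops_wact)
    then have "j + r = int p" using interior_in_D j r by blast
    then have jr: "j = int p - r" by simp
    have "wact (us @ [(Merge j, False)]) ((of_int a + of_int r / N) / N ^ k) = expand j (merge j P)"
      using w j jr by (simp add: merge_P)
    then have "wact (us @ [(Merge j, False)]) ((of_int a + of_int r / N) / N ^ k) = P" by simp
    with us jr have "\<exists>us vs. ws = us @ (Merge (int p - r), False) # vs \<and> affine_std (wact us) a k (int p - r) 0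
      \<and> wact (us @ [(Merge (int p - r), False)]) ((of_int a + of_int r / N) / N ^ k) = P" by blast }
  with affine_std_wact[of ws a k] show ?thesis by blast
qed

text \<open>If the stop is crossed only once, the crossing creates a caret around it. This caret is never
removed again, so it is the final one; its children on the right of the stop are the first \<open>p\<close> trees there, and these are
not touched any more.\<close>

lemma single_crossing:
  assumes "ws \<in> words" "k \<ge> (1::int)" "wact ws (P * of_int k) = qlast" "crossings (P * of_int k) ws = 1"
    and "0 \<le> s" "s \<le> P"
  shows "wact (right_word (P * of_int k) ws) s = s"
  using assms(1-4)
proof (induction ws arbitrary: k)
  case Nil
  then show ?case using not_ahead_qlast unfolding ahead_def by auto
next
  case (Cons l ws)
  let ?d = "P * of_int k"
  have ah: "ahead ?d" using Cons.prems(2) unfolding ahead_def by blast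
  have l: "fst l \<in> moves" and ws: "ws \<in> words" using Cons.prems(1) by auto
  show ?case
  proof (cases "key l ?d = P")
    case False
    then have "ahead (act l ?d)" using ah ahead_act[OF l, of ?d] by auto
    then obtain k' where k': "k' \<ge> 1" "act l ?d = P * of_int k'" by (auto simp: ahead_def)
    have "key l ?d \<ge> P" using ah \<open>ahead (act l ?d)\<close> ahead_ge by (auto simp: key_def)
    then show ?thesis using Cons.IH[OF ws k'(1)] Cons.prems False by (simp add: k')
  next
    case True
    then have na: "\<not> ahead (act l ?d)" using ah ahead_act[OF l, of ?d] by auto
    then have snd: "snd l" using True ahead_P by (auto simp: key_def split: if_splits)
    then have d: "?d = P" using True by (simp add: key_def)
    have c: "crossings (act l ?d) ws = 0" using Cons.prems(4) True by simp
    have e: "wact ws (act l ?d) = qlast" using Cons.prems(3) by simp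
    show ?thesis using l
    proof (cases rule: moves_cases)
      case 1
      then have "act l ?d = P * of_int 0" using snd d by (simp add: act_def)
      from behind_stays[OF ws this _ c] e obtain r where "r \<le> 0" "qlast = P * of_int r" by auto
      moreover from this have "qlast \<le> 0" using N_gt(5) by (simp add: mult_nonneg_nonpos)
      ultimately show ?thesis using qlast_bounds N_gt by linarith
    next
      case (2 i)
      let ?r = "int p - i"
      have r: "1 \<le> ?r" "?r \<le> int p" using 2 by auto
      have ad: "act l ?d = (of_int i + of_int ?r / N) / N ^ 0"
        using snd 2 d merge_P[of i] by (simp add: act_def)
      have "(of_int i + of_int ?r / N) / N ^ 0 \<in> stops" unfolding ad[symmetric] by simp
      from interior_path[OF ws this r] show ?thesis
      proof (elim disjE exE conjE)
        fix b m assume aff: "affine_std (wact ws) i 0 b m"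
        have "0 \<le> real_of_int ?r / N" "real_of_int ?r / N \<le> 1" using r N_gt by (auto simp: N_def)
        from affine_stdD[OF aff this] have "qlast = (of_int b + of_int ?r / N) / N ^ m"
          using ad e by simp
        then have u: "m = 0 \<and> b = int p - 1 \<and> ?r = 1"
          using r p_pos by (intro interior_unique) (auto simp: qlast_def)
        then have i: "i = int p - 1" by simp
        have id: "wact ws t = t" if "P - 1 \<le> t" "t \<le> P" for t
          using affine_stdD[OF aff, of "t - (P - 1)"] that u i by simp
        have adq: "act l ?d = qlast" using ad i by (simp add: qlast_def)
        let ?t = "merge (int p - 1) (s + P)"
        have "merge (int p - 1) P \<le> ?t" "?t \<le> merge (int p - 1) (2 * P)" using assms(5,6) by simp_all
        moreover have "merge (int p - 1) (2 * P) = P" by (subst merge_ge) (auto simp: N_def)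
        ultimately have t: "qlast \<le> ?t" "?t \<le> P" by (simp_all add: qlast_eq)
        have "right_part (wact ws qlast) (wact ws ?t) = wact (right_word qlast ws) (right_part qlast ?t)"
          using t by (intro right_part_wact ws qlast_D)
        moreover have "wact ws ?t = ?t" using id t qlast_bounds by auto
        moreover have "wact ws qlast = qlast" using e adq by simp
        moreover have "right_part qlast ?t = s" using right_part_qlast[OF t(1)] by simp
        ultimately have "wact (right_word qlast ws) s = s" by simp
        then show ?thesis using True adq by simp
      next
        fix us vs assume us: "ws = us @ (Merge (int p - ?r), False) # vs"
          and "wact (us @ [(Merge (int p - ?r), False)]) ((of_int i + of_int ?r / N) / N ^ 0) = P"
        then have "key (Merge (int p - ?r), False) (wact us (act l ?d)) = P"
          unfolding ad[symmetric] by (simp add: key_def)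
        then have "crossings (act l ?d) ws \<noteq> 0" unfolding us by (simp add: crossings_append)
        then show ?thesis using c by simp
      qed
    qed
  qed
qed

text \<open>Let \<open>f\<close> be the map whose merge is represented by the word. The stop is followed from its initial
position \<open>d\<close> to \<open>qlast\<close>, its final one. By \<open>cut_ahead\<close> and \<open>cut_behind\<close> there is a word for \<open>f\<close> in which
the crossings are replaced by two or by one. This is a gain unless the stop is crossed just once
while the pointer starts on its left. In the latter case, the trees on the right of the stop
are trivial, contrary to the hypothesis, or the work on the right can be done before the stop gets exposed.\<close>

lemma shorten_merge:
  assumes ws: "ws \<in> words"
    and nontriv: "\<And>a k. \<not> (\<forall>x\<in>{0..1}. expand (int p - 1) (wact ws ((of_int a + x) / N ^ k)) = 2 * P - 1 + x)"
  shows "\<exists>vs\<in>words. length vs < length ws \<and> (\<forall>t. wact vs t = expand (int p - 1) (wact ws t))"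
proof -
  define d where "d = wact (inv_word ws) qlast"
  have wd: "wact ws d = qlast" by (simp add: d_def)
  have dD: "d \<in> stops" using qlast_D wd by (metis stops_wact)
  show ?thesis
  proof (cases "\<exists>z. d = of_int z")
    case True
    then obtain z where "d = of_int z" by blast
    moreover from this have "int p dvd z" using dD stops_int by simp
    then obtain k where "z = int p * k" by (rule dvdE)
    ultimately have k: "d = P * of_int k" by simp
    note len = length_parts[of d d ws, OF order_refl]
    show ?thesis
    proof (cases "k \<le> 0")
      case True
      \<comment> \<open>The pointer starts on the right, so the crossings are even in number and not zero; one remains.\<close>
      let ?vs = "right_word d ws @ (Shift, False) # left_word d ws"
      have nad: "\<not> ahead d" using True k N_gt(5) ahead_ge[of d] mult_nonneg_nonpos[of P "of_int k"] by auto
      have "crossings d ws \<noteq> 0"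
      proof
        assume "crossings d ws = 0"
        from behind_stays[OF ws k True this] wd obtain r where "r \<le> 0" "qlast = P * of_int r" by auto
        moreover from this have "qlast \<le> 0" using N_gt(5) by (simp add: mult_nonneg_nonpos)
        ultimately show False using qlast_bounds N_gt by linarith
      qed
      moreover have "even (crossings d ws)" using even_crossings[OF ws, of d] nad not_ahead_qlast wd by simp
      ultimately have "crossings d ws \<ge> 2" by (cases "crossings d ws" rule: nat.exhaust) (auto elim: oddE evenE)
      then have "length ?vs < length ws" using len by simp
      moreover have "?vs \<in> words" using ws by simp
      moreover have "wact ?vs t = expand (int p - 1) (wact ws t)" for t
        using cut_behind[OF ws True, of t] wd unfolding k by simp
      ultimately show ?thesis by blast
    next
      case False
      \<comment> \<open>The pointer starts on the left, so the number of crossings is odd; two remain.\<close>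
      let ?vs = "left_word d ws @ (Shift, True) # right_word d ws @ [(Shift, False)]"
      have k1: "k \<ge> 1" using False by simp
      then have ad: "ahead d" using k by (auto simp: ahead_def)
      have cut: "wact ?vs t = expand (int p - 1) (wact ws t)" for t
        using cut_ahead[OF ws k1, of t] wd unfolding k by simp
      have odd: "odd (crossings d ws)" using even_crossings[OF ws, of d] ad not_ahead_qlast wd by simp
      \<comment> \<open>With a single crossing, tree 2p - 1 would never be touched, hence be trivial.\<close>
      have "crossings d ws \<noteq> 1"
      proof
        assume one: "crossings d ws = 1"
        have "expand (int p - 1) (wact ws ((of_int (int p * k + int p - 1) + x) / N ^ 0)) = 2 * P - 1 + x"
          if x: "0 \<le> x" "x \<le> 1" for x
        proof -
          let ?t = "d + P - 1 + x"
          have dP: "d \<ge> P" by (rule ahead_ge[OF ad])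
          have "wact (left_word d ws) ?t = (P - 1 + x) + P"
          proof -
            have "left_edge d = d" using left_edge_multiple[of k] dP unfolding k by simp
            then show ?thesis
              using left_word_above[OF ws, of d ?t] x N_gt(4) by (simp add: wd edge_qlast)
          qed
          moreover have "wact (right_word d ws) (P - 1 + x) = P - 1 + x"
            using single_crossing[OF ws k1] wd one x N_gt(4) unfolding k by auto
          ultimately have "wact ?vs ?t = (P - 1 + x) + P"
            by (simp only: wact_append wact.simps act_simps add_diff_cancel_right')
          then show ?thesis using cut[of ?t] by (simp add: k algebra_simps)
        qed
        then show False using nontriv by (meson atLeastAtMost_iff)
      qed
      with odd have "crossings d ws \<ge> 3" by (auto elim!: oddE)
      then have "length ?vs < length ws" using len by simp
      moreover have "?vs \<in> words" using ws by simp
      ultimately show ?thesis using cut by blast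
    qed
  next
    case False
    then obtain a k r where d: "d = (of_int a + of_int r / N) / N ^ k" and r: "1 \<le> r" "r \<le> int p"
      using stops_noninteger_interior[OF dD] by metis
    have x: "0 \<le> real_of_int r / N" "real_of_int r / N \<le> 1" using r N_gt by (auto simp: N_def)
    from interior_path[OF ws dD[unfolded d] r] show ?thesis
    proof (elim disjE exE conjE)
      fix b l assume aff: "affine_std (wact ws) a k b l"
      from affine_stdD[OF aff x] have "qlast = (of_int b + of_int r / N) / N ^ l" using wd d by simp
      then have u: "l = 0 \<and> b = int p - 1 \<and> r = 1"
        using r p_pos by (intro interior_unique) (auto simp: qlast_def)
      have "expand (int p - 1) (wact ws ((of_int (a * (int p + 1) + int p) + y) / N ^ Suc k)) = 2 * P - 1 + y"
        if y: "0 \<le> y" "y \<le> 1" for y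
      proof -
        have eq: "(of_int (a * (int p + 1) + int p) + y) / N ^ Suc k = (of_int a + (P + y) / N) / N ^ k"
          using N_gt by (simp add: field_simps) (simp add: N_def algebra_simps)
        have "wact ws ((of_int (a * (int p + 1) + int p) + y) / N ^ Suc k) = P - 1 + (P + y) / N"
          unfolding eq using affine_stdD[OF aff, of "(P + y) / N"] u y N_gt by (simp add: N_def)
        moreover have "expand (int p - 1) (P - 1 + (P + y) / N) = P - 1 + (P + y)"
        proof -
          have "0 < (P + y) / N" "(P + y) / N \<le> 1" using y N_gt by (simp_all add: N_def)
          then show ?thesis using N_gt(1) by (simp add: expand_def)
        qed
        ultimately show ?thesis by simp
      qed
      then show ?thesis using nontriv by (meson atLeastAtMost_iff)
    next
      fix us vs
      let ?i = "int p - r"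
      let ?e = "(Merge ?i, False)"
      assume us: "ws = us @ ?e # vs" and up: "wact (us @ [?e]) ((of_int a + of_int r / N) / N ^ k) = P"
      have uw: "us \<in> words" "vs \<in> words" "fst ?e \<in> moves" using ws us by auto
      have vq: "wact vs (P * of_int 1) = qlast" using wd up d us by simp
      note len = length_parts[of P P vs, OF order_refl]
      let ?l = "left_word P vs" and ?r = "right_word P vs"
      have cut: "wact (?l @ (Shift, True) # ?r @ [(Shift, False)]) t = expand (int p - 1) (wact vs t)" for t
        using cut_ahead[OF uw(2) _ vq, of t] by simp
      have odd: "odd (crossings P vs)" using even_crossings[OF uw(2), of P] ahead_P not_ahead_qlast vq by simp
      show ?thesis
      proof (cases "crossings P vs = 1")
        case False
        \<comment> \<open>The removal of the initial caret around the stop is not one of the crossings of the rest.\<close>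
        let ?ws = "us @ [?e] @ ?l @ (Shift, True) # ?r @ [(Shift, False)]"
        have "crossings P vs \<ge> 3" using odd False by (auto elim!: oddE)
        then have "length ?ws < length ws" using len us by simp
        moreover have "?ws \<in> words" using uw by simp
        moreover have "wact ?ws t = expand (int p - 1) (wact ws t)" for t
          using cut[of "expand ?i (wact us t)"] us by simp
        ultimately show ?thesis by blast
      next
        case True
        \<comment> \<open>The work on the right is done beyond the initial caret, while that is still there.\<close>
        let ?ws = "us @ ?r @ [?e] @ ?l"
        have rid: "wact ?r s = s" if "s \<le> P" for s
        proof (cases "s \<le> 0")
          case True
          then show ?thesis using right_word_below[OF uw(2), of s P] vq N_gt(5)
            by (simp add: right_edge_nonneg edge_qlast)
        next
          case False
          then show ?thesis using single_crossing[OF uw(2) _ vq] True that \<open>crossings P vs = 1\<close> by simp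
        qed
        have rP: "wact ?r s \<ge> P \<longleftrightarrow> s \<ge> P" for s
          using wact_le_iff[of ?r P s] rid[of P] by simp
        have lP: "wact ?l P = P" "s \<ge> P \<Longrightarrow> wact ?l s = s" for s
          using left_word_above[OF uw(2), of P s] left_word_above[OF uw(2), of P P] vq
          by (simp_all add: left_edge_le edge_qlast)
        have comm: "wact ?r (wact ?l s - P) + P = wact ?l (wact ?r (s - P) + P)" for s
        proof (cases "s \<ge> P")
          case True
          then have "wact ?r (s - P) \<ge> wact ?r 0" by simp
          then have "wact ?r (s - P) \<ge> 0" using rid[of 0] N_gt(5) by simp
          then show ?thesis using True by (simp add: lP)
        next
          case False
          then have "wact ?l s \<le> wact ?l P" by simp
          then have "wact ?l s \<le> P" by (simp add: lP)
          then show ?thesis using False rid N_gt(5) by simp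
        qed
        \<comment> \<open>The right word fixes everything up to i + 1, hence it commutes with the expansion up to translation.\<close>
        have swap: "wact ?r (expand ?i s - P) + P = expand ?i (wact ?r s)" for s
        proof (cases "s \<ge> of_int ?i + 1")
          case True
          then have "wact ?r s \<ge> wact ?r (of_int ?i + 1)" by simp
          moreover have "wact ?r (of_int ?i + 1) = of_int ?i + 1" using rid[of "of_int ?i + 1"] r by simp
          ultimately have "wact ?r s \<ge> of_int ?i + 1" by (simp only:)
          then show ?thesis using True by (simp add: expand_ge)
        next
          case False
          then have "expand ?i s \<le> expand ?i (of_int ?i + 1)" by simp
          then have "expand ?i s \<le> of_int ?i + 1 + P" by (simp add: expand_ge)
          then have "expand ?i s - P \<le> P" using r by simp
          moreover have "s \<le> P" using False r by simp
          ultimately show ?thesis using rid by simp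
        qed
        have "length ?ws < length ws" using len us True by simp
        moreover have "?ws \<in> words" using uw by simp
        moreover have "wact ?ws t = expand (int p - 1) (wact ws t)" for t
          using cut[of "expand ?i (wact us t)"] us comm swap by simp
        ultimately show ?thesis by blast
      qed
    qed
  qed
qed

text \<open>The hypothesis says that the word represents the expansion at \<open>p - 1\<close> of a map \<open>g\<close> whose tree \<open>p - 1\<close>
is trivial. At some time the word removes the root over this tree; its \<open>N\<close>
children end up where they are at that time, so the rest of the word as a whole acts only on what lies to the left of the stop \<open>p\<close> and to the right of the
stop \<open>2 p\<close>. Without the expansion, these two parts are adjacent, and one crossing of
the stop \<open>p\<close> in each direction suffices. The expansion itself is saved.\<close>

lemma shorten_expand:
  assumes ws: "ws \<in> words"
    and triv: "\<And>x. 0 \<le> x \<Longrightarrow> x \<le> 1 \<Longrightarrow> wact ws ((of_int a + x) / N ^ k) = P - 1 + N * x"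
  shows "\<exists>vs\<in>words. length vs < length ws \<and> (\<forall>t. wact vs t = merge (int p - 1) (wact ws t))"
proof -
  let ?m = "merge (int p - 1)"
  let ?d = "(of_int a + of_int 1 / N) / N ^ k"
  have x: "0 \<le> 1 / N" "1 / N \<le> 1" using N_gt by auto
  have wd: "wact ws ?d = P" using triv[OF x] N_gt by simp
  have dD: "?d \<in> stops" using wd stops_mult_p(1) by (metis stops_wact)
  have one: "1 \<le> (1::int)" "1 \<le> int p" using p_pos by auto
  from interior_path[OF ws dD one] show ?thesis
  proof (elim disjE exE conjE)
    fix b l assume aff: "affine_std (wact ws) a k b l"
    from affine_stdD[OF aff x] have "(of_int b + of_int 1 / N) / N ^ l = of_int (int p) + of_int 0 / N"
      using wd by simp
    from interior_unique[OF this] show ?thesis using one by auto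
  next
    fix us vs
    let ?e = "(Last, False)"
    assume us: "ws = us @ ?e # vs" and aff: "affine_std (wact us) a k (int p - 1) 0"
    have uw: "us \<in> words" "vs \<in> words" using ws us by auto
    have fx: "wact vs t = t" if t: "P - 1 \<le> t" "t \<le> 2 * P" for t
    proof -
      let ?x = "(t - (P - 1)) / N"
      have x: "0 \<le> ?x" "?x \<le> 1" using t N_gt by (auto simp: N_def)
      have "wact us ((of_int a + ?x) / N ^ k) = P - 1 + ?x" using affine_stdD[OF aff x] by simp
      moreover have "expand (int p - 1) (P - 1 + ?x) = t"
        using x N_gt by (auto simp: expand_def)
      ultimately show ?thesis using triv[OF x] us N_gt by simp
    qed
    let ?l = "left_word P vs" and ?r = "right_word (2 * P) vs"
    have vP: "wact vs P = P" "wact vs (2 * P) = 2 * P" using fx N_gt by auto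
    note e2 = right_edge_nonneg[of "2 * P"]
    have len: "length ?l + length ?r + crossings P vs \<le> length vs"
      using N_gt(5) by (intro length_parts) simp
    have ev: "even (crossings P vs)" using even_crossings[OF uw(2), of P] vP by simp
    have ll: "wact ?l t = wact vs t" if "t \<le> P" for t
      using left_part_wact[OF uw(2) stops_mult_p(1) that] left_part_multiple[of 1] N_gt(5) vP by simp
    have lr: "wact ?l t = t" if "t \<ge> P" for t
      using left_word_above[OF uw(2), of P t] that vP by (simp add: left_edge_le)
    have rl: "wact ?r t = t" if "t \<le> 0" for t
      using right_word_below[OF uw(2), of t "2 * P"] that vP e2 N_gt(5) by simp
    have rr: "wact ?r t = wact vs (t + 2 * P) - 2 * P" if "t \<ge> 0" for t
      using right_part_wact[OF uw(2) stops_mult_p(2), of "t + 2 * P"] that vP right_part_multiple[of 2] N_gt(5)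
      by (simp add: mult.commute)
    have main: "wact (?l @ (Shift, True) # ?r @ [(Shift, False)]) t = ?m (wact vs (expand (int p - 1) t))" for t
    proof (cases "t \<le> P")
      case True
      then have "wact ?l t \<le> wact ?l P" by simp
      then have "wact ?l t \<le> P" using lr[of P] by simp
      then have "wact (?l @ (Shift, True) # ?r @ [(Shift, False)]) t = wact vs t"
        using rl ll True by simp
      also have "wact vs t = ?m (wact vs (expand (int p - 1) t))"
      proof (cases "t \<le> P - 1")
        case True
        then have "wact vs t \<le> wact vs (P - 1)" by simp
        then have "wact vs t \<le> P - 1" using fx[of "P - 1"] N_gt by simp
        then show ?thesis using True by (simp add: expand_less merge_less)
      next
        case False
        have "expand (int p - 1) t \<ge> expand (int p - 1) (P - 1)" "expand (int p - 1) t \<le> expand (int p - 1) P"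
          using False True by simp_all
        then have "expand (int p - 1) t \<ge> P - 1" "expand (int p - 1) t \<le> 2 * P"
          by (simp_all add: expand_less expand_ge)
        then have "wact vs (expand (int p - 1) t) = expand (int p - 1) t" by (rule fx)
        then show ?thesis using fx[of t] False True N_gt by simp
      qed
      finally show ?thesis .
    next
      case False
      then have e: "expand (int p - 1) t = t + P" by (simp add: expand_ge)
      have "wact vs (t + P) \<ge> wact vs (2 * P)" using False by simp
      then have "wact vs (t + P) \<ge> 2 * P" by (simp only: vP)
      then have "?m (wact vs (t + P)) = wact vs (t + P) - P" by (intro merge_ge) (simp add: N_def)
      then show ?thesis using False lr[of t] rr[of "t - P"] e by (simp add: algebra_simps)
    qed
    have eq: "?m (wact ws t) = ?m (wact vs (expand (int p - 1) (wact us t)))" for t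
      using us by simp
    show ?thesis
    proof (cases "crossings P vs = 0")
      case True
      have r0: "?r = []" using right_word_ahead[OF uw(2) ahead_P True] N_gt(5) by simp
      \<comment> \<open>Without crossings, nothing happens on the right of the stop.\<close>
      let ?ws = "us @ ?l"
      have "length ?ws < length ws" using len us by simp
      moreover have "?ws \<in> words" using uw by simp
      moreover have "wact ?ws t = ?m (wact ws t)" for t
        using main[of "wact us t"] unfolding eq r0 by simp
      ultimately show ?thesis by blast
    next
      case False
      let ?ws = "us @ ?l @ (Shift, True) # ?r @ [(Shift, False)]"
      have "crossings P vs \<ge> 2" using ev False by (auto elim!: evenE)
      then have "length ?ws < length ws" using len us by simp
      moreover have "?ws \<in> words" using uw by simp
      moreover have "wact ?ws t = ?m (wact ws t)" for t
        using main[of "wact us t"] unfolding eq by simp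
      ultimately show ?thesis by blast
    qed
  qed
qed

section \<open>Partitions into standard intervals\<close>

definition shift_word :: "int \<Rightarrow> (move \<times> bool) list" where
  "shift_word q = (if q \<ge> 0 then replicate (nat q) (Shift, True) else replicate (nat (- q)) (Shift, False))"

lemma replicate_words: "fst l \<in> moves \<Longrightarrow> replicate n l \<in> words"
  by (simp add: words_def)

lemma wact_replicate:
  "wact (replicate n (Shift, True)) t = t - P * of_nat n"
  "wact (replicate n (Shift, False)) t = t + P * of_nat n"
  by (induction n arbitrary: t) (auto simp: algebra_simps)

lemma shift_word [simp]: "shift_word q \<in> words" "wact (shift_word q) t = t - P * of_int q"
  by (auto simp: shift_word_def replicate_words wact_replicate)

text \<open>Merges at arbitrary indices are conjugate by translations to those with index in \<open>[0, p)\<close>.\<close>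

lemma merge_word: "\<exists>ws\<in>words. \<forall>t. wact ws t = merge j t"
proof -
  let ?q = "j div int p" and ?i = "j mod int p"
  have i: "0 \<le> ?i" "?i < int p" using p_pos by auto
  let ?ws = "shift_word ?q @ [(Merge ?i, True)] @ shift_word (- ?q)"
  have "?ws \<in> words" using i by (simp add: moves_def)
  moreover have "real_of_int j = P * of_int ?q + of_int ?i"
    by (metis of_int_add of_int_mult of_int_of_nat_eq mult_div_mod_eq)
  then have "wact ?ws t = merge j t" for t
    by (auto simp: merge_def algebra_simps)
  ultimately show ?thesis by blast
qed

text \<open>Among the intervals of largest exponent, the \<open>N\<close> siblings of one interval are all present: a shorter
sibling is excluded by maximality, and a longer one would not fit. Composing with an
expansion in the domain replaces the \<open>N\<close> siblings by their parent, so fewer intervals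
shrink.\<close>

lemma partition_word:
  assumes f: "\<And>j x. 0 \<le> x \<Longrightarrow> x \<le> 1 \<Longrightarrow> f (of_int j + x) = (of_int (a j) + x) / N ^ k j"
    and fin: "finite {j. k j \<noteq> 0}"
    and tail: "\<And>s. s \<ge> A \<Longrightarrow> f s = s + P * of_int c"
  shows "\<exists>ws\<in>words. \<forall>t. wact ws t = f t"
  using assms
proof (induction "card {j. k j \<noteq> 0}" arbitrary: f a k A c rule: less_induct)
  case less
  note f = less.prems(1) and fin = less.prems(2) and tail = less.prems(3)
  let ?n = "int p + 1"
  have nxt: "(a j + 1) * ?n ^ k (j + 1) = a (j + 1) * ?n ^ k j" for j
  proof -
    have "(of_int (a j) + 1) / N ^ k j = of_int (a (j + 1)) / N ^ k (j + 1)"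
      using f[of 1 j] f[of 0 "j + 1"] by simp
    then have "(of_int (a j) + 1) * N ^ k (j + 1) = of_int (a (j + 1)) * N ^ k j"
      using N_gt by (simp add: field_simps)
    then have "real_of_int ((a j + 1) * ?n ^ k (j + 1)) = of_int (a (j + 1) * ?n ^ k j)"
      by (simp add: N_def)
    then show ?thesis by (simp only: of_int_eq_iff)
  qed
  show ?case
  proof (cases "{j. k j \<noteq> 0} = {}")
    case True
    then have k0: "k j = 0" for j by auto
    have a1: "a (j + 1) = a j + 1" for j using nxt[of j] k0 by simp
    have a: "a j = a 0 + j" for j
    proof (induction j rule: int_induct[where k = 0])
      case (step2 i)
      then show ?case using a1[of "i - 1"] by simp
    qed (use a1 in auto)
    have f1: "f t = t + of_int (a 0)" for t
    proof -
      have "f (of_int \<lfloor>t\<rfloor> + frac t) = of_int (a \<lfloor>t\<rfloor>) + frac t"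
        using f[of "frac t" "\<lfloor>t\<rfloor>"] frac_lt_1[of t] k0 by simp
      moreover have "of_int \<lfloor>t\<rfloor> + frac t = t" by (simp add: frac_def)
      ultimately show ?thesis using a[of "\<lfloor>t\<rfloor>"] by (simp add: frac_def)
    qed
    have "real_of_int (a 0) = P * of_int c" using tail[of A] f1[of A] by simp
    then have "wact (shift_word (- c)) t = f t" for t using f1 by simp
    then show ?thesis using shift_word(1) by blast
  next
    case False
    let ?S = "{j. k j \<noteq> 0}"
    obtain j where j: "k j \<noteq> 0" and max: "\<And>i. k i \<le> k j"
    proof -
      have "Max (k ` ?S) \<in> k ` ?S" using False fin by (intro Max_in) auto
      then obtain j where j: "j \<in> ?S" "k j = Max (k ` ?S)" by auto
      have "k i \<le> Max (k ` ?S)" for i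
        using fin False by (cases "k i = 0") (auto intro!: Max_ge)
      then show thesis using j that[of j] by simp
    qed
    define K where "K = k j"
    have up: "k (i + 1) = K \<and> a (i + 1) = a i + 1" if "k i = K" "a i mod ?n \<noteq> int p" for i
    proof -
      have le: "k (i + 1) \<le> K" using max K_def by simp
      have "k (i + 1) = K"
      proof (rule ccontr)
        assume "k (i + 1) \<noteq> K"
        with le obtain m where m: "K = k (i + 1) + Suc m" by (metis less_imp_Suc_add order_le_neq_trans add_Suc_right)
        have "(a i + 1) * ?n ^ k (i + 1) = (a (i + 1) * ?n ^ Suc m) * ?n ^ k (i + 1)"
          using nxt[of i] that m by (simp add: power_add algebra_simps)
        then have "a i + 1 = a (i + 1) * ?n ^ Suc m" using p_pos by simp
        then have "(a i + 1) mod ?n = 0" by simp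
        then have "a i mod ?n = (0 - 1) mod ?n" by (metis mod_diff_left_eq add_diff_cancel_right')
        then show False using that(2) zmod_minus1[of ?n] by simp
      qed
      then show ?thesis using nxt[of i] that p_pos by simp
    qed
    have down: "k (i - 1) = K \<and> a (i - 1) = a i - 1" if "k i = K" "a i mod ?n \<noteq> 0" for i
    proof -
      have le: "k (i - 1) \<le> K" using max K_def by simp
      have n: "(a (i - 1) + 1) * ?n ^ K = a i * ?n ^ k (i - 1)" using nxt[of "i - 1"] that by simp
      have "k (i - 1) = K"
      proof (rule ccontr)
        assume "k (i - 1) \<noteq> K"
        with le obtain m where m: "K = k (i - 1) + Suc m" by (metis less_imp_Suc_add order_le_neq_trans add_Suc_right)
        have "a i * ?n ^ k (i - 1) = ((a (i - 1) + 1) * ?n ^ Suc m) * ?n ^ k (i - 1)"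
          using n m by (simp add: power_add algebra_simps)
        then have "a i = (a (i - 1) + 1) * ?n ^ Suc m" using p_pos by simp
        then show False using that(2) by simp
      qed
      then show ?thesis using n p_pos by auto
    qed
    define q r where "q = a j div ?n" and "r = a j mod ?n"
    have r: "0 \<le> r" "r \<le> int p" using pos_mod_bound[of ?n "a j"] by (auto simp: r_def)
    have aj: "a j = q * ?n + r" unfolding q_def r_def by (rule div_mult_mod_eq[symmetric])
    have U: "r + int m \<le> int p \<Longrightarrow> k (j + int m) = K \<and> a (j + int m) = a j + int m" for m
    proof (induction m)
      case (Suc m)
      have "(a j + int m) mod ?n = r + int m"
        using Suc.prems r by (simp add: aj mod_pos_pos_trivial add.assoc)
      then show ?case using Suc up[of "j + int m"] by (simp add: ac_simps)
    qed (simp add: K_def)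
    have L: "int m \<le> r \<Longrightarrow> k (j - int m) = K \<and> a (j - int m) = a j - int m" for m
    proof (induction m)
      case (Suc m)
      have "(a j - int m) mod ?n = (q * ?n + (r - int m)) mod ?n" by (simp add: aj algebra_simps)
      also have "\<dots> = r - int m"
        using Suc.prems r by (simp add: mod_pos_pos_trivial)
      finally have md: "(a j - int m) mod ?n = r - int m" .
      have ih: "k (j - int m) = K" "a (j - int m) = a j - int m" using Suc by simp_all
      have "a (j - int m) mod ?n \<noteq> 0" unfolding ih md using Suc.prems by simp
      from down[OF ih(1) this] show ?case using ih by (simp add: algebra_simps)
    qed (simp add: K_def)
    define j0 where "j0 = j - r"
    have sib: "k (j0 + m) = K \<and> a (j0 + m) = q * ?n + m" if "0 \<le> m" "m \<le> int p" for m
    proof (cases "m \<ge> r")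
      case True
      then have e: "j0 + m = j + int (nat (m - r))" by (simp add: j0_def)
      show ?thesis unfolding e using U[of "nat (m - r)"] that True by (simp add: aj)
    next
      case False
      then have e: "j0 + m = j - int (nat (r - m))" by (simp add: j0_def)
      show ?thesis unfolding e using L[of "nat (r - m)"] that False by (simp add: aj)
    qed
    have K: "K > 0" using j K_def by simp
    \<comment> \<open>The siblings j0, ..., j0 + p become one interval, so later indices drop by p.\<close>
    define f' where "f' t = f (expand j0 t)" for t
    define a' where "a' i = (if i < j0 then a i else if i = j0 then q else a (i + int p))" for i
    define k' where "k' i = (if i < j0 then k i else if i = j0 then K - 1 else k (i + int p))" for i
    have f': "f' (of_int i + x) = (of_int (a' i) + x) / N ^ k' i" if x: "0 \<le> x" "x \<le> 1" for i x
    proof -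
      consider "i < j0" | "i = j0" | "i > j0" by linarith
      then show ?thesis
      proof cases
        case 1
        then have "real_of_int i + x \<le> of_int j0" using x by linarith
        then show ?thesis using 1 f[OF x] by (simp add: f'_def a'_def k'_def expand_less)
      next
        case 2
        define m where "m = min \<lfloor>x * N\<rfloor> (int p)"
        have xN: "0 \<le> x * N" "x * N \<le> 1 * N" using x N_gt by (auto intro: mult_right_mono)
        then have m: "0 \<le> m" "m \<le> int p" by (auto simp: m_def)
        have "of_int m \<le> x * N" "x * N \<le> of_int m + 1"
        proof -
          show "of_int m \<le> x * N" using of_int_floor_le[of "x * N"] by (simp add: m_def min_def) linarith
          show "x * N \<le> of_int m + 1" using xN unfolding m_def min_def N_def by (auto; linarith)
        qed
        then have y: "0 \<le> x * N - of_int m" "x * N - of_int m \<le> 1" by auto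
        have "expand j0 (of_int j0 + x) = of_int (j0 + m) + (x * N - of_int m)"
          using x by (auto simp: expand_def)
        then have "f' (of_int i + x) = (of_int (q * ?n + m) + (x * N - of_int m)) / N ^ K"
          using f[OF y, of "j0 + m"] sib[OF m] 2 by (simp add: f'_def)
        also have "\<dots> = (of_int q + x) * N / (N ^ (K - 1) * N)"
          using K by (cases K) (auto simp: N_def algebra_simps)
        also have "\<dots> = (of_int q + x) / N ^ (K - 1)" using N_gt by simp
        finally show ?thesis using 2 by (simp add: a'_def k'_def)
      next
        case 3
        then have "real_of_int i + x \<ge> of_int j0 + 1" using x by linarith
        then have "f' (of_int i + x) = f (of_int (i + int p) + x)" by (simp add: f'_def expand_ge algebra_simps)
        then show ?thesis using 3 f[OF x, of "i + int p"] by (simp add: a'_def k'_def)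
      qed
    qed
    let ?S' = "{i. k' i \<noteq> 0}" and ?A = "{i\<in>?S. i < j0}" and ?B = "{i\<in>?S. i > j0 + int p}"
    have S': "?S' \<subseteq> ?A \<union> {j0} \<union> (\<lambda>i. i - int p) ` ?B"
      by (force simp: k'_def split: if_splits)
    have finAB: "finite ?A" "finite ?B" using fin by auto
    then have fin': "finite ?S'" using finite_subset[OF S'] by simp
    have "card ?S' \<le> card ((?A \<union> {j0}) \<union> (\<lambda>i. i - int p) ` ?B)" using finAB by (intro card_mono S') auto
    also have "\<dots> \<le> card (?A \<union> {j0}) + card ((\<lambda>i. i - int p) ` ?B)" by (rule card_Un_le)
    also have "card (?A \<union> {j0}) \<le> card ?A + card {j0}" by (rule card_Un_le)
    also have "card ((\<lambda>i. i - int p) ` ?B) \<le> card ?B" using finAB by (intro card_image_le) auto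
    finally have c1: "card ?S' \<le> card ?A + 1 + card ?B" by simp
    have in_S: "j0 \<in> ?S" "j0 + 1 \<in> ?S" using sib[of 0] sib[of 1] K p_pos by auto
    have "card (?A \<union> {j0, j0 + 1} \<union> ?B) = card (?A \<union> {j0, j0 + 1}) + card ?B"
      using finAB p_pos by (intro card_Un_disjoint) auto
    also have "card (?A \<union> {j0, j0 + 1}) = card ?A + card {j0, j0 + 1}"
      using finAB by (intro card_Un_disjoint) auto
    finally have "card (?A \<union> {j0, j0 + 1} \<union> ?B) = card ?A + 2 + card ?B" by simp
    moreover have "card (?A \<union> {j0, j0 + 1} \<union> ?B) \<le> card ?S" using in_S fin by (intro card_mono) auto
    ultimately have "card ?S' < card ?S" using c1 by simp
    moreover have "f' s = s + P * of_int (c + 1)" if "s \<ge> max A (of_int j0 + 1)" for s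
      using that tail[of "s + P"] N_gt(5) by (simp add: f'_def expand_ge algebra_simps)
    ultimately obtain ws where ws: "ws \<in> words" "\<And>t. wact ws t = f' t"
      using less.hyps[of k' f' a', OF _ f' fin'] by blast
    obtain vs where vs: "vs \<in> words" "\<And>t. wact vs t = merge j0 t" using merge_word by blast
    have "wact (vs @ ws) t = f t" for t using ws vs by (simp add: f'_def)
    moreover have "vs @ ws \<in> words" using ws vs by simp
    ultimately show ?thesis by blast
  qed
qed

section \<open>The line as the open unit interval\<close>

text \<open>\<open>H\<close> sends \<open>[- P m, - P m + P]\<close> for \<open>m \<ge> 1\<close> to \<open>[1 / N ^ (m + 1), 1 / N ^ m]\<close>, the trees hanging off the left
spine of the \<open>N\<close>-ary tree over the unit interval, and the unit intervals from \<open>0\<close> on to the trees hanging off its right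
spine. The first child of the root contains the left spine, whence the shift by \<open>1\<close> in the second
case.\<close>

definition H :: "real \<Rightarrow> real" where
  "H s = (if s < 0 then let m = nat (- \<lfloor>s / P\<rfloor>) in (1 + s + P * of_nat m) / N ^ (m + 1)
          else let k = nat \<lfloor>(s + 1) / P\<rfloor> in 1 - (N + P * of_nat k - s - 1) / N ^ (k + 1))"

lemma H_neg:
  assumes "- P * of_nat m \<le> s" "s \<le> P - P * of_nat m" "m \<ge> 1"
  shows "H s = (1 + s + P * of_nat m) / N ^ (m + 1)"
proof -
  consider "s < P - P * of_nat m" | "s = P - P * of_nat m" "m \<ge> 2" | "s = 0" "m = 1"
  proof -
    have "s = P - P * of_nat m \<Longrightarrow> \<not> m \<ge> 2 \<Longrightarrow> s = 0 \<and> m = 1"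
      using assms(3) by (cases "m = 1") auto
    then show thesis using that assms(2) by linarith
  qed
  then show ?thesis
  proof cases
    case 1
    have "P * 1 \<le> P * of_nat m" using assms(3) N_gt(5) by (intro mult_left_mono) auto
    then have "s < 0" using 1 by simp
    moreover have "\<lfloor>s / P\<rfloor> = - int m"
      using assms(1) 1 N_gt(5) by (intro floor_unique) (auto simp: field_simps)
    ultimately show ?thesis by (simp add: H_def)
  next
    case 2
    then obtain k where k: "m = Suc (Suc k)" by (metis Suc_le_D numeral_2_eq_2 Suc_le_mono)
    then have s: "s = - P * of_nat (Suc k)" using 2 by (simp add: algebra_simps)
    then have "s < 0" using N_gt(5) by (simp add: mult_neg_pos)
    moreover have "\<lfloor>s / P\<rfloor> = - int (Suc k)" using s N_gt(5) by (intro floor_unique) auto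
    then have "nat (- \<lfloor>s / P\<rfloor>) = Suc k" by simp
    ultimately have "H s = (1 + s + P * of_nat (Suc k)) / N ^ (Suc k + 1)" by (simp add: H_def Let_def)
    also have "\<dots> = N / (N * N ^ (Suc k + 1))" using s N_gt by simp
    also have "\<dots> = (1 + s + P * of_nat m) / N ^ (m + 1)" unfolding s k by (simp add: N_def algebra_simps)
    finally show ?thesis .
  next
    case 3
    have k: "nat \<lfloor>1 / P\<rfloor> = (if p = 1 then 1 else 0)" using p_pos by (auto simp: floor_eq_iff)
    show ?thesis
    proof (cases "p = 1")
      case True
      then have P1: "P = 1" by simp
      then have N2: "N = 2" unfolding N_def by (simp only:)
      show ?thesis unfolding 3 H_def P1 N2 by simp
    next
      case False
      then have "H s = 1 - (N - 1) / N" using 3 k by (simp add: H_def)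
      also have "\<dots> = (1 + s + P * of_nat m) / N ^ (m + 1)"
        unfolding 3 P_eq using N_gt by (simp add: field_simps)
      finally show ?thesis .
    qed
  qed
qed

lemma H_pos:
  assumes "s \<ge> 0" "P * of_nat k \<le> s + 1" "s + 1 \<le> P * of_nat k + P"
  shows "H s = 1 - (N + P * of_nat k - s - 1) / N ^ (k + 1)"
proof -
  consider "s + 1 < P * of_nat k + P" | "s + 1 = P * of_nat (Suc k)" using assms(3) by (auto simp: algebra_simps) linarith
  then show ?thesis
  proof cases
    case 1
    have "\<lfloor>(s + 1) / P\<rfloor> = int k"
      using assms(2) 1 N_gt(5) by (intro floor_unique) (auto simp: field_simps)
    then show ?thesis using assms(1) by (simp add: H_def)
  next
    case 2
    have "\<lfloor>(s + 1) / P\<rfloor> = int (Suc k)"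
      unfolding 2 using N_gt(5) by simp
    then have "nat \<lfloor>(s + 1) / P\<rfloor> = Suc k" by simp
    then have "H s = 1 - (N + P * of_nat (Suc k) - s - 1) / N ^ (Suc k + 1)"
      using assms(1) by (simp add: H_def Let_def)
    also have "\<dots> = 1 - N / (N * N ^ (k + 1))" using 2 by (simp add: algebra_simps)
    also have "\<dots> = 1 - 1 / N ^ (k + 1)" using N_gt by simp
    also have "\<dots> = 1 - (N + P * of_nat k - s - 1) / N ^ (k + 1)" using 2 by (simp add: N_def algebra_simps)
    finally show ?thesis .
  qed
qed

lemma neg_block: "s \<le> 0 \<Longrightarrow> \<exists>m\<ge>1. - P * of_nat m \<le> s \<and> s \<le> P - P * of_nat m \<and> (s < 0 \<longrightarrow> s < P - P * of_nat m)"
proof -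
  assume s: "s \<le> 0"
  show ?thesis
  proof (cases "s = 0")
    case True
    then show ?thesis by (intro exI[of _ 1]) auto
  next
    case False
    obtain q where q: "P * of_int q \<le> s" "s < P * of_int q + P" using block_exists by blast
    then have "q \<le> -1" using s False mult_P_cases[of q] N_gt(5) by linarith
    then have "real (nat (- q)) = - of_int q" "nat (- q) \<ge> 1" by auto
    then show ?thesis using q by (intro exI[of _ "nat (- q)"]) auto
  qed
qed

lemma pos_block: "s \<ge> 0 \<Longrightarrow> \<exists>k. P * of_nat k \<le> s + 1 \<and> s + 1 < P * of_nat k + P"
proof -
  assume s: "s \<ge> 0"
  obtain q where q: "P * of_int q \<le> s + 1" "s + 1 < P * of_int q + P" using block_exists by blast
  then have "q \<ge> 0" using s mult_P_cases[of q] N_gt(5) by linarith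
  then show ?thesis using q by (intro exI[of _ "nat q"]) auto
qed

lemma H_minus: "s \<le> 0 \<Longrightarrow> H (s - P) = H s / N"
proof -
  assume "s \<le> 0"
  then obtain m where m: "m \<ge> 1" "- P * of_nat m \<le> s" "s \<le> P - P * of_nat m" using neg_block by blast
  have "H (s - P) = (1 + (s - P) + P * of_nat (Suc m)) / N ^ (Suc m + 1)"
    using m by (intro H_neg) (auto simp: algebra_simps)
  then show ?thesis using H_neg[OF m(2,3,1)] by (simp add: algebra_simps)
qed

lemma H_plus: "s \<ge> 0 \<Longrightarrow> 1 - H (s + P) = (1 - H s) / N"
proof -
  assume s: "s \<ge> 0"
  then obtain k where k: "P * of_nat k \<le> s + 1" "s + 1 \<le> P * of_nat k + P" using pos_block by force
  have "H (s + P) = 1 - (N + P * of_nat (Suc k) - (s + P) - 1) / N ^ (Suc k + 1)"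
    using k s by (intro H_pos) (auto simp: algebra_simps)
  also have "N + P * of_nat (Suc k) - (s + P) - 1 = N + P * of_nat k - s - 1" by (simp add: algebra_simps)
  finally show ?thesis using H_pos[OF s k] by (simp add: mult.commute)
qed

lemma H_mid:
  "- P \<le> s \<Longrightarrow> s \<le> 0 \<Longrightarrow> H s = (s + N) / N\<^sup>2"
  "0 \<le> s \<Longrightarrow> s \<le> P - 1 \<Longrightarrow> H s = (s + 1) / N"
  "P - 1 \<le> s \<Longrightarrow> s \<le> 2 * P - 1 \<Longrightarrow> H s = P / N + (s + 1 - P) / N\<^sup>2"
proof -
  show "- P \<le> s \<Longrightarrow> s \<le> 0 \<Longrightarrow> H s = (s + N) / N\<^sup>2"
    using H_neg[of 1 s] by (simp add: N_def add_ac power2_eq_square)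
  show "0 \<le> s \<Longrightarrow> s \<le> P - 1 \<Longrightarrow> H s = (s + 1) / N"
    using H_pos[of s 0] N_gt by (simp add: field_simps)
  assume s: "P - 1 \<le> s" "s \<le> 2 * P - 1"
  then have "H s = 1 - (N + P - s - 1) / N\<^sup>2" using H_pos[of s 1] N_gt by (simp add: power2_eq_square)
  also have "\<dots> = P / N + (s + 1 - P) / N\<^sup>2"
    using N_gt by (simp add: power2_eq_square divide_simps) (simp add: N_def algebra_simps)
  finally show "H s = P / N + (s + 1 - P) / N\<^sup>2" .
qed

lemma H_neg_bounds:
  assumes "- P * of_nat m \<le> s" "s < P - P * of_nat m" "m \<ge> 1"
  shows "1 / N ^ (m + 1) \<le> H s" "H s < 1 / N ^ m"
proof -
  have H: "H s = (1 + s + P * of_nat m) / N ^ (m + 1)" using assms by (intro H_neg) auto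
  show "1 / N ^ (m + 1) \<le> H s" unfolding H using assms N_gt by (intro divide_right_mono) auto
  have "H s < N / N ^ (m + 1)" unfolding H using assms N_gt by (intro divide_strict_right_mono) (auto simp: N_def)
  then show "H s < 1 / N ^ m" using N_gt by simp
qed

lemma H_pos_bounds:
  assumes "s \<ge> 0" "P * of_nat k \<le> s + 1" "s + 1 < P * of_nat k + P"
  shows "1 / N ^ (k + 1) < 1 - H s" "1 - H s \<le> 1 / N ^ k"
proof -
  have H: "1 - H s = (N + P * of_nat k - s - 1) / N ^ (k + 1)" using assms H_pos[of s k] by simp
  show "1 / N ^ (k + 1) < 1 - H s" unfolding H using assms N_gt by (intro divide_strict_right_mono) (auto simp: N_def)
  have "1 - H s \<le> N / N ^ (k + 1)" unfolding H using assms N_gt by (intro divide_right_mono) auto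
  then show "1 - H s \<le> 1 / N ^ k" using N_gt by simp
qed

lemma H_less_iff_neg: "H s < 1 / N \<longleftrightarrow> s < 0"
proof
  assume "s < 0"
  then obtain m where m: "m \<ge> 1" "- P * of_nat m \<le> s" "s < P - P * of_nat m" using neg_block[of s] by auto
  have "1 / N ^ m \<le> 1 / N ^ 1" using m(1) N_gt by (intro divide_left_mono power_increasing) auto
  then show "H s < 1 / N" using H_neg_bounds(2)[OF m(2,3,1)] by simp
next
  assume H: "H s < 1 / N"
  show "s < 0"
  proof (rule ccontr)
    assume "\<not> s < 0"
    then have s: "s \<ge> 0" by simp
    show False
    proof (cases "s \<le> P - 1")
      case True
      have "1 / N \<le> (s + 1) / N" using s N_gt by (intro divide_right_mono) auto
      then show False using H H_mid(2)[OF s True] by simp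
    next
      case False
      obtain k where k: "P * of_nat k \<le> s + 1" "s + 1 < P * of_nat k + P" using pos_block[OF s] by blast
      then have "k \<noteq> 0" using False by (cases "k = 0") auto
      then have "1 / N ^ k \<le> 1 / N ^ 1" using N_gt by (intro divide_left_mono power_increasing) auto
      then have "1 - H s \<le> 1 / N" using H_pos_bounds(2)[OF s k] by simp
      moreover have "1 / N \<le> 1 / 2" using N_gt by (intro divide_left_mono) auto
      ultimately show False using H by linarith
    qed
  qed
qed

lemma H_range: "0 < H s" "H s < 1"
proof -
  show "0 < H s"
  proof (cases "s < 0")
    case True
    then obtain m where m: "m \<ge> 1" "- P * of_nat m \<le> s" "s < P - P * of_nat m" using neg_block[of s] by auto
    have "0 < 1 / N ^ (m + 1)" using N_gt by simp
    then show ?thesis using H_neg_bounds(1)[OF m(2,3,1)] by linarith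
  next
    case False
    have "0 < 1 / N" using N_gt by simp
    then show ?thesis using H_less_iff_neg[of s] False by linarith
  qed
  show "H s < 1"
  proof (cases "s < 0")
    case True
    have "1 / N < 1" using N_gt by simp
    then show ?thesis using H_less_iff_neg[of s] True by linarith
  next
    case False
    then obtain k where k: "P * of_nat k \<le> s + 1" "s + 1 < P * of_nat k + P" using pos_block[of s] by auto
    have "0 < 1 / N ^ (k + 1)" using N_gt by simp
    then show ?thesis using H_pos_bounds(1)[of s k] k False by linarith
  qed
qed

lemma power_gap: "1 / N ^ (m + 1) \<le> y \<Longrightarrow> y < 1 / N ^ n \<Longrightarrow> n \<le> m"
proof (rule ccontr)
  assume y: "1 / N ^ (m + 1) \<le> y" "y < 1 / N ^ n" and "\<not> n \<le> m"
  then have "1 / N ^ n \<le> 1 / N ^ (m + 1)" using N_gt by (intro divide_left_mono power_increasing) auto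
  with y show False by linarith
qed

lemma power_gap': "1 / N ^ (m + 1) < y \<Longrightarrow> y \<le> 1 / N ^ n \<Longrightarrow> n \<le> m"
proof (rule ccontr)
  assume y: "1 / N ^ (m + 1) < y" "y \<le> 1 / N ^ n" and "\<not> n \<le> m"
  then have "1 / N ^ n \<le> 1 / N ^ (m + 1)" using N_gt by (intro divide_left_mono power_increasing) auto
  with y show False by linarith
qed

lemma H_inj: "H s = H t \<Longrightarrow> s = t"
proof -
  assume eq: "H s = H t"
  then have sg: "s < 0 \<longleftrightarrow> t < 0" using H_less_iff_neg by metis
  show ?thesis
  proof (cases "s < 0")
    case True
    obtain m where m: "m \<ge> 1" "- P * of_nat m \<le> s" "s < P - P * of_nat m" using True neg_block[of s] by auto
    obtain n where n: "n \<ge> 1" "- P * of_nat n \<le> t" "t < P - P * of_nat n" using True sg neg_block[of t] by auto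
    note bm = H_neg_bounds[OF m(2,3,1)] and bn = H_neg_bounds[OF n(2,3,1)]
    have "n = m" using power_gap[OF bm(1) bn(2)[folded eq]] power_gap[OF bn(1) bm(2)[unfolded eq]] by simp
    then show ?thesis using eq H_neg[of m s] H_neg[of n t] m n N_gt by simp
  next
    case False
    then have st: "s \<ge> 0" "t \<ge> 0" using sg by auto
    obtain m where m: "P * of_nat m \<le> s + 1" "s + 1 < P * of_nat m + P" using pos_block[OF st(1)] by auto
    obtain n where n: "P * of_nat n \<le> t + 1" "t + 1 < P * of_nat n + P" using pos_block[OF st(2)] by auto
    note bm = H_pos_bounds[OF st(1) m] and bn = H_pos_bounds[OF st(2) n]
    have "n = m" using power_gap'[OF bm(1) bn(2)[folded eq]] power_gap'[OF bn(1) bm(2)[unfolded eq]] by simp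
    then show ?thesis using eq H_pos[of s m] H_pos[of t n] m n st N_gt by simp
  qed
qed

lemma power_block:
  assumes "0 < y"
  obtains m where "1 / N ^ (m + 1) \<le> y" "m = 0 \<or> y < 1 / N ^ m"
proof -
  have ex: "\<exists>m. 1 / N ^ (m + 1) \<le> y"
  proof -
    have "1 / N < 1" using N_gt by simp
    from real_arch_pow_inv[OF assms this] obtain n where "(1 / N) ^ n < y" by blast
    then have n: "1 / N ^ n < y" by (simp add: power_one_over)
    have "1 / N ^ (n + 1) \<le> 1 / N ^ n" using N_gt by (intro divide_left_mono power_increasing) auto
    then show ?thesis using n by (intro exI[of _ n]) linarith
  qed
  define m where "m = (LEAST m. 1 / N ^ (m + 1) \<le> y)"
  have A: "1 / N ^ (m + 1) \<le> y" unfolding m_def by (rule LeastI_ex[OF ex])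
  have "y < 1 / N ^ m" if "m \<noteq> 0"
  proof -
    have "\<not> 1 / N ^ (m - 1 + 1) \<le> y" using that not_less_Least[of "m - 1" "\<lambda>m. 1 / N ^ (m + 1) \<le> y"] by (simp add: m_def)
    then show ?thesis using that by simp
  qed
  then have "m = 0 \<or> y < 1 / N ^ m" by (cases "m = 0") auto
  with A show thesis by (rule that)
qed

lemma H_surj: "0 < y \<Longrightarrow> y < 1 \<Longrightarrow> \<exists>s. H s = y"
proof -
  assume y: "0 < y" "y < 1"
  show ?thesis
  proof (cases "y < 1 / N")
    case True
    obtain m where m: "1 / N ^ (m + 1) \<le> y" "m = 0 \<or> y < 1 / N ^ m" using power_block[OF y(1)] .
    have m1: "m \<ge> 1" using m(1) True by (cases m) auto
    define z where "z = y * N ^ (m + 1)"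
    let ?s = "z - 1 - P * of_nat m"
    have a: "1 \<le> z" using m(1) N_gt by (simp add: z_def field_simps)
    have "y * N ^ m < 1" using m m1 N_gt by (simp add: field_simps)
    then have "y * N ^ m * N < 1 * N" using N_gt by (intro mult_strict_right_mono) auto
    then have b: "z < N" by (simp add: z_def mult_ac)
    have "H ?s = (1 + ?s + P * of_nat m) / N ^ (m + 1)"
      using m1 a b by (intro H_neg) (auto simp: N_def)
    then have "H ?s = z / N ^ (m + 1)" by simp
    then show ?thesis using N_gt by (intro exI[of _ ?s]) (simp add: z_def)
  next
    case False
    obtain k where k: "1 / N ^ (k + 1) \<le> 1 - y" "k = 0 \<or> 1 - y < 1 / N ^ k" using power_block[of "1 - y"] y by auto
    define z where "z = (1 - y) * N ^ (k + 1)"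
    let ?s = "N + P * of_nat k - 1 - z"
    have a: "1 \<le> z" using k(1) N_gt by (simp add: z_def field_simps)
    have "(1 - y) * N ^ k \<le> 1" using k(2) y N_gt by (auto simp: field_simps)
    then have "(1 - y) * N ^ k * N \<le> 1 * N" using N_gt by (intro mult_right_mono) auto
    then have b: "z \<le> N" by (simp add: z_def mult_ac)
    have "?s \<ge> 0"
    proof (cases "k = 0")
      case True
      then show ?thesis using False N_gt by (simp add: z_def field_simps)
    next
      case False
      then have "P * 1 \<le> P * of_nat k" using N_gt(5) by (intro mult_left_mono) auto
      then show ?thesis using b N_gt by linarith
    qed
    then have "H ?s = 1 - (N + P * of_nat k - ?s - 1) / N ^ (k + 1)"
      using a b by (intro H_pos) (auto simp: N_def)
    then have "H ?s = 1 - z / N ^ (k + 1)" by simp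
    then show ?thesis using N_gt by (intro exI[of _ ?s]) (simp add: z_def)
  qed
qed

section \<open>The generators as moves\<close>

lemma subdiv_point_eq: "subdiv_point p i k =
    (if k \<le> i then real k / N
     else if k \<le> i + p + 1 then real i / N + (real k - real i) / N\<^sup>2
     else (real k - P) / N)"
  unfolding subdiv_point_def by (simp add: N_def of_nat_diff add.commute)

text \<open>The common form of all the pieces of a generator: it carries the parameter of one subdivision interval
to that of the corresponding one.\<close>

lemma gen_low_piece:
  assumes "j \<le> 2 * p" "0 \<le> x" "x \<le> 1"
  shows "gen_low p i (subdiv_point p p j + x * (subdiv_point p p (j + 1) - subdiv_point p p j)) =
    subdiv_point p i j + x * (subdiv_point p i (j + 1) - subdiv_point p i j)"
proof -
  let ?D = "subdiv_point p p (j + 1) - subdiv_point p p j"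
  have D: "?D > 0" using subdiv_point_less[of p p j] by simp
  have "0 \<le> x * ?D" "x * ?D \<le> 1 * ?D" using assms D by (auto intro!: mult_right_mono)
  then have "subdiv_point p p j + x * ?D \<in> {subdiv_point p p j..subdiv_point p p (j + 1)}" by auto
  from gen_low_affine[OF assms(1) this, of i] show ?thesis using D by simp
qed

lemma dom_first: "subdiv_point p p 0 = 0" "subdiv_point p p (0 + 1) = 1 / N"
  using p_pos by (auto simp: subdiv_point_eq)

lemma dom_last: "subdiv_point p p (2 * p) = 1 - 1 / N\<^sup>2" "subdiv_point p p (2 * p + 1) = 1"
proof -
  have "subdiv_point p p (2 * p) = P / N + P / N\<^sup>2" using p_pos by (auto simp: subdiv_point_eq)
  also have "\<dots> = 1 - 1 / N\<^sup>2" unfolding P_eq using N_gt by (simp add: power2_eq_square field_simps)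
  finally show "subdiv_point p p (2 * p) = 1 - 1 / N\<^sup>2" .
  have "subdiv_point p p (2 * p + 1) = P / N + (P + 1) / N\<^sup>2" by (auto simp: subdiv_point_eq)
  also have "P + 1 = N" by (simp add: N_def)
  also have "P / N + N / N\<^sup>2 = (P + 1) / N" using N_gt by (simp add: power2_eq_square field_simps)
  also have "\<dots> = 1" using N_gt by (simp add: N_def)
  finally show "subdiv_point p p (2 * p + 1) = 1" .
qed

lemma ran_last: "i < p \<Longrightarrow> subdiv_point p i (2 * p) = P / N" "i < p \<Longrightarrow> subdiv_point p i (2 * p + 1) = 1"
proof -
  assume i: "i < p"
  show "subdiv_point p i (2 * p + 1) = 1" using i N_gt by (auto simp: subdiv_point_eq) (simp add: N_def)
  show "subdiv_point p i (2 * p) = P / N"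
  proof (cases "2 * p = i + p + 1")
    case True
    have "subdiv_point p i (i + p + 1) = real i / N + (P + 1) / N\<^sup>2"
      by (auto simp: subdiv_point_eq)
    then have "subdiv_point p i (2 * p) = real i / N + (P + 1) / N\<^sup>2" using True by (simp only:)
    also have "P + 1 = N" by (simp add: N_def)
    also have "real i / N + N / N\<^sup>2 = (real i + 1) / N" using N_gt by (simp add: power2_eq_square field_simps)
    also have "real i + 1 = P" using True by linarith
    finally show ?thesis .
  qed (use i in \<open>auto simp: subdiv_point_eq\<close>)
qed

lemma gen_low_first:
  assumes "0 \<le> t" "t \<le> 1 / N"
  shows "i \<ge> 1 \<Longrightarrow> gen_low p i t = t" "gen_low p 0 t = t / N"
proof -
  have x: "0 \<le> t * N" "t * N \<le> 1" using assms N_gt by (auto simp: field_simps)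
  have t: "subdiv_point p p 0 + t * N * (subdiv_point p p (0 + 1) - subdiv_point p p 0) = t"
    unfolding dom_first using N_gt by simp
  note g = gen_low_piece[of 0 "t * N", OF _ x, unfolded t]
  show "i \<ge> 1 \<Longrightarrow> gen_low p i t = t" using g[of i] N_gt by (simp add: subdiv_point_eq)
  show "gen_low p 0 t = t / N" using g[of 0] N_gt by (simp add: subdiv_point_eq power2_eq_square)
qed

lemma gen_low_last:
  assumes "1 - 1 / N\<^sup>2 \<le> t" "t \<le> 1" "i < p"
  shows "gen_low p i t = 1 - N * (1 - t)"
proof -
  let ?x = "1 - (1 - t) * N\<^sup>2"
  have "(1 - t) * N\<^sup>2 \<le> 1 / N\<^sup>2 * N\<^sup>2" using assms N_gt by (intro mult_right_mono) auto
  then have x: "0 \<le> ?x" "?x \<le> 1" using assms N_gt by auto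
  have t: "subdiv_point p p (2 * p) + ?x * (subdiv_point p p (2 * p + 1) - subdiv_point p p (2 * p)) = t"
    unfolding dom_last using N_gt by (simp add: field_simps)
  have "gen_low p i t = P / N + ?x * (1 - P / N)"
    using gen_low_piece[of "2 * p", OF _ x, of i] unfolding t ran_last[OF assms(3)] by simp
  also have "1 - P / N = 1 / N" using N_gt by (simp add: N_def field_simps)
  also have "P / N + ?x * (1 / N) = 1 - N * (1 - t)"
    using N_gt unfolding P_eq by (simp add: power2_eq_square field_simps)
  finally show ?thesis .
qed

lemma H_first: "s \<le> 0 \<Longrightarrow> 0 \<le> H s \<and> H s \<le> 1 / N"
  using H_range[of s] H_less_iff_neg[of s] H_mid(1)[of 0] N_gt
  by (cases "s = 0") (auto simp: power2_eq_square)

lemma H_last: "s \<ge> 2 * P - 1 \<Longrightarrow> 1 - 1 / N\<^sup>2 \<le> H s \<and> H s \<le> 1"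
proof -
  assume s: "s \<ge> 2 * P - 1"
  then have s0: "s \<ge> 0" using N_gt by linarith
  obtain k where k: "P * of_nat k \<le> s + 1" "s + 1 < P * of_nat k + P" using pos_block[OF s0] by auto
  have "k \<ge> 2"
  proof (rule ccontr)
    assume "\<not> k \<ge> 2"
    then have "P * of_nat k \<le> P * 1" by (intro mult_left_mono) auto
    then show False using k s by linarith
  qed
  then have "1 / N ^ k \<le> 1 / N\<^sup>2" using N_gt by (intro divide_left_mono power_increasing) auto
  then show ?thesis using H_pos_bounds(2)[OF s0 k] H_range[of s] by linarith
qed

text \<open>For \<open>1 \<le> j \<le> 2 p - 1\<close> the \<open>j\<close>-th interval of the domain subdivision is the image under \<open>H\<close> of the unit interval
\<open>[j - 1, j]\<close>. The two remaining intervals of the subdivision correspond to half-lines.\<close>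

lemma gen_low_middle:
  assumes "1 \<le> j" "j \<le> 2 * p - 1" "of_nat j - 1 \<le> s" "s \<le> of_nat j"
  shows "gen_low p i (H s) = subdiv_point p i j + (s - of_nat j + 1) * (subdiv_point p i (j + 1) - subdiv_point p i j)"
proof -
  let ?A = "subdiv_point p p"
  have "H s = ?A j + (s - of_nat j + 1) * (?A (j + 1) - ?A j)"
  proof (cases "j < p")
    case True
    have r: "real j + 1 \<le> P" using True by linarith
    have s: "0 \<le> s" "s \<le> P - 1" using assms r by linarith+
    have "?A j = real j / N" "?A (j + 1) = (real j + 1) / N" using True by (auto simp: subdiv_point_eq)
    then show ?thesis using H_mid(2)[OF s]
      by (simp add: diff_divide_distrib[symmetric] add_divide_distrib[symmetric])
  next
    case False
    have r: "real j \<ge> P" "real j \<le> 2 * P - 1" using False assms(2) p_pos by (auto simp: of_nat_diff)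
    have s: "P - 1 \<le> s" "s \<le> 2 * P - 1" using assms r by linarith+
    have A: "?A j = P / N + (real j - P) / N\<^sup>2" "?A (j + 1) = P / N + (real j + 1 - P) / N\<^sup>2"
      using False assms(2) p_pos by (auto simp: subdiv_point_eq)
    have d: "?A (j + 1) - ?A j = 1 / N\<^sup>2" unfolding A by (simp add: diff_divide_distrib[symmetric])
    have "?A j + (s - of_nat j + 1) * (?A (j + 1) - ?A j) = P / N + ((real j - P) + (s - real j + 1)) / N\<^sup>2"
      unfolding d unfolding A(1) by (simp only: add_divide_distrib[of "real j - P"] times_divide_eq_right mult_1_right add.assoc)
    then show ?thesis using H_mid(3)[OF s] by (simp add: algebra_simps)
  qed
  then show ?thesis using gen_low_piece[of j "s - of_nat j + 1" i] assms by simp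
qed

lemma middle_index:
  assumes "0 \<le> s" "s < 2 * P - 1"
  obtains j where "1 \<le> j" "j \<le> 2 * p - 1" "of_nat j - 1 \<le> s" "s \<le> of_nat j" "s < of_nat j"
proof -
  let ?j = "nat (\<lfloor>s\<rfloor> + 1)"
  have j: "real ?j = of_int \<lfloor>s\<rfloor> + 1" using assms by simp
  have b: "of_int \<lfloor>s\<rfloor> \<le> s" "s < of_int \<lfloor>s\<rfloor> + 1" by linarith+
  have "real ?j < 2 * P" using j b assms by linarith
  then have "?j < 2 * p" by linarith
  moreover have "?j \<ge> 1" using assms(1) by linarith
  ultimately show thesis using b j by (intro that[of ?j]) linarith+
qed

lemma gen_low_0_H: "gen_low p 0 (H s) = H (s - P)"
proof -
  consider "s \<le> 0" | "0 \<le> s" "s < 2 * P - 1" | "s \<ge> 2 * P - 1" by linarith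
  then show ?thesis
  proof cases
    case 1
    then show ?thesis using gen_low_first(2)[of "H s"] H_first[of s] H_minus[of s] by simp
  next
    case 2
    obtain j where j: "1 \<le> j" "j \<le> 2 * p - 1" "of_nat j - 1 \<le> s" "s \<le> of_nat j"
      using middle_index[OF 2] by metis
    note g = gen_low_middle[OF j, of 0]
    show ?thesis
    proof (cases "j \<le> p")
      case True
      then have r: "real j \<le> P" by simp
      have S: "subdiv_point p 0 j = real j / N\<^sup>2" "subdiv_point p 0 (j + 1) = (real j + 1) / N\<^sup>2"
        using True j by (auto simp: subdiv_point_eq)
      have "gen_low p 0 (H s) = (s + 1) / N\<^sup>2" unfolding g S
        by (simp add: diff_divide_distrib[symmetric] add_divide_distrib[symmetric])
      also have "\<dots> = H (s - P)" using H_mid(1)[of "s - P"] 2 j r by (simp add: N_def algebra_simps)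
      finally show ?thesis .
    next
      case False
      then have r: "real j \<ge> P + 1" "real j \<le> 2 * P - 1" using j p_pos by (auto simp: of_nat_diff)
      have S: "subdiv_point p 0 j = (real j - P) / N" "subdiv_point p 0 (j + 1) = (real j + 1 - P) / N"
      proof -
        show "subdiv_point p 0 j = (real j - P) / N"
        proof (cases "j = p + 1")
          case True
          have "(P + 1) / N\<^sup>2 = 1 / N" using N_gt by (simp add: power2_eq_square N_def[symmetric])
          then show ?thesis using True by (simp add: subdiv_point_eq add.commute)
        qed (use False in \<open>auto simp: subdiv_point_eq\<close>)
        show "subdiv_point p 0 (j + 1) = (real j + 1 - P) / N" using False by (auto simp: subdiv_point_eq)
      qed
      have "gen_low p 0 (H s) = (s - P + 1) / N" unfolding g S
        by (simp add: diff_divide_distrib[symmetric] add_divide_distrib[symmetric])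
      also have "\<dots> = H (s - P)" using H_mid(2)[of "s - P"] j r by simp
      finally show ?thesis .
    qed
  next
    case 3
    have "1 - H s = (1 - H (s - P)) / N" using H_plus[of "s - P"] 3 N_gt by simp
    then have "N * (1 - H s) = 1 - H (s - P)" using N_gt by simp
    then show ?thesis using gen_low_last[of "H s" 0] H_last[OF 3] p_pos by simp
  qed
qed

lemma gen_low_H:
  assumes i: "1 \<le> i" "i < p"
  shows "gen_low p i (H s) = H (merge (int i - 1) s)"
proof -
  let ?m = "merge (int i - 1)"
  have ir: "real i \<ge> 1" "real i + 1 \<le> P" using i by linarith+
  consider "s \<le> 0" | "0 \<le> s" "s < 2 * P - 1" | "s \<ge> 2 * P - 1" by linarith
  then show ?thesis
  proof cases
    case 1
    then have "?m s = s" using ir by (intro merge_less) simp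
    then show ?thesis using gen_low_first(1)[of "H s" i] H_first[of s] 1 i by simp
  next
    case 2
    obtain j where j: "1 \<le> j" "j \<le> 2 * p - 1" "of_nat j - 1 \<le> s" "s \<le> of_nat j" "s < of_nat j"
      using middle_index[OF 2] by metis
    note g = gen_low_middle[OF j(1-4), of i]
    consider "j < i" | "i \<le> j" "j \<le> i + p" | "j \<ge> i + p + 1" by linarith
    then show ?thesis
    proof cases
      case 1
      then have r: "real j + 1 \<le> real i" by linarith
      have "?m s = s" using r j by (intro merge_less) simp
      have S: "subdiv_point p i j = real j / N" "subdiv_point p i (j + 1) = (real j + 1) / N"
        using 1 by (auto simp: subdiv_point_eq)
      have "gen_low p i (H s) = (s + 1) / N" unfolding g S
        by (simp add: diff_divide_distrib[symmetric] add_divide_distrib[symmetric])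
      then show ?thesis using \<open>?m s = s\<close> H_mid(2)[of s] 2 j r ir by simp
    next
      case b: 2
      then have r: "real i \<le> real j" "real j \<le> real i + P" by linarith+
      have S: "subdiv_point p i j = real i / N + (real j - real i) / N\<^sup>2"
        "subdiv_point p i (j + 1) = real i / N + (real j + 1 - real i) / N\<^sup>2"
        using b by (auto simp: subdiv_point_eq)
      have "gen_low p i (H s) = real i / N + (s + 1 - real i) / N\<^sup>2" unfolding g S
        by (simp add: diff_divide_distrib[symmetric] add_divide_distrib[symmetric])
      moreover have "?m s = real i - 1 + (s - (real i - 1)) / N"
        using j r N_gt by (cases "s = real i - 1") (auto simp: merge_def N_def)
      moreover have "0 \<le> (s - (real i - 1)) / N" "(s - (real i - 1)) / N \<le> 1"
        using j r N_gt by (auto simp: N_def)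
      then have "H (real i - 1 + (s - (real i - 1)) / N) = (real i - 1 + (s - (real i - 1)) / N + 1) / N"
        using ir by (intro H_mid(2)) linarith+
      ultimately show ?thesis
        by (simp add: add_divide_distrib diff_divide_distrib power2_eq_square)
    next
      case 3
      then have r: "real j \<ge> real i + P + 1" "real j \<le> 2 * P - 1" using j p_pos by (auto simp: of_nat_diff)
      have S: "subdiv_point p i j = (real j - P) / N" "subdiv_point p i (j + 1) = (real j + 1 - P) / N"
      proof -
        show "subdiv_point p i j = (real j - P) / N"
        proof (cases "j = i + p + 1")
          case True
          then have "subdiv_point p i j = real i / N + N / N\<^sup>2" by (simp add: subdiv_point_eq) (simp add: N_def)
          also have "\<dots> = (real j - P) / N" using True N_gt by (simp add: power2_eq_square add_divide_distrib)
          finally show ?thesis .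
        qed (use 3 in \<open>auto simp: subdiv_point_eq\<close>)
        show "subdiv_point p i (j + 1) = (real j + 1 - P) / N" using 3 by (auto simp: subdiv_point_eq)
      qed
      have "gen_low p i (H s) = (s - P + 1) / N" unfolding g S
        by (simp add: diff_divide_distrib[symmetric] add_divide_distrib[symmetric])
      also have "\<dots> = H (s - P)" using H_mid(2)[of "s - P"] j r ir by simp
      also have "s - P = ?m s" using j r by (subst merge_ge) (auto simp: N_def)
      finally show ?thesis .
    qed
  next
    case 3
    have "1 - H s = (1 - H (s - P)) / N" using H_plus[of "s - P"] 3 N_gt by simp
    then have "N * (1 - H s) = 1 - H (s - P)" using N_gt by simp
    moreover have "?m s = s - P" using 3 ir by (intro merge_ge) (simp add: N_def)
    ultimately show ?thesis using gen_low_last[of "H s" i] H_last[OF 3] i by simp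
  qed
qed

lemma gen_last_H: "gen_last p (H s) = H (merge (int p - 1) s)"
proof -
  have r: "H s \<in> {0..1}" using H_range[of s] by simp
  have gl: "gen_last p (H s) = (if H s \<le> P / N then H s else (P + gen_low p 0 (N * H s - P)) / N)"
    using r by (simp add: gen_last_def N_def add.commute)
  consider "s \<le> P - 1" | "P - 1 < s" "s \<le> P" | "P < s" by linarith
  then show ?thesis
  proof cases
    case 1
    have "H s \<le> P / N"
    proof (cases "s \<le> 0")
      case True
      have "1 / N \<le> P / N" using N_gt by (intro divide_right_mono) auto
      then show ?thesis using H_first[OF True] by linarith
    next
      case False
      then show ?thesis using H_mid(2)[of s] 1 N_gt by (simp add: divide_right_mono)
    qed
    then show ?thesis using 1 gl by (simp add: merge_less)
  next
    case 2
    have H: "H s = P / N + (s + 1 - P) / N\<^sup>2" using 2 N_gt by (intro H_mid(3)) auto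
    have "(s + 1 - P) / N\<^sup>2 > 0" using 2 N_gt by simp
    then have n: "\<not> H s \<le> P / N" using H by simp
    have y: "N * H s - P = (s + 1 - P) / N" unfolding H using N_gt by (simp add: power2_eq_square distrib_left)
    have "gen_low p 0 ((s + 1 - P) / N) = (s + 1 - P) / N / N"
      using 2 N_gt by (intro gen_low_first(2)) (auto intro: divide_right_mono)
    then have g: "gen_last p (H s) = (P + (s + 1 - P) / N / N) / N" using gl n y by simp
    have m: "merge (int p - 1) s = P - 1 + (s + 1 - P) / N"
      using 2 N_gt by (simp add: merge_def N_def algebra_simps)
    have b: "0 \<le> (s + 1 - P) / N" "(s + 1 - P) / N \<le> 1" using 2 N_gt by auto
    have "H (merge (int p - 1) s) = P / N + (s + 1 - P) / N / N\<^sup>2"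
      unfolding m using b N_gt(4) H_mid(3)[of "P - 1 + (s + 1 - P) / N"] by simp
    then show ?thesis unfolding g by (simp add: add_divide_distrib power2_eq_square)
  next
    case 3
    have "1 - H s = (1 - H (s - P)) / N" using H_plus[of "s - P"] 3 by simp
    then have y: "N * H s - P = H (s - P)" using N_gt by (simp add: N_def field_simps)
    then have "N * H s > P" using H_range[of "s - P"] by linarith
    then have n: "\<not> H s \<le> P / N" using N_gt by (simp add: field_simps)
    have g: "gen_last p (H s) = (P + H (s - 2 * P)) / N"
      using gl n y gen_low_0_H[of "s - P"] by (simp add: algebra_simps)
    show ?thesis
    proof (cases "s \<le> 2 * P")
      case True
      have m: "merge (int p - 1) s = P - 1 + (s + 1 - P) / N"
        using 3 True N_gt by (simp add: merge_def N_def algebra_simps)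
      have b: "0 \<le> (s + 1 - P) / N" "(s + 1 - P) / N \<le> 1" using 3 True N_gt by (auto simp: N_def)
      have "H (merge (int p - 1) s) = P / N + (s + 1 - P) / N / N\<^sup>2"
        unfolding m using b N_gt(4) H_mid(3)[of "P - 1 + (s + 1 - P) / N"] by simp
      moreover have "H (s - 2 * P) = (s + 1 - P) / N\<^sup>2"
        using 3 True by (subst H_mid(1)) (auto simp: N_def algebra_simps)
      ultimately show ?thesis unfolding g by (simp add: add_divide_distrib power2_eq_square)
    next
      case False
      then have m: "merge (int p - 1) s = s - P" by (intro merge_ge) (simp add: N_def)
      have "1 - H (s - P) = (1 - H (s - 2 * P)) / N" using H_plus[of "s - 2 * P"] False by (simp add: algebra_simps)
      then have "N * H (s - P) - P = H (s - 2 * P)" using N_gt by (simp add: N_def field_simps)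
      then show ?thesis unfolding g m using N_gt by (simp add: field_simps)
    qed
  qed
qed

section \<open>Standard intervals of the line and of the unit interval\<close>

lemma fold_N: "P + 1 = N" "1 + P = N"
  by (simp_all add: N_def)

text \<open>The last clause, where \<open>l\<close> grows with the distance from the origin, makes images of far away
unit intervals as short as needed.\<close>

lemma H_std_unit:
  assumes j: "j * (int p + 1) ^ k \<le> a" "a + 1 \<le> (j + 1) * (int p + 1) ^ k"
  shows "\<exists>b l. affine_std H a k b l \<and> k \<le> l \<and> (j < - int (p * A) \<or> j \<ge> int (p * A) \<longrightarrow> A \<le> l)"
proof -
  let ?s = "\<lambda>x. (of_int a + x) / N ^ k"
  have s: "of_int j \<le> ?s x" "?s x \<le> of_int j + 1" if "0 \<le> x" "x \<le> 1" for x
    using std_bounds(1)[OF that j(1)] std_bounds(2)[OF that j(2)] by auto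
  show ?thesis
  proof (cases "j < 0")
    case True
    define m where "m = nat (- (j div int p))"
    have jd: "j div int p < 0" using True p_pos by (simp add: pos_imp_zdiv_neg_iff)
    have jm: "int p * (j div int p) \<le> j" "j < int p * (j div int p) + int p"
      using p_pos pos_mod_bound[of "int p" j] pos_mod_sign[of "int p" j] mult_div_mod_eq[of "int p" j] by linarith+
    have m: "m \<ge> 1" "int m = - (j div int p)" using jd by (auto simp: m_def)
    have "- int p * int m \<le> j" "j + 1 \<le> int p - int p * int m" using jm m by auto
    then have "real_of_int (- int p * int m) \<le> of_int j" "real_of_int (j + 1) \<le> of_int (int p - int p * int m)"
      by (simp_all only: of_int_le_iff)
    then have b: "- P * of_nat m \<le> of_int j" "of_int j + 1 \<le> P - P * of_nat m" by simp_all
    let ?b = "(1 + int p * int m) * (int p + 1) ^ k + a"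
    have "H (?s x) = (of_int ?b + x) / N ^ (m + 1 + k)" if "0 \<le> x" "x \<le> 1" for x
    proof -
      have "H (?s x) = (1 + ?s x + P * of_nat m) / N ^ (m + 1)"
        using s[OF that] b m by (intro H_neg) linarith+
      also have "1 + ?s x + P * of_nat m = (of_int ?b + x) / N ^ k"
        using N_gt by (simp add: N_pow[symmetric] field_simps) (simp add: N_def ac_simps)
      finally show ?thesis by (simp add: power_add mult_ac)
    qed
    then have "affine_std H a k ?b (m + 1 + k)" by (simp add: affine_std_def)
    moreover have "A \<le> m + 1 + k" if "j < - int (p * A) \<or> j \<ge> int (p * A)"
    proof -
      have jA: "j < - int (p * A)" using that True by (auto dest: order_trans[OF of_nat_0_le_iff])
      then have "P * of_nat A < P * of_nat m"
      proof -
        have "real_of_int j < of_int (- int (p * A))" using jA by (simp only: of_int_less_iff)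
        then have "of_int j < - (P * of_nat A)" by simp
        then show ?thesis using b by linarith
      qed
      then have "A < m" using N_gt(5) by simp
      then show ?thesis by simp
    qed
    ultimately show ?thesis by (intro exI[of _ ?b] exI[of _ "m + 1 + k"]) auto
  next
    case False
    define m where "m = nat ((j + 1) div int p)"
    have jd: "(j + 1) div int p \<ge> 0" using False p_pos by (simp add: pos_imp_zdiv_nonneg_iff)
    have jm: "int p * ((j + 1) div int p) \<le> j + 1" "j + 1 < int p * ((j + 1) div int p) + int p"
      using p_pos pos_mod_bound[of "int p" "j + 1"] pos_mod_sign[of "int p" "j + 1"] mult_div_mod_eq[of "int p" "j + 1"] by linarith+
    have m: "int m = (j + 1) div int p" using jd by (auto simp: m_def)
    have "int p * int m \<le> j + 1" "j + 2 \<le> int p * int m + int p" using jm m by auto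
    then have "real_of_int (int p * int m) \<le> of_int (j + 1)" "real_of_int (j + 2) \<le> of_int (int p * int m + int p)"
      by (simp_all only: of_int_le_iff)
    then have b: "P * of_nat m \<le> of_int j + 1" "of_int j + 2 \<le> P * of_nat m + P" by simp_all
    let ?b = "((int p + 1) ^ (m + 1) - int p * int m - int p) * (int p + 1) ^ k + a"
    have "H (?s x) = (of_int ?b + x) / N ^ (m + 1 + k)" if x: "0 \<le> x" "x \<le> 1" for x
    proof -
      have "0 \<le> real_of_int j" using False by simp
      then have "H (?s x) = 1 - (N + P * of_nat m - ?s x - 1) / N ^ (m + 1)"
        using s[OF x] b by (intro H_pos) linarith+
      also have "\<dots> = (N ^ (m + 1) - (N + P * of_nat m - ?s x - 1)) / N ^ (m + 1)"
        using N_gt by (simp add: diff_divide_distrib)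
      also have "N ^ (m + 1) - (N + P * of_nat m - ?s x - 1) = (N ^ (m + 1) - P * of_nat m - P) + ?s x"
        by (simp add: N_def)
      also have "\<dots> = (of_int ?b + x) / N ^ k"
        using N_gt by (simp add: N_pow[symmetric] fold_N add_divide_distrib)
      finally show ?thesis by (simp add: power_add mult_ac)
    qed
    then have "affine_std H a k ?b (m + 1 + k)" by (simp add: affine_std_def)
    moreover have "A \<le> m + 1 + k" if "j < - int (p * A) \<or> j \<ge> int (p * A)"
    proof -
      have jA: "j \<ge> int (p * A)" using that False by auto
      have "P * of_nat A < P * of_nat (m + 1)"
      proof -
        have "real_of_int j \<ge> of_int (int (p * A))" using jA by (simp only: of_int_le_iff)
        then show ?thesis using b by (simp add: algebra_simps)
      qed
      then have "A < m + 1" using N_gt(5) by (simp only: mult_less_cancel_left_pos of_nat_less_iff)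
      then show ?thesis by simp
    qed
    ultimately show ?thesis by (intro exI[of _ ?b] exI[of _ "m + 1 + k"]) auto
  qed
qed

lemma inverse_le_divide_iff: "A > 0 \<Longrightarrow> B > 0 \<Longrightarrow> 1 / A \<le> c / (A * B) \<longleftrightarrow> B \<le> (c::real)"
  by (simp add: field_simps)

text \<open>A standard interval that contains neither \<open>0\<close> nor \<open>1\<close> lies in a single tree off one of the spines, since standard
intervals are nested or have disjoint interiors.\<close>

lemma std_H:
  assumes b: "0 < b" "b + 1 < (int p + 1) ^ l"
  shows "\<exists>a k. affine_std H a k b l"
proof -
  have Nl: "N ^ l > 0" using N_gt by simp
  have pl: "l \<noteq> 0" using b by (cases "l = 0") auto
  show ?thesis
  proof (cases "of_int b / N ^ l < 1 / N")
    case True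
    have y: "0 < of_int b / N ^ l" using b Nl by simp
    obtain m where m: "1 / N ^ (m + 1) \<le> of_int b / N ^ l" "m = 0 \<or> of_int b / N ^ l < 1 / N ^ m" using power_block[OF y] .
    have m1: "m \<ge> 1" using m(1) True by (cases m) auto
    have lm: "l > m"
    proof (rule ccontr)
      assume "\<not> l > m"
      then have "1 / N ^ m \<le> 1 / N ^ l" using N_gt by (intro divide_left_mono power_increasing) auto
      also have "\<dots> \<le> of_int b / N ^ l" using b Nl by (intro divide_right_mono) auto
      finally show False using m m1 by simp
    qed
    define e where "e = l - m - 1"
    have l: "l = m + 1 + e" using lm by (simp add: e_def)
    have Ne: "N ^ e > 0" "N ^ (m + 1) > 0" using N_gt by auto
    have b1: "N ^ e \<le> of_int b" using m(1) Ne inverse_le_divide_iff unfolding l power_add[of _ "m + 1"] by blast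
    have "of_int b * N ^ m < N ^ m * (N * N ^ e)" using m(2) m1 Nl N_gt unfolding l by (simp add: field_simps power_add)
    then have "of_int b < N * N ^ e" using N_gt by (simp add: mult.commute)
    then have "real_of_int b < of_int ((int p + 1) ^ (e + 1))" by (simp add: N_def)
    then have "b + 1 \<le> (int p + 1) ^ (e + 1)" by (simp only: of_int_less_iff)
    then have "real_of_int (b + 1) \<le> of_int ((int p + 1) ^ (e + 1))" by (simp only: of_int_le_iff)
    then have b2: "of_int b + 1 \<le> N * N ^ e" by (simp add: N_def)
    let ?a = "b - (1 + int p * int m) * (int p + 1) ^ e"
    have "H ((of_int ?a + x) / N ^ e) = (of_int b + x) / N ^ l" if x: "0 \<le> x" "x \<le> 1" for x
    proof -
      let ?z = "(of_int b + x) / N ^ e"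
      have s: "(of_int ?a + x) / N ^ e = ?z - 1 - P * of_nat m"
      proof -
        have eq: "of_int ?a + x = (of_int b + x) - (1 + P * of_nat m) * N ^ e" by (simp add: N_def)
        show ?thesis unfolding eq using N_gt(6) by (simp add: diff_divide_distrib)
      qed
      have z: "1 \<le> ?z" "?z \<le> N" using b1 b2 x Ne by (auto simp: field_simps)
      have "H (?z - 1 - P * of_nat m) = (1 + (?z - 1 - P * of_nat m) + P * of_nat m) / N ^ (m + 1)"
        using z m1 by (intro H_neg) (auto simp: N_def)
      then show ?thesis unfolding s l power_add using N_gt by (simp add: mult_ac)
    qed
    then show ?thesis unfolding affine_std_def by (intro exI[of _ ?a] exI[of _ e]) simp
  next
    case False
    define c where "c = (int p + 1) ^ l - b - 1"
    have c: "c > 0" using b by (simp add: c_def)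
    have bc: "real_of_int b = N ^ l - of_int c - 1" by (simp add: c_def N_def)
    have y: "0 < of_int c / N ^ l" using c Nl by simp
    obtain m where m: "1 / N ^ (m + 1) \<le> of_int c / N ^ l" "m = 0 \<or> of_int c / N ^ l < 1 / N ^ m" using power_block[OF y] .
    have lm: "l > m"
    proof (rule ccontr)
      assume n: "\<not> l > m"
      then have "1 / N ^ m \<le> 1 / N ^ l" using N_gt by (intro divide_left_mono power_increasing) auto
      also have "\<dots> \<le> of_int c / N ^ l" using c Nl by (intro divide_right_mono) auto
      finally show False using m pl n by (cases "m = 0") auto
    qed
    define e where "e = l - m - 1"
    have l: "l = m + 1 + e" using lm by (simp add: e_def)
    have Ne: "N ^ e > 0" "N ^ (m + 1) > 0" using N_gt by auto
    have b1: "N ^ e \<le> of_int c" using m(1) Ne inverse_le_divide_iff unfolding l power_add[of _ "m + 1"] by blast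
    have b2: "of_int c + 1 \<le> N * N ^ e"
    proof (cases "m = 0")
      case True
      then show ?thesis using bc b(1) l by simp
    next
      case False
      then have "of_int c * N ^ m < N ^ m * (N * N ^ e)" using m(2) Nl N_gt unfolding l by (simp add: field_simps power_add)
      then have "of_int c < N * N ^ e" using N_gt by (simp add: mult.commute)
      then have "real_of_int c < of_int ((int p + 1) ^ (e + 1))" by (simp add: N_def)
      then have "c + 1 \<le> (int p + 1) ^ (e + 1)" by (simp only: of_int_less_iff)
      then have "real_of_int (c + 1) \<le> of_int ((int p + 1) ^ (e + 1))" by (simp only: of_int_le_iff)
      then show ?thesis by (simp add: N_def)
    qed
    let ?a = "(int p + int p * int m) * (int p + 1) ^ e - c - 1"
    have "H ((of_int ?a + x) / N ^ e) = (of_int b + x) / N ^ l" if x: "0 \<le> x" "x \<le> 1" for x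
    proof -
      let ?z = "(of_int c + 1 - x) / N ^ e"
      have s: "(of_int ?a + x) / N ^ e = P + P * of_nat m - ?z"
      proof -
        have eq: "of_int ?a + x = (P + P * of_nat m) * N ^ e - (of_int c + 1 - x)" by (simp add: N_def)
        show ?thesis unfolding eq using N_gt(6) by (simp add: diff_divide_distrib)
      qed
      have z: "1 \<le> ?z" "?z \<le> N" using b1 b2 x Ne by (auto simp: field_simps)
      have s0: "P + P * of_nat m - ?z \<ge> 0"
      proof (cases "m = 0")
        case True
        have "1 / N * N ^ l \<le> of_int b" using False Nl by (simp add: field_simps)
        then have "N ^ e \<le> of_int b" using True l N_gt by simp
        then have "of_int c + 1 - x \<le> P * N ^ e" using bc True l x by (simp add: N_def algebra_simps)
        then have "?z \<le> P" using Ne by (simp add: field_simps)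
        then show ?thesis using True by simp
      next
        case False
        then have "P * 1 \<le> P * of_nat m" using N_gt(5) by (intro mult_left_mono) auto
        then show ?thesis using z N_gt(4) N_def by linarith
      qed
      have "H (P + P * of_nat m - ?z) = 1 - (N + P * of_nat m - (P + P * of_nat m - ?z) - 1) / N ^ (m + 1)"
        using z s0 by (intro H_pos) (auto simp: N_def)
      also have "\<dots> = 1 - ?z / N ^ (m + 1)" by (simp add: N_def)
      also have "\<dots> = (of_int b + x) / N ^ l" unfolding bc l power_add using N_gt
        by (simp add: diff_divide_distrib add_divide_distrib mult_ac)
      finally show ?thesis unfolding s .
    qed
    then show ?thesis unfolding affine_std_def by (intro exI[of _ ?a] exI[of _ e]) simp
  qed
qed

lemma H_minus_power: "s \<le> 0 \<Longrightarrow> H (s - P * of_nat m) = H s / N ^ m"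
proof (induction m arbitrary: s)
  case (Suc m)
  have "H (s - P * of_nat (Suc m)) = H ((s - P) - P * of_nat m)" by (simp add: algebra_simps)
  also have "\<dots> = H (s - P) / N ^ m" using Suc N_gt(5) by simp
  finally show ?case using H_minus[OF Suc.prems] by simp
qed simp

lemma H_plus_power: "s \<ge> 0 \<Longrightarrow> 1 - H (s + P * of_nat m) = (1 - H s) / N ^ m"
proof (induction m arbitrary: s)
  case (Suc m)
  have "1 - H (s + P * of_nat (Suc m)) = 1 - H ((s + P) + P * of_nat m)" by (simp add: algebra_simps)
  also have "\<dots> = (1 - H (s + P)) / N ^ m" using Suc N_gt(5) by simp
  finally show ?case using H_plus[OF Suc.prems] by simp
qed simp

text \<open>Scaling by powers of \<open>N\<close> at the end points of the unit interval corresponds to translation by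
multiples of \<open>p\<close>. This is how elements of the group act near the end points.\<close>

lemma H_near_0: "\<exists>A. \<forall>s\<le>A. H s * N ^ k = N ^ l * H (s + P * (real k - real l))"
proof -
  have *: "H s * N ^ k = N ^ l * H (s + P * (real k - real l))" if s: "s \<le> - P * real k" for s
  proof (cases "l \<le> k")
    case True
    then obtain m where m: "k = l + m" by (metis le_Suc_ex)
    have "0 \<le> P * real l" "s \<le> - (P * real l) - P * real m" using s m by (simp_all add: algebra_simps)
    then have "s + P * real m \<le> 0" by linarith
    from H_minus_power[OF this, of m] have "H s * N ^ m = H (s + P * real m)" using N_gt by (simp add: field_simps)
    then show ?thesis unfolding m by (simp add: power_add mult_ac)
  next
    case False
    then obtain m where m: "l = k + m" by (metis le_Suc_ex nat_le_linear)
    have "P * real k \<ge> 0" by simp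
    then have "s \<le> 0" using s by linarith
    from H_minus_power[OF this, of m] have "H (s - P * real m) * N ^ m = H s" using N_gt by (simp add: field_simps)
    then show ?thesis unfolding m by (simp add: power_add mult_ac)
  qed
  then show ?thesis by blast
qed

lemma H_near_1: "\<exists>A. \<forall>s\<ge>A. (1 - H s) * N ^ k = N ^ l * (1 - H (s + P * (real l - real k)))"
proof -
  have *: "(1 - H s) * N ^ k = N ^ l * (1 - H (s + P * (real l - real k)))" if s: "s \<ge> P * real k" for s
  proof (cases "l \<le> k")
    case True
    then obtain m where m: "k = l + m" by (metis le_Suc_ex)
    have "0 \<le> P * real l" "s \<ge> P * real l + P * real m" using s m by (simp_all add: algebra_simps)
    then have "s - P * real m \<ge> 0" by linarith
    from H_plus_power[OF this, of m] have "(1 - H s) * N ^ m = 1 - H (s - P * real m)" using N_gt by (simp add: field_simps)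
    then show ?thesis unfolding m by (simp add: power_add mult_ac)
  next
    case False
    then obtain m where m: "l = k + m" by (metis le_Suc_ex nat_le_linear)
    have "P * real k \<ge> 0" by simp
    then have "s \<ge> 0" using s by linarith
    from H_plus_power[OF this, of m] have "(1 - H (s + P * real m)) * N ^ m = 1 - H s" using N_gt by (simp add: field_simps)
    then show ?thesis unfolding m by (simp add: power_add mult_ac)
  qed
  then show ?thesis by blast
qed

section \<open>The generators generate\<close>

lemma N_real: "real (p + 1) = N" by (simp add: N_def)

lemma common_level:
  assumes "finite B" "B \<subseteq> N_adic (p + 1)"
  shows "\<exists>K. \<forall>k\<ge>K. \<forall>b\<in>B. \<exists>a::int. b = of_int a / N ^ k"
  using assms
proof (induction B rule: finite_induct)
  case (insert x B)
  then obtain K where K: "\<And>k b. k \<ge> K \<Longrightarrow> b \<in> B \<Longrightarrow> \<exists>a::int. b = of_int a / N ^ k" by auto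
  obtain a l where a: "x = of_int a / N ^ l" using insert.prems by (auto simp: N_adic_def N_def add.commute)
  have "\<exists>c::int. x = of_int c / N ^ k" if "k \<ge> l" for k
  proof -
    obtain m where m: "k = l + m" using \<open>k \<ge> l\<close> le_Suc_ex by blast
    have "x = of_int (a * (int p + 1) ^ m) / N ^ k"
      unfolding a m power_add using N_gt by (simp add: fold_N)
    then show ?thesis by blast
  qed
  then show ?case using K by (intro exI[of _ "max K l"]) auto
qed auto

text \<open>On a uniform subdivision that contains all breakpoints, the map is affine with slopes powers of \<open>N\<close>, so its values at the division
points are fractions with denominator a power of \<open>N\<close>. Once the intervals are short compared with these denominators, their images are standard.\<close>

lemma carrier_affine_std:
  assumes w: "w \<in> thompson_carrier (p + 1)"
  shows "\<exists>K. \<forall>k\<ge>K. \<forall>a. 0 \<le> a \<and> a < (int p + 1) ^ k \<longrightarrow> (\<exists>b l. affine_std w a k b l)"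
proof -
  note wd = thompson_carrierD[OF w]
  have bp: "finite (breakpoints w)" "breakpoints w \<subseteq> N_adic (p + 1)"
    and slope: "\<And>x m. x \<in> {0<..<1} \<Longrightarrow> has_local_slope w x m \<Longrightarrow> \<exists>e::int. m = N powi e"
    using w by (auto simp: thompson_carrier_def N_def add.commute)
  obtain K where K: "\<And>b. b \<in> breakpoints w \<Longrightarrow> \<exists>a::int. b = of_int a / N ^ K"
    using common_level[OF bp] by blast
  have NK: "N ^ K > 0" using N_gt by simp
  define M where "M = (int p + 1) ^ K"
  have M: "M > 0" "real_of_int M = N ^ K" by (simp_all add: M_def N_def)
  have piece: "\<exists>m c e. (\<forall>x. 0 \<le> x \<and> x \<le> 1 \<longrightarrow> w ((of_int a + x) / N ^ K) = w (of_int a / N ^ K) + m * x / N ^ K) \<and> m = N powi e"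
    if a: "0 \<le> a" "a < M" for a
  proof -
    let ?u = "of_int a / N ^ K" and ?v = "(of_int a + 1) / N ^ K"
    have "real_of_int (a + 1) \<le> of_int M" using a by (simp only: of_int_le_iff)
    then have aM: "of_int a + 1 \<le> N ^ K" using M by simp
    have uv: "?u < ?v" "0 \<le> ?u" "?v \<le> 1" using aM a NK by (auto simp: divide_strict_right_mono)
    have nb: "breakpoints w \<inter> {?u<..<?v} = {}"
    proof (rule ccontr)
      assume "breakpoints w \<inter> {?u<..<?v} \<noteq> {}"
      then obtain b where b: "b \<in> breakpoints w" "?u < b" "b < ?v" by auto
      obtain c :: int where "b = of_int c / N ^ K" using K[OF b(1)] by blast
      then have "real_of_int a < of_int c" "real_of_int c < of_int (a + 1)" using b NK by (simp_all add: divide_less_cancel)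
      then have "a < c" "c < a + 1" by (simp_all only: of_int_less_iff)
      then show False by linarith
    qed
    have "continuous_on {?u..?v} w" using wd(1) uv by (rule_tac continuous_on_subset) auto
    from affine_between_breakpoints[OF this uv nb] obtain m c where mc:
      "\<And>x. ?u \<le> x \<Longrightarrow> x \<le> ?v \<Longrightarrow> w x = m * x + c" "\<exists>x\<in>{0<..<1}. has_local_slope w x m" by blast
    have "w ((of_int a + x) / N ^ K) = w (of_int a / N ^ K) + m * x / N ^ K" if x: "0 \<le> x" "x \<le> 1" for x
    proof -
      have "?u \<le> (of_int a + x) / N ^ K" "(of_int a + x) / N ^ K \<le> ?v" "?u \<le> ?v"
        using x NK by (auto intro!: divide_right_mono)
      then have "w ((of_int a + x) / N ^ K) = m * ((of_int a + x) / N ^ K) + c" "w ?u = m * ?u + c"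
        using mc(1) by auto
      then show ?thesis by (simp add: add_divide_distrib distrib_left)
    qed
    moreover obtain e where "m = N powi e" using mc(2) slope by blast
    ultimately show ?thesis by blast
  qed
  have "\<exists>sl. \<forall>a. 0 \<le> a \<and> a < M \<longrightarrow> (\<forall>x. 0 \<le> x \<and> x \<le> 1 \<longrightarrow>
      w ((of_int a + x) / N ^ K) = w (of_int a / N ^ K) + N powi (sl a) * x / N ^ K)"
  proof (rule choice, rule allI)
    fix a
    show "\<exists>e. 0 \<le> a \<and> a < M \<longrightarrow> (\<forall>x. 0 \<le> x \<and> x \<le> 1 \<longrightarrow>
      w ((of_int a + x) / N ^ K) = w (of_int a / N ^ K) + N powi e * x / N ^ K)"
      using piece[of a] by (cases "0 \<le> a \<and> a < M") auto
  qed
  then obtain sl where sl: "\<And>a x. 0 \<le> a \<Longrightarrow> a < M \<Longrightarrow> 0 \<le> x \<Longrightarrow> x \<le> 1 \<Longrightarrow>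
      w ((of_int a + x) / N ^ K) = w (of_int a / N ^ K) + N powi (sl a) * x / N ^ K"
    by blast
  have val: "\<exists>b l. w (of_int a / N ^ K) = of_int b / N ^ l" if "0 \<le> a" "a \<le> M" for a
    using that
  proof (induction a rule: int_ge_induct)
    case base
    have "w (of_int 0 / N ^ K) = of_int 0 / N ^ 0" using wd by simp
    then show ?case by blast
  next
    case (step a)
    then obtain b l where b: "w (of_int a / N ^ K) = of_int b / N ^ l" by auto
    have "w (of_int (a + 1) / N ^ K) = of_int b / N ^ l + N powi (sl a) / N ^ K"
      using sl[of a 1] step b by simp
    also have "N powi (sl a) / N ^ K = N powi (sl a - int K)" using N_gt by (simp add: power_int_diff)
    also have "\<exists>c m. of_int b / N ^ l + N powi (sl a - int K) = of_int c / N ^ m"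
    proof (cases "sl a - int K \<ge> 0")
      case True
      then obtain n where n: "sl a - int K = int n" using nonneg_int_cases by blast
      have "of_int b / N ^ l + N powi (sl a - int K) = of_int (b + (int p + 1) ^ n * (int p + 1) ^ l) / N ^ l"
        unfolding n using N_gt by (simp add: fold_N add_divide_distrib)
      then show ?thesis by blast
    next
      case False
      define n where "n = nat (- (sl a - int K))"
      have n: "sl a - int K = - int n" using False by (simp add: n_def)
      have "of_int b / N ^ l + N powi (sl a - int K) = of_int (b * (int p + 1) ^ n + (int p + 1) ^ l) / N ^ (l + n)"
        unfolding n using N_gt by (simp add: fold_N power_int_minus add_divide_distrib power_add inverse_eq_divide)
      then show ?thesis by blast
    qed
    finally show ?case .
  qed
  have each: "\<exists>T. \<forall>k\<ge>T. \<forall>c. 0 \<le> c \<and> c < (int p + 1) ^ k \<and> k \<ge> K \<and> c div (int p + 1) ^ (k - K) = a \<longrightarrow> (\<exists>b l. affine_std w c k b l)"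
    if a: "0 \<le> a" "a < M" for a
  proof -
    obtain b l where b: "w (of_int a / N ^ K) = of_int b / N ^ l" using val[of a] a by auto
    define T where "T = nat (sl a) + l"
    have "\<exists>b l. affine_std w c k b l"
      if k: "k \<ge> T" "k \<ge> K" and c: "c div (int p + 1) ^ (k - K) = a" for k c
    proof -
      obtain d where d: "k = K + d" using k le_Suc_ex by blast
      let ?r = "c mod (int p + 1) ^ d"
      have cr: "c = a * (int p + 1) ^ d + ?r" using c d by (metis add_diff_cancel_left' div_mult_mod_eq)
      have r: "0 \<le> ?r" "?r + 1 \<le> (int p + 1) ^ d" by (simp_all add: add1_zle_eq)
      then have "real_of_int (?r + 1) \<le> of_int ((int p + 1) ^ d)" by (simp only: of_int_le_iff)
      then have r': "of_int ?r + 1 \<le> N ^ d" "0 \<le> real_of_int ?r" using r by (simp_all add: N_def)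
      have Nd: "N ^ d > 0" using N_gt by simp
      define m where "m = nat (int k - sl a)"
      have "sl a \<le> int k" using k(1) by (simp add: T_def)
      then have m: "int m = int k - sl a" by (simp add: m_def)
      have ml: "l \<le> m" using k(1) m by (simp add: T_def)
      then obtain h where h: "m = l + h" using le_Suc_ex by blast
      have pw: "N powi (sl a) / N ^ k = 1 / N ^ m"
      proof -
        have "N powi (sl a) / N ^ k = N powi (sl a - int k)" using N_gt by (simp add: power_int_diff)
        also have "sl a - int k = - int m" using m by simp
        finally show ?thesis by (simp add: power_int_minus inverse_eq_divide)
      qed
      have "w ((of_int c + x) / N ^ k) = (of_int (b * (int p + 1) ^ h + ?r) + x) / N ^ m" if x: "0 \<le> x" "x \<le> 1" for x
      proof -
        let ?y = "(of_int ?r + x) / N ^ d"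
        have y: "0 \<le> ?y" "?y \<le> 1" using r' x Nd by auto
        have "of_int c = of_int a * N ^ d + of_int ?r"
          using arg_cong[OF cr, of real_of_int] by (simp add: fold_N)
        then have "of_int a + ?y = (of_int c + x) / N ^ d" using Nd by (simp add: add_divide_distrib)
        then have "(of_int c + x) / N ^ k = (of_int a + ?y) / N ^ K"
          unfolding d power_add by (simp add: mult.commute)
        then have "w ((of_int c + x) / N ^ k) = of_int b / N ^ l + N powi (sl a) * ?y / N ^ K"
          using sl[OF a y] b by simp
        also have "N powi (sl a) * ?y / N ^ K = (N powi (sl a) / N ^ k) * (of_int ?r + x)"
          unfolding d power_add using Nd NK by (simp add: mult_ac)
        also have "\<dots> = (of_int ?r + x) / N ^ m" unfolding pw by simp
        also have "of_int b / N ^ l = of_int (b * (int p + 1) ^ h) / N ^ m"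
          unfolding h power_add using N_gt by (simp add: fold_N)
        finally show ?thesis by (simp add: add_divide_distrib)
      qed
      then have "affine_std w c k (b * (int p + 1) ^ h + ?r) m" by (simp add: affine_std_def)
      then show ?thesis by blast
    qed
    then show ?thesis by blast
  qed
  have "\<exists>T. \<forall>a. 0 \<le> a \<and> a < M \<longrightarrow> (\<forall>k\<ge>T a. \<forall>c. 0 \<le> c \<and> c < (int p + 1) ^ k \<and> k \<ge> K \<and> c div (int p + 1) ^ (k - K) = a \<longrightarrow> (\<exists>b l. affine_std w c k b l))"
    using each by (intro choice) blast
  then obtain T where T: "\<And>a k c. 0 \<le> a \<Longrightarrow> a < M \<Longrightarrow> T a \<le> k \<Longrightarrow> 0 \<le> c \<Longrightarrow> c < (int p + 1) ^ k \<Longrightarrow> k \<ge> K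
      \<Longrightarrow> c div (int p + 1) ^ (k - K) = a \<Longrightarrow> \<exists>b l. affine_std w c k b l" by blast
  define L where "L = max K (Max (T ` {0..<M}))"
  have "\<exists>b l. affine_std w c k b l" if k: "k \<ge> L" and c: "0 \<le> c" "c < (int p + 1) ^ k" for k c
  proof -
    let ?a = "c div (int p + 1) ^ (k - K)"
    have kK: "K \<le> k" using k by (simp add: L_def)
    have "0 \<le> ?a" using c by (simp add: pos_imp_zdiv_nonneg_iff)
    moreover have "?a < M"
    proof -
      have "(int p + 1) ^ k = M * (int p + 1) ^ (k - K)" using kK by (simp add: M_def power_add[symmetric])
      moreover have "0 \<le> c mod (int p + 1) ^ (k - K)" by (rule pos_mod_sign) simp
      then have "?a * (int p + 1) ^ (k - K) \<le> c"
        using div_mult_mod_eq[of c "(int p + 1) ^ (k - K)"] by linarith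
      ultimately have "?a * (int p + 1) ^ (k - K) < M * (int p + 1) ^ (k - K)" using c(2) by linarith
      then show ?thesis by (simp add: mult_less_cancel_right)
    qed
    ultimately have a: "?a \<in> {0..<M}" by simp
    then have "T ?a \<le> Max (T ` {0..<M})" by (intro Max_ge) auto
    then show ?thesis using T[of ?a k c] a c k kK by (simp add: L_def)
  qed
  then show ?thesis by blast
qed

lemma affine_std_unit_translation:
  assumes "affine_std f j 0 a k" "f (of_int j) = of_int j + e" "f (of_int j + 1) = of_int j + 1 + e"
  shows "k = 0"
proof (rule ccontr)
  assume k: "k \<noteq> 0"
  have "f (of_int j) = of_int a / N ^ k" "f (of_int j + 1) = (of_int a + 1) / N ^ k"
    using affine_stdD[OF assms(1), of 0] affine_stdD[OF assms(1), of 1] by simp_all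
  then have "(of_int a + 1) / N ^ k - of_int a / N ^ k = 1" using assms(2,3) by linarith
  then have "1 / N ^ k = 1" by (simp add: add_divide_distrib)
  moreover have "1 < N ^ k" using N_gt k by (simp add: one_less_power)
  ultimately show False by simp
qed

lemma partition_word':
  assumes std: "\<And>j. \<exists>a k. affine_std f j 0 a k"
    and left: "\<And>s. s \<le> B \<Longrightarrow> f s = s + e"
    and right: "\<And>s. s \<ge> A \<Longrightarrow> f s = s + P * of_int c"
  shows "\<exists>ws\<in>words. \<forall>t. wact ws t = f t"
proof -
  have "\<exists>g. \<forall>j. affine_std f j 0 (fst (g j)) (snd (g j))"
  proof (rule choice, rule allI)
    fix j
    obtain a k where "affine_std f j 0 a k" using std by blast
    then show "\<exists>y. affine_std f j 0 (fst y) (snd y)" by (intro exI[of _ "(a, k)"]) simp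
  qed
  then obtain g where g: "\<And>j. affine_std f j 0 (fst (g j)) (snd (g j))" by blast
  let ?a = "\<lambda>j. fst (g j)" and ?k = "\<lambda>j. snd (g j)"
  have "f (of_int j + x) = (of_int (?a j) + x) / N ^ ?k j" if "0 \<le> x" "x \<le> 1" for j x
    using affine_stdD[OF g that, of j] by simp
  moreover have "finite {j. ?k j \<noteq> 0}"
  proof (rule finite_subset)
    show "{j. ?k j \<noteq> 0} \<subseteq> {\<lfloor>B\<rfloor> - 1..\<lceil>A\<rceil>}"
    proof
      fix j assume "j \<in> {j. ?k j \<noteq> 0}"
      then have k: "?k j \<noteq> 0" by simp
      have "\<not> of_int j + 1 \<le> B"
        using affine_std_unit_translation[OF g, of j e] left[of "of_int j"] left[of "of_int j + 1"] k by auto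
      moreover have "\<not> of_int j \<ge> A"
        using affine_std_unit_translation[OF g, of j "P * of_int c"] right[of "of_int j"] right[of "of_int j + 1"] k by auto
      ultimately show "j \<in> {\<lfloor>B\<rfloor> - 1..\<lceil>A\<rceil>}" by (simp; linarith)
    qed
  qed simp
  ultimately show ?thesis using right by (intro partition_word[of f ?a ?k A c])
qed

text \<open>The images of the unit intervals are the intervals of level \<open>K\<close> between \<open>- P K\<close> and \<open>P K\<close>, and unit intervals outside. Further out, the images of unit
intervals under \<open>H\<close> have level at least \<open>K\<close> already.\<close>

definition subdivide :: "nat \<Rightarrow> real \<Rightarrow> real" where
  "subdivide K s = (if s \<le> 0 then s - P * K else if s \<le> 2 * P * K * N ^ K then s / N ^ K - P * K
     else s - 2 * P * K * N ^ K + P * K)"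

lemma subdivide_std:
  "\<exists>a k j. affine_std (subdivide K) i 0 a k \<and> (j * (int p + 1) ^ k \<le> a \<and> a + 1 \<le> (j + 1) * (int p + 1) ^ k) \<and>
     (k = K \<or> j < - int (p * K) \<or> j \<ge> int (p * K))"
proof -
  let ?n = "(int p + 1) ^ K" and ?M = "2 * int p * int K"
  have M: "2 * P * K * N ^ K = of_int (?M * ?n)" by (simp add: fold_N)
  have NK: "N ^ K > 0" using N_gt by simp
  consider "i < 0" | "0 \<le> i" "i < ?M * ?n" | "i \<ge> ?M * ?n" by linarith
  then show ?thesis
  proof cases
    case 1
    then have "real_of_int (i + 1) \<le> of_int 0" by (simp only: of_int_le_iff)
    then have "affine_std (subdivide K) i 0 (i - int (p * K)) 0"
      by (simp add: affine_std_def subdivide_def algebra_simps)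
    then show ?thesis using 1 by (intro exI[of _ "i - int (p * K)"] exI[of _ 0]) auto
  next
    case 2
    then have b: "0 \<le> real_of_int i" "real_of_int (i + 1) \<le> of_int (?M * ?n)" by (simp, simp only: of_int_le_iff)
    have "affine_std (subdivide K) i 0 (i - int p * int K * ?n) K"
      unfolding affine_std_def
    proof
      fix x :: real assume x: "x \<in> {0..1}"
      have "subdivide K (of_int i + x) = (of_int i + x) / N ^ K - P * K"
      proof (cases "of_int i + x \<le> 0")
        case True
        then have "of_int i + x = 0" using x b by auto
        then show ?thesis by (simp add: subdivide_def)
      next
        case False
        have "of_int i + x \<le> of_int (?M * ?n)" using b x by auto
        then show ?thesis using False unfolding subdivide_def M by simp
      qed
      also have "\<dots> = (of_int (i - int p * int K * ?n) + x) / N ^ K"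
        using NK by (simp add: fold_N diff_divide_distrib add_divide_distrib)
      finally show "subdivide K ((of_int i + x) / N ^ 0) = (of_int (i - int p * int K * ?n) + x) / N ^ K" by simp
    qed
    moreover obtain j where "j * ?n \<le> i - int p * int K * ?n" "i - int p * int K * ?n + 1 \<le> (j + 1) * ?n"
    proof
      let ?c = "i - int p * int K * ?n"
      have "0 \<le> ?c mod ?n" by (rule pos_mod_sign) simp
      then show "(?c div ?n) * ?n \<le> ?c" using div_mult_mod_eq[of ?c ?n] by linarith
      show "?c + 1 \<le> (?c div ?n + 1) * ?n" 
      proof -
        have "?c mod ?n < ?n" by (rule pos_mod_bound) simp
        then show ?thesis unfolding distrib_right using div_mult_mod_eq[of ?c ?n] by linarith
      qed
    qed
    ultimately show ?thesis by blast
  next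
    case 3
    then have b: "real_of_int i \<ge> of_int (?M * ?n)" by (simp only: of_int_le_iff)
    have M0: "real_of_int (?M * ?n) \<ge> 0" by simp
    have "affine_std (subdivide K) i 0 (i - ?M * ?n + int p * int K) 0"
      unfolding affine_std_def
    proof
      fix x :: real assume x: "x \<in> {0..1}"
      show "subdivide K ((of_int i + x) / N ^ 0) = (of_int (i - ?M * ?n + int p * int K) + x) / N ^ 0"
      proof (cases "of_int i + x = of_int (?M * ?n)")
        case True
        have "subdivide K (of_int i + x) = P * K"
        proof (cases "K = 0")
          case False
          then have "2 * P * K * N ^ K > 0" using NK N_gt(5) by simp
          then show ?thesis unfolding True M[symmetric] subdivide_def by simp
        qed (use True in \<open>simp add: subdivide_def\<close>)
        moreover have "of_int (i - ?M * ?n) + x = 0" using True by simp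
        ultimately show ?thesis by simp
      next
        case False
        then have "of_int i + x > of_int (?M * ?n)" using b x by auto
        then have "subdivide K (of_int i + x) = of_int i + x - of_int (?M * ?n) + P * K"
        proof -
          assume g: "of_int i + x > of_int (?M * ?n)"
          then have "\<not> of_int i + x \<le> 0" "\<not> of_int i + x \<le> of_int (?M * ?n)" using M0 by linarith+
          then show ?thesis unfolding subdivide_def M by (simp only: if_False)
        qed
        then show ?thesis by simp
      qed
    qed
    then show ?thesis using 3 by (intro exI[of _ "i - ?M * ?n + int p * int K"] exI[of _ 0]) auto
  qed
qed

lemma subdivide_word: "\<exists>vs\<in>words. \<forall>t. wact vs t = subdivide K t"
proof (rule partition_word')
  show "\<exists>a k. affine_std (subdivide K) j 0 a k" for j using subdivide_std[of K j] by blast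
  show "subdivide K s = s + - (P * K)" if "s \<le> 0" for s using that by (simp add: subdivide_def)
  have M: "0 \<le> 2 * P * K * N ^ K" using N_gt by simp
  show "subdivide K s = s + P * of_int (int K - 2 * int K * (int p + 1) ^ K)" if "s \<ge> 2 * P * K * N ^ K + 1" for s
  proof -
    have "\<not> s \<le> 0" "\<not> s \<le> 2 * P * K * N ^ K" using that M by linarith+
    then show ?thesis by (simp add: subdivide_def fold_N algebra_simps)
  qed
qed

text \<open>After subdividing finely, \<open>w\<close> maps each piece to a standard interval. So \<open>H\<close> conjugates \<open>w\<close> to
a quotient of two maps to which \<open>partition_word\<close> applies.\<close>

lemma carrier_word:
  assumes w: "w \<in> thompson_carrier (p + 1)"
  shows "\<exists>ws\<in>words. \<forall>s. w (H (wact ws s)) = H s"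
proof -
  note wd = thompson_carrierD[OF w]
  obtain K where K: "\<And>k a. k \<ge> K \<Longrightarrow> 0 \<le> a \<Longrightarrow> a < (int p + 1) ^ k \<Longrightarrow> \<exists>b l. affine_std w a k b l"
    using carrier_affine_std[OF w] by blast
  obtain vs where vs: "vs \<in> words" "\<And>t. wact vs t = subdivide K t" using subdivide_word by blast
  have wH: "0 < w (H s)" "w (H s) < 1" for s
    using strict_mono_onD[OF wd(2), of 0 "H s"] strict_mono_onD[OF wd(2), of "H s" 1] wd(5,6) H_range[of s] by auto
  define f where "f s = (SOME t. H t = w (H (subdivide K s)))" for s
  have f: "H (f s) = w (H (subdivide K s))" for s
    unfolding f_def by (rule someI_ex) (rule H_surj[OF wH])
  have fI: "f s = t" if "H t = w (H (subdivide K s))" for s t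
    using f[of s] that H_inj by simp
  have bounds: "0 < a \<and> a + 1 < (int p + 1) ^ k"
    if "0 < of_int a / N ^ k" "(of_int a + 1) / N ^ k < 1" for a k
  proof -
    have "N ^ k > 0" using N_gt by simp
    then have "0 < real_of_int a" "of_int a + 1 < N ^ k" using that by (auto simp: field_simps)
    then have "0 < real_of_int a" "real_of_int (a + 1) < of_int ((int p + 1) ^ k)" by (simp_all add: N_def)
    then show ?thesis by (simp only: of_int_less_iff of_int_0_less_iff)
  qed
  have std: "\<exists>a k. affine_std f i 0 a k" for i
  proof -
    obtain a k j where a: "affine_std (subdivide K) i 0 a k"
      "j * (int p + 1) ^ k \<le> a" "a + 1 \<le> (j + 1) * (int p + 1) ^ k"
      "k = K \<or> j < - int (p * K) \<or> j \<ge> int (p * K)" using subdivide_std by metis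
    obtain b l where b: "affine_std H a k b l" "k \<le> l" "j < - int (p * K) \<or> j \<ge> int (p * K) \<longrightarrow> K \<le> l"
      using H_std_unit[OF a(2,3), of K] by blast
    have lK: "l \<ge> K" using a(4) b(2,3) by auto
    have h: "(of_int b + x) / N ^ l = H ((of_int a + x) / N ^ k)" if "0 \<le> x" "x \<le> 1" for x
      using affine_stdD[OF b(1) that] by simp
    have "0 < b \<and> b + 1 < (int p + 1) ^ l"
      using h[of 0] h[of 1] H_range by (intro bounds) auto
    then obtain c m where c: "affine_std w b l c m" using K[OF lK, of b] by auto
    have h': "(of_int c + x) / N ^ m = w (H ((of_int a + x) / N ^ k))" if "0 \<le> x" "x \<le> 1" for x
      using affine_stdD[OF c that] h[OF that] by simp
    have "0 < c \<and> c + 1 < (int p + 1) ^ m"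
      using h'[of 0] h'[of 1] wH by (intro bounds) auto
    then obtain d n where d: "affine_std H d n c m" using std_H by blast
    have "f ((of_int i + x) / N ^ 0) = (of_int d + x) / N ^ n" if "x \<in> {0..1}" for x
      using affine_stdD[OF a(1), of x] affine_stdD[OF b(1), of x] affine_stdD[OF c, of x] affine_stdD[OF d, of x] that
      by (intro fI) simp
    then have "affine_std f i 0 d n" by (simp add: affine_std_def)
    then show ?thesis by blast
  qed
  have n0: "0 < (int p + 1) ^ K" by simp
  obtain b0 l0 where w0: "affine_std w 0 K b0 l0" using K[of K 0] n0 by auto
  have b0: "b0 = 0" using affine_stdD[OF w0, of 0] wd(5) N_gt by simp
  obtain b1 l1 where w1: "affine_std w ((int p + 1) ^ K - 1) K b1 l1" using K[of K "(int p + 1) ^ K - 1"] n0 by auto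
  have b1: "of_int b1 + 1 = N ^ l1"
    using affine_stdD[OF w1, of 1] wd(6) N_gt by (simp add: fold_N field_simps)
  have NK: "N ^ K > 0" "N ^ l0 > 0" "N ^ l1 > 0" using N_gt by auto
  obtain A0 where A0: "\<And>s. s \<le> A0 \<Longrightarrow> H s * N ^ K = N ^ l0 * H (s + P * (real K - real l0))"
    using H_near_0[of K l0] by blast
  \<comment> \<open>Near its end points w is linear with slope a power of N, which H turns into a translation.\<close>
  define S0 where "S0 = min A0 (- P * K - 1)"
  have near0: "H u * N ^ K \<le> 1" if u: "u \<le> - P * real K" for u
  proof -
    have "u + P * K \<le> 0" using u by simp
    from H_minus_power[OF this, of K] have "H u * N ^ K = H (u + P * K)" using NK by (simp add: field_simps)
    then show ?thesis using H_range[of "u + P * K"] by simp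
  qed
  have left: "f s = s + (- P * K + P * (real K - real l0))" if s: "s \<le> min 0 (S0 + P * K)" for s
  proof (rule fI)
    let ?u = "s - P * K"
    have u: "?u \<le> A0" "?u \<le> - P * K" using s by (auto simp: S0_def)
    have su: "subdivide K s = ?u" using s by (simp add: subdivide_def)
    have x: "0 \<le> H ?u * N ^ K" "H ?u * N ^ K \<le> 1" using near0[OF u(2)] H_range[of ?u] NK by auto
    have "w (H ?u) = w ((of_int 0 + H ?u * N ^ K) / N ^ K)" using NK by simp
    also have "\<dots> = (H ?u * N ^ K) / N ^ l0" using affine_stdD[OF w0 x] b0 by simp
    also have "\<dots> = H (?u + P * (real K - real l0))" using A0[OF u(1)] NK by simp
    finally show "H (s + (- P * K + P * (real K - real l0))) = w (H (subdivide K s))"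
      unfolding su by (simp add: algebra_simps)
  qed
  obtain A1 where A1: "\<And>s. s \<ge> A1 \<Longrightarrow> (1 - H s) * N ^ K = N ^ l1 * (1 - H (s + P * (real l1 - real K)))"
    using H_near_1[of K l1] by blast
  have near1: "(1 - H u) * N ^ K \<le> 1" if u: "u \<ge> P * real K" for u
  proof -
    have "u - P * K \<ge> 0" using u by simp
    from H_plus_power[OF this, of K] have "(1 - H u) * N ^ K = 1 - H (u - P * K)" using NK by (simp add: field_simps)
    then show ?thesis using H_range[of "u - P * K"] by simp
  qed
  let ?c = "int K - 2 * int K * (int p + 1) ^ K + (int l1 - int K)"
  have M: "0 \<le> 2 * P * K * N ^ K" using N_gt by simp
  have right: "f s = s + P * of_int ?c" if s: "s \<ge> max (2 * P * K * N ^ K + 1) (A1 + 2 * P * K * N ^ K - P * K)" for s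
  proof (rule fI)
    let ?u = "s - 2 * P * K * N ^ K + P * K"
    have u: "?u \<ge> A1" "?u \<ge> P * K" using s by auto
    have "2 * P * K * N ^ K + 1 \<le> s" using s by simp
    then have "\<not> s \<le> 0" "\<not> s \<le> 2 * P * K * N ^ K" using M by linarith+
    then have su: "subdivide K s = ?u" by (simp add: subdivide_def)
    have x: "0 \<le> 1 - (1 - H ?u) * N ^ K" "1 - (1 - H ?u) * N ^ K \<le> 1" using near1[OF u(2)] H_range[of ?u] NK by auto
    have "w (H ?u) = w ((of_int ((int p + 1) ^ K - 1) + (1 - (1 - H ?u) * N ^ K)) / N ^ K)"
      using NK by (simp add: fold_N field_simps)
    also have "\<dots> = (of_int b1 + (1 - (1 - H ?u) * N ^ K)) / N ^ l1" using affine_stdD[OF w1 x] by simp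
    also have "of_int b1 + (1 - (1 - H ?u) * N ^ K) = N ^ l1 - (1 - H ?u) * N ^ K" using b1 by simp
    also have "(1 - H ?u) * N ^ K = N ^ l1 * (1 - H (?u + P * (real l1 - real K)))" by (rule A1[OF u(1)])
    also have "(N ^ l1 - N ^ l1 * (1 - H (?u + P * (real l1 - real K)))) / N ^ l1 = H (?u + P * (real l1 - real K))"
      using NK by (simp add: field_simps)
    finally show "H (s + P * of_int ?c) = w (H (subdivide K s))"
      unfolding su by (simp add: fold_N algebra_simps)
  qed
  obtain ws where ws: "ws \<in> words" "\<And>t. wact ws t = f t"
    using partition_word'[OF std left right] by blast
  have eq: "w (H (wact vs s)) = H (wact ws s)" for s using f vs ws by simp
  let ?us = "inv_word ws @ vs"
  have "w (H (wact ?us s)) = H s" for s using eq[of "wact (inv_word ws) s"] by simp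
  moreover have "?us \<in> words" using ws vs inv_word_words by simp
  ultimately show ?thesis by blast
qed

section \<open>The generators and their inverses as elements of the group\<close>

lemma subdiv_point_adic:
  assumes "i \<le> p"
  shows "\<exists>a::int. subdiv_point p i j = of_int a / N\<^sup>2"
proof -
  consider "j \<le> i" | "i < j" "j \<le> i + p + 1" | "j > i + p + 1" by linarith
  then show ?thesis
  proof cases
    case 1
    then have "subdiv_point p i j = of_int (int j * (int p + 1)) / N\<^sup>2"
      by (simp add: subdiv_point_eq fold_N power2_eq_square)
    then show ?thesis by blast
  next
    case 2
    then have "subdiv_point p i j = of_int (int i * (int p + 1) + int j - int i) / N\<^sup>2"
      by (simp add: subdiv_point_eq fold_N power2_eq_square add_divide_distrib diff_divide_distrib)
    then show ?thesis by blast
  next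
    case 3
    then have "subdiv_point p i j = of_int ((int j - int p) * (int p + 1)) / N\<^sup>2"
      by (simp add: subdiv_point_eq fold_N power2_eq_square)
    then show ?thesis by blast
  qed
qed

lemma subdiv_point_gap: "\<exists>e::nat. subdiv_point p i (Suc j) - subdiv_point p i j = 1 / N ^ e"
proof -
  consider "j < i" | "i \<le> j" "j < i + p + 1" | "j = i + p + 1" | "j > i + p + 1" by linarith
  then show ?thesis
  proof cases
    case 1
    then have "subdiv_point p i (Suc j) - subdiv_point p i j = 1 / N ^ 1"
      by (simp add: subdiv_point_eq diff_divide_distrib[symmetric])
    then show ?thesis by blast
  next
    case 2
    then have "subdiv_point p i (Suc j) - subdiv_point p i j = 1 / N ^ 2"
      by (auto simp: subdiv_point_eq diff_divide_distrib add_divide_distrib)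
    then show ?thesis by blast
  next
    case 3
    then have "subdiv_point p i (Suc j) = (real i + 2) / N" by (simp add: subdiv_point_eq)
    moreover have "subdiv_point p i j = real i / N + N / N\<^sup>2"
      using 3 by (simp add: subdiv_point_eq fold_N)
    ultimately have "subdiv_point p i (Suc j) - subdiv_point p i j = 1 / N ^ 1"
      by (simp add: power2_eq_square add_divide_distrib)
    then show ?thesis by blast
  next
    case 4
    then have "subdiv_point p i (Suc j) - subdiv_point p i j = 1 / N ^ 1"
      by (simp add: subdiv_point_eq diff_divide_distrib[symmetric])
    then show ?thesis by blast
  qed
qed

lemma gap_ratio:
  "\<exists>k::int. (subdiv_point p i (Suc j) - subdiv_point p i j) /
     (subdiv_point p i' (Suc j) - subdiv_point p i' j) = N powi k"
proof -
  obtain d e where "subdiv_point p i (Suc j) - subdiv_point p i j = 1 / N ^ d"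
    "subdiv_point p i' (Suc j) - subdiv_point p i' j = 1 / N ^ e" using subdiv_point_gap by metis
  then have "(subdiv_point p i (Suc j) - subdiv_point p i j) /
     (subdiv_point p i' (Suc j) - subdiv_point p i' j) = N powi (int e - int d)"
    by (simp add: power_int_diff)
  then show ?thesis by blast
qed

lemma N_adicI: "x = of_int a / N ^ k \<Longrightarrow> x \<in> N_adic (p + 1)"
  unfolding N_adic_def N_real by blast

lemma gen_low_piecewise:
  assumes "i < p"
  shows "piecewise_affine (2 * p + 1) (subdiv_point p p) (subdiv_point p i) (gen_low p i)"
proof
  show "subdiv_point p i 0 = 0" "subdiv_point p p 0 = 0" by (auto simp: subdiv_point_eq)
  show "gen_low p i t = subdiv_point p i j + (subdiv_point p i (Suc j) - subdiv_point p i j) /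
      (subdiv_point p p (Suc j) - subdiv_point p p j) * (t - subdiv_point p p j)"
    if "j < 2 * p + 1" "subdiv_point p p j \<le> t" "t \<le> subdiv_point p p (Suc j)" for j t
    using gen_low_affine[of j p t i] that by simp
qed (use assms dom_last ran_last in \<open>auto simp: subdiv_point_less gen_low_def\<close>)

text \<open>The subdivisions for \<open>x\<^sub>p\<close>: the interval where it is the identity is one piece, and those for \<open>x\<^sub>0\<close>
are scaled down into the rest.\<close>

definition last_points :: "nat \<Rightarrow> nat \<Rightarrow> real" where
  "last_points i j = (case j of 0 \<Rightarrow> 0 | Suc k \<Rightarrow> P / N + subdiv_point p i k / N)"

lemma last_points_simps [simp]:
  "last_points i 0 = 0" "last_points i (Suc k) = P / N + subdiv_point p i k / N"
  by (simp_all add: last_points_def)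

lemma subdiv_point_0: "subdiv_point p i 0 = 0"
  by (simp add: subdiv_point_eq)

lemma last_points_less: "i \<le> p \<Longrightarrow> last_points i j < last_points i (Suc j)"
  using subdiv_point_less[of i p] N_gt
  by (cases j) (auto simp: subdiv_point_0 divide_strict_right_mono)

lemma P_N_1: "P / N + 1 / N = 1"
  using N_gt by (simp add: add_divide_distrib[symmetric] fold_N)

lemma gen_last_piecewise:
  "piecewise_affine (2 * p + 2) (last_points p) (last_points 0) (gen_last p)"
proof
  have e: "2 * p + 2 = Suc (2 * p + 1)" by simp
  show "last_points p (2 * p + 2) = 1" "last_points 0 (2 * p + 2) = 1"
    unfolding e last_points_simps using dom_last ran_last[of 0] p_pos P_N_1 by auto
  show "gen_last p \<in> extensional {0..1}" by (simp add: gen_last_def)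
  show "last_points p j < last_points p (Suc j)" "last_points 0 j < last_points 0 (Suc j)" for j
    by (rule last_points_less, simp)+
  fix j t
  assume j: "j < 2 * p + 2" and t: "last_points p j \<le> t" "t \<le> last_points p (Suc j)"
  have gl: "gen_last p t = (if t \<le> P / N then t else (P + gen_low p 0 (N * t - P)) / N)" if "0 \<le> t" "t \<le> 1"
    using that by (simp add: gen_last_def fold_N)
  let ?s = "subdiv_point p p" and ?r = "subdiv_point p 0"
  show "gen_last p t = last_points 0 j + (last_points 0 (Suc j) - last_points 0 j) /
      (last_points p (Suc j) - last_points p j) * (t - last_points p j)"
  proof (cases j)
    case 0
    then have "t \<le> P / N" "0 \<le> t" using t by (simp_all add: subdiv_point_0)
    moreover have "P / N \<le> 1" using P_N_1 N_gt by (simp add: field_simps)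
    ultimately have "gen_last p t = t" using gl by simp
    then show ?thesis using 0 N_gt by (simp add: subdiv_point_0)
  next
    case (Suc k)
    have k: "k \<le> 2 * p" using j Suc by simp
    have sm: "strict_mono ?s" by (simp add: strict_mono_Suc_iff subdiv_point_less)
    have s0: "0 \<le> ?s k" using strict_mono_less_eq[OF sm, of 0 k] by (simp add: subdiv_point_0)
    have s1: "?s (Suc k) \<le> 1" using strict_mono_less_eq[OF sm, of "Suc k" "2 * p + 1"] k dom_last by simp
    have PN: "0 \<le> P / N" using N_gt by simp
    have t': "P / N + ?s k / N \<le> t" "t \<le> P / N + ?s (Suc k) / N" using t Suc by simp_all
    have "0 \<le> ?s k / N" "?s (Suc k) / N \<le> 1 / N" using s0 s1 N_gt by (auto intro!: divide_right_mono)
    then have t01: "0 \<le> t" "t \<le> 1" "P / N \<le> t" using t' PN P_N_1 by linarith+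
    have d: "?s (Suc k) - ?s k > 0" using subdiv_point_less[of p p k] by simp
    let ?q = "(?r (Suc k) - ?r k) / (?s (Suc k) - ?s k)"
    have Nt: "?s k \<le> N * t - P" "N * t - P \<le> ?s (Suc k)"
      using t' N_gt by (simp_all add: add_divide_distrib[symmetric] field_simps)
    have low: "gen_low p 0 (N * t - P) = ?r k + ?q * (N * t - P - ?s k)"
      using gen_low_affine[OF k, of "N * t - P" 0] Nt by simp
    have "gen_last p t = (P + gen_low p 0 (N * t - P)) / N"
    proof (cases "t \<le> P / N")
      case True
      then have "t = P / N" using t01 by simp
      moreover have "gen_low p 0 0 = 0" using gen_low_first(2)[of 0] N_gt by simp
      ultimately show ?thesis using gl t01 by simp
    qed (use gl t01 in simp)
    also have "\<dots> = (P / N + ?r k / N) + ?q * (t - (P / N + ?s k / N))"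
    proof -
      have "N * t - P - ?s k = N * (t - (P / N + ?s k / N))" by (simp add: right_diff_distrib distrib_left)
      then show ?thesis unfolding low by (simp add: add_divide_distrib)
    qed
    also have "?q = (last_points 0 (Suc j) - last_points 0 j) / (last_points p (Suc j) - last_points p j)"
      unfolding Suc last_points_simps by (simp add: diff_divide_distrib[symmetric])
    finally show ?thesis unfolding Suc last_points_simps .
  qed
qed (simp_all)

lemma last_points_adic: "i \<le> p \<Longrightarrow> last_points i j \<in> N_adic (p + 1)"
proof (cases j)
  case 0
  then show ?thesis by (intro N_adicI[of _ 0 0]) simp
next
  case (Suc k)
  assume "i \<le> p"
  then obtain a where "subdiv_point p i k = of_int a / N\<^sup>2" using subdiv_point_adic by blast
  then have "last_points i j = of_int (int p * (int p + 1)\<^sup>2 + a) / N ^ 3"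
    unfolding Suc by (simp add: fold_N add_divide_distrib power2_eq_square power3_eq_cube)
  then show ?thesis by (rule N_adicI)
qed

lemma last_points_ratio:
  "\<exists>k::int. (last_points i (Suc j) - last_points i j) / (last_points i' (Suc j) - last_points i' j) = N powi k"
proof (cases j)
  case 0
  then show ?thesis using N_gt by (intro exI[of _ 0]) (simp add: subdiv_point_0)
next
  case (Suc k)
  have "(last_points i (Suc j) - last_points i j) / (last_points i' (Suc j) - last_points i' j)
    = (subdiv_point p i (Suc k) - subdiv_point p i k) / (subdiv_point p i' (Suc k) - subdiv_point p i' k)"
    unfolding Suc last_points_simps by (simp add: diff_divide_distrib[symmetric])
  then show ?thesis using gap_ratio by simp
qed

definition inverse_map :: "(real \<Rightarrow> real) \<Rightarrow> real \<Rightarrow> real" where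
  "inverse_map x = (\<lambda>y\<in>{0..1}. inv_into {0..1} x y)"

lemma gen_low_carrier:
  assumes "i < p"
  shows "gen_low p i \<in> thompson_carrier (p + 1)" "inverse_map (gen_low p i) \<in> thompson_carrier (p + 1)"
proof -
  interpret a: piecewise_affine "2 * p + 1" "subdiv_point p p" "subdiv_point p i" "gen_low p i"
    by (rule gen_low_piecewise[OF assms])
  interpret b: piecewise_affine "2 * p + 1" "subdiv_point p i" "subdiv_point p p" a.inv_f
    by (rule a.piecewise_affine_inverse)
  have ad: "subdiv_point p i' j \<in> N_adic (p + 1)" if "i' \<le> p" for i' j
    using subdiv_point_adic[OF that, of j] N_adicI by blast
  show "gen_low p i \<in> thompson_carrier (p + 1)"
    using ad gap_ratio by (intro a.in_thompson_carrier) (auto simp: fold_N add.commute)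
  have "a.inv_f \<in> thompson_carrier (p + 1)"
    using ad gap_ratio assms by (intro b.in_thompson_carrier) (auto simp: fold_N add.commute)
  then show "inverse_map (gen_low p i) \<in> thompson_carrier (p + 1)"
    by (simp add: inverse_map_def a.inv_f_def)
qed

lemma gen_last_carrier:
  "gen_last p \<in> thompson_carrier (p + 1)" "inverse_map (gen_last p) \<in> thompson_carrier (p + 1)"
proof -
  interpret a: piecewise_affine "2 * p + 2" "last_points p" "last_points 0" "gen_last p"
    by (rule gen_last_piecewise)
  interpret b: piecewise_affine "2 * p + 2" "last_points 0" "last_points p" a.inv_f
    by (rule a.piecewise_affine_inverse)
  show "gen_last p \<in> thompson_carrier (p + 1)"
    by (intro a.in_thompson_carrier last_points_adic) (unfold N_real, rule order_refl, rule last_points_ratio)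
  have "a.inv_f \<in> thompson_carrier (p + 1)"
    by (intro b.in_thompson_carrier last_points_adic) (unfold N_real, rule le0, rule last_points_ratio)
  then show "inverse_map (gen_last p) \<in> thompson_carrier (p + 1)"
    by (simp add: inverse_map_def a.inv_f_def)
qed

lemma std_gens_moves:
  "x \<in> std_gens p \<Longrightarrow> \<exists>a\<in>moves. \<forall>s. x (H s) = H (fwd a s)"
  "a \<in> moves \<Longrightarrow> \<exists>x\<in>std_gens p. \<forall>s. x (H s) = H (fwd a s)"
proof -
  have low: "\<exists>a\<in>moves. \<forall>s. gen_low p i (H s) = H (fwd a s)" if "i < p" for i
  proof (cases "i = 0")
    case True
    then show ?thesis using gen_low_0_H by (intro bexI[of _ Shift]) auto
  next
    case False
    then show ?thesis using gen_low_H[of i] that by (intro bexI[of _ "Merge (int i - 1)"]) (auto simp: moves_def)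
  qed
  have last: "\<exists>a\<in>moves. \<forall>s. gen_last p (H s) = H (fwd a s)"
    using gen_last_H by (intro bexI[of _ Last]) auto
  show "x \<in> std_gens p \<Longrightarrow> \<exists>a\<in>moves. \<forall>s. x (H s) = H (fwd a s)"
    using low last by (auto simp: std_gens_def)
  assume "a \<in> moves"
  then show "\<exists>x\<in>std_gens p. \<forall>s. x (H s) = H (fwd a s)"
  proof (cases rule: moves_cases)
    case 1
    then show ?thesis using gen_low_0_H p_pos by (intro bexI[of _ "gen_low p 0"]) (auto simp: std_gens_def)
  next
    case (2 i)
    show ?thesis
    proof (cases "i = int p - 1")
      case True
      then show ?thesis using gen_last_H 2 by (intro bexI[of _ "gen_last p"]) (auto simp: std_gens_def)
    next
      case False
      let ?k = "nat (i + 1)"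
      have k: "1 \<le> ?k" "?k < p" "int ?k - 1 = i" using False 2 by auto
      then show ?thesis using gen_low_H[OF k(1,2)] 2 by (intro bexI[of _ "gen_low p ?k"]) (auto simp: std_gens_def)
    qed
  qed
qed

lemma std_gens_carrier:
  "x \<in> std_gens p \<Longrightarrow> x \<in> thompson_carrier (p + 1)"
  "x \<in> std_gens p \<Longrightarrow> inverse_map x \<in> thompson_carrier (p + 1)"
  using gen_low_carrier gen_last_carrier by (auto simp: std_gens_def)

section \<open>Word length and dead ends\<close>

definition G :: "(real \<Rightarrow> real) monoid" where "G = thompson_group (p + 1)"

abbreviation X where "X \<equiv> std_gens p"

text \<open>The group law is composition of bijections, so products of generators can be computed in this larger set,
whose closure under composition is immediate.\<close>

definition fixing_maps :: "(real \<Rightarrow> real) set" where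
  "fixing_maps = {w \<in> Bij {0..1}. w 0 = 0 \<and> w 1 = 1}"

text \<open>In the coordinate given by \<open>H\<close>, the map \<open>f\<close> is the inverse of \<open>w\<close>. With the inverse, multiplication
on the right by a letter becomes the action of one more letter at the end of a word.\<close>

definition represents :: "(real \<Rightarrow> real) \<Rightarrow> (real \<Rightarrow> real) \<Rightarrow> bool" where
  "represents f w \<longleftrightarrow> (\<forall>s. w (H (f s)) = H s)"

lemma carrier_fixing_maps: "w \<in> thompson_carrier (p + 1) \<Longrightarrow> w \<in> fixing_maps"
  using thompson_carrierD[of w "p + 1"] by (simp add: fixing_maps_def Bij_def)

lemma fixing_maps_Bij: "w \<in> fixing_maps \<Longrightarrow> w \<in> Bij {0..1}"
  by (simp add: fixing_maps_def)

lemma H_in: "H s \<in> {0..1}" using H_range[of s] by simp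

lemma mult_G: "g \<in> Bij {0..1} \<Longrightarrow> h \<in> Bij {0..1} \<Longrightarrow> g \<otimes>\<^bsub>G\<^esub> h = compose {0..1} g h"
  by (simp add: G_def thompson_group_def BijGroup_def)

lemma one_G: "\<one>\<^bsub>G\<^esub> = (\<lambda>x\<in>{0..1}. x)"
  by (simp add: G_def thompson_group_def BijGroup_def)

lemma mult_fixing_maps: "g \<in> fixing_maps \<Longrightarrow> h \<in> fixing_maps \<Longrightarrow> g \<otimes>\<^bsub>G\<^esub> h \<in> fixing_maps"
  using compose_Bij[of g "{0..1}" h] by (auto simp: fixing_maps_def mult_G) (auto simp: compose_def)

lemma one_fixing_maps: "\<one>\<^bsub>G\<^esub> \<in> fixing_maps"
  by (simp add: fixing_maps_def one_G id_Bij)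

lemma represents_mult:
  assumes "g \<in> fixing_maps" "h \<in> fixing_maps" "represents f g" "represents f' h"
  shows "represents (\<lambda>s. f' (f s)) (g \<otimes>\<^bsub>G\<^esub> h)"
  using assms H_in by (simp add: represents_def mult_G fixing_maps_Bij compose_def)

lemma represents_one: "represents (\<lambda>s. s) \<one>\<^bsub>G\<^esub>"
  using H_in by (simp add: represents_def one_G)

lemma represents_determines_word:
  assumes "w \<in> fixing_maps" "represents f w" "represents f' w"
  shows "f s = f' s"
proof -
  have "inj_on w {0..1}" using assms(1) by (simp add: fixing_maps_def Bij_def bij_betw_def)
  moreover have "w (H (f s)) = w (H (f' s))" using assms(2,3) by (simp add: represents_def)
  ultimately have "H (f s) = H (f' s)" using H_in inj_onD by metis
  then show ?thesis by (rule H_inj)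
qed

lemma represents_determines_map:
  assumes "w \<in> fixing_maps" "w' \<in> fixing_maps" "represents (wact ws) w" "represents (wact ws) w'"
  shows "w = w'"
proof
  fix y :: real
  have "y \<notin> {0..1} \<or> y = 0 \<or> y = 1 \<or> (0 < y \<and> y < 1)" by auto
  then consider "y \<notin> {0..1}" | "y = 0" | "y = 1" | "0 < y" "y < 1" by blast
  then show "w y = w' y"
  proof cases
    case 1
    then show ?thesis using assms(1,2) by (auto simp: fixing_maps_def Bij_def extensional_def)
  next
    case 4
    then obtain s where "H s = y" using H_surj by blast
    then have "H (wact ws (wact (inv_word ws) s)) = y" by simp
    then show ?thesis using assms(3,4) unfolding represents_def by metis
  qed (use assms in \<open>auto simp: fixing_maps_def\<close>)
qed

text \<open>The inverse operation of the group depends on its carrier, so the inverse map has to be known to belong to the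
group.\<close>

lemma m_inv_G:
  assumes "x \<in> X"
  shows "m_inv G x = inverse_map x"
proof -
  have x: "x \<in> Bij {0..1}" and ix: "inverse_map x \<in> Bij {0..1}"
    using std_gens_carrier[OF assms] carrier_fixing_maps fixing_maps_Bij by blast+
  interpret B: group "BijGroup {0..1::real}" by (rule group_BijGroup)
  have inv: "inv\<^bsub>BijGroup {0..1}\<^esub> x = inverse_map x"
    using inv_BijGroup[OF x] by (simp add: inverse_map_def)
  have cB: "carrier (BijGroup {0..1}) = Bij {0..1::real}" by (simp add: BijGroup_def)
  have ops: "a \<otimes>\<^bsub>G\<^esub> b = a \<otimes>\<^bsub>BijGroup {0..1}\<^esub> b" "\<one>\<^bsub>G\<^esub> = \<one>\<^bsub>BijGroup {0..1}\<^esub>" for a b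
    by (simp_all add: G_def thompson_group_def BijGroup_def)
  have cG: "carrier G = thompson_carrier (p + 1)" by (simp add: G_def thompson_group_def)
  show ?thesis unfolding m_inv_def[of G]
  proof (rule the_equality)
    show "inverse_map x \<in> carrier G \<and> x \<otimes>\<^bsub>G\<^esub> inverse_map x = \<one>\<^bsub>G\<^esub> \<and> inverse_map x \<otimes>\<^bsub>G\<^esub> x = \<one>\<^bsub>G\<^esub>"
      unfolding ops cG using std_gens_carrier(2)[OF assms] B.r_inv[of x] B.l_inv[of x] x inv cB by simp
  next
    fix y assume y: "y \<in> carrier G \<and> x \<otimes>\<^bsub>G\<^esub> y = \<one>\<^bsub>G\<^esub> \<and> y \<otimes>\<^bsub>G\<^esub> x = \<one>\<^bsub>G\<^esub>"
    then have "y \<in> Bij {0..1}" using carrier_fixing_maps fixing_maps_Bij cG by blast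
    then show "y = inverse_map x" using y x B.inv_equality[of y x] unfolding ops cB inv[symmetric] by metis
  qed
qed

lemma inverse_map_H:
  assumes "x \<in> X" "x (H s) = t"
  shows "inverse_map x t = H s"
proof -
  have "bij_betw x {0..1} {0..1}" using thompson_carrierD(4) std_gens_carrier(1)[OF assms(1)] by blast
  then have "inv_into {0..1} x (x (H s)) = H s" "x (H s) \<in> {0..1}"
    using H_in by (auto simp: bij_betw_def inv_into_f_f)
  then show ?thesis using assms(2) by (simp add: inverse_map_def)
qed

lemma letter_moves:
  assumes "g \<in> letters G X"
  shows "g \<in> fixing_maps" "\<exists>l. fst l \<in> moves \<and> represents (act l) g"
proof -
  obtain x where x: "x \<in> X" "g = x \<or> g = inverse_map x" using assms m_inv_G by (auto simp: letters_def)
  show "g \<in> fixing_maps" using x std_gens_carrier carrier_fixing_maps by auto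
  obtain a where a: "a \<in> moves" "\<And>s. x (H s) = H (fwd a s)" using std_gens_moves(1)[OF x(1)] by blast
  from x(2) show "\<exists>l. fst l \<in> moves \<and> represents (act l) g"
  proof
    assume "g = x"
    then show ?thesis using a by (intro exI[of _ "(a, False)"]) (simp add: represents_def act_def)
  next
    assume "g = inverse_map x"
    then show ?thesis using a inverse_map_H[OF x(1)]
      by (intro exI[of _ "(a, True)"]) (simp add: represents_def act_def)
  qed
qed

lemma moves_letter:
  assumes "fst l \<in> moves"
  shows "\<exists>g\<in>letters G X. represents (act l) g"
proof -
  obtain x where x: "x \<in> X" "\<And>s. x (H s) = H (fwd (fst l) s)" using std_gens_moves(2)[OF assms] by blast
  show ?thesis
  proof (cases "snd l")
    case True
    have "represents (act l) (m_inv G x)"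
      using True inverse_map_H[OF x(1)] x(2) m_inv_G[OF x(1)] by (simp add: represents_def act_def)
    then show ?thesis using x(1) by (auto simp: letters_def)
  next
    case False
    then have "represents (act l) x" using x(2) by (simp add: represents_def act_def)
    then show ?thesis using x(1) by (auto simp: letters_def)
  qed
qed

lemma word_prod_Cons: "word_prod G (g # gs) = g \<otimes>\<^bsub>G\<^esub> word_prod G gs"
  by (simp add: word_prod_def)

lemma wact_Cons: "wact (l # ws) = (\<lambda>s. wact ws (act l s))"
  by (simp add: fun_eq_iff)

lemma word_prod_word:
  assumes "gs \<in> lists (letters G X)"
  shows "word_prod G gs \<in> fixing_maps \<and> (\<exists>ws\<in>words. length ws = length gs \<and> represents (wact ws) (word_prod G gs))"
  using assms
proof (induction gs)
  case Nil
  show ?case using one_fixing_maps represents_one by (intro conjI bexI[of _ "[]"]) (auto simp: word_prod_def)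
next
  case (Cons g gs)
  then obtain ws where ws: "ws \<in> words" "length ws = length gs" "represents (wact ws) (word_prod G gs)"
    and f: "word_prod G gs \<in> fixing_maps" by auto
  obtain l where l: "fst l \<in> moves" "represents (act l) g" and g: "g \<in> fixing_maps"
    using letter_moves[OF Cons.hyps(1)] by blast
  have "represents (wact (l # ws)) (word_prod G (g # gs))"
    unfolding word_prod_Cons wact_Cons by (rule represents_mult[OF g f l(2) ws(3)])
  moreover have "word_prod G (g # gs) \<in> fixing_maps" unfolding word_prod_Cons by (rule mult_fixing_maps[OF g f])
  moreover have "l # ws \<in> words" "length (l # ws) = length (g # gs)" using ws l by auto
  ultimately show ?case by blast
qed

lemma word_word_prod:
  assumes "ws \<in> words"
  shows "\<exists>gs\<in>lists (letters G X). length gs = length ws \<and> represents (wact ws) (word_prod G gs)"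
  using assms
proof (induction ws)
  case Nil
  show ?case using represents_one by (intro bexI[of _ "[]"]) (auto simp: word_prod_def)
next
  case (Cons l ws)
  then obtain gs where gs: "gs \<in> lists (letters G X)" "length gs = length ws" "represents (wact ws) (word_prod G gs)"
    by auto
  obtain g where g: "g \<in> letters G X" "represents (act l) g" using moves_letter[of l] Cons.prems by auto
  have "represents (wact (l # ws)) (word_prod G (g # gs))"
    unfolding word_prod_Cons wact_Cons using letter_moves(1)[OF g(1)] word_prod_word[OF gs(1)] g(2) gs(3)
    by (intro represents_mult) auto
  moreover have "g # gs \<in> lists (letters G X)" "length (g # gs) = length (l # ws)" using gs g by auto
  ultimately show ?case by blast
qed

definition spelled :: "(real \<Rightarrow> real) \<Rightarrow> nat \<Rightarrow> bool" where
  "spelled f n \<longleftrightarrow> (\<exists>ws\<in>words. length ws \<le> n \<and> wact ws = f)"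

lemma word_length_le_iff:
  assumes "w \<in> fixing_maps" "represents f w"
  shows "word_length G X w \<le> enat n \<longleftrightarrow> spelled f n"
proof
  let ?S = "{enat (length gs) | gs. gs \<in> lists (letters G X) \<and> word_prod G gs = w}"
  assume le: "word_length G X w \<le> enat n"
  have "?S \<noteq> {}"
  proof
    assume "?S = {}"
    then have "word_length G X w = \<infinity>" unfolding word_length_def by (simp only: Inf_empty top_enat_def)
    then show False using le by simp
  qed
  moreover have "Inf ?S = (LEAST x. x \<in> ?S)" using \<open>?S \<noteq> {}\<close> unfolding Inf_enat_def by (rule if_not_P)
  ultimately have "Inf ?S \<in> ?S" by (metis (lifting) LeastI ex_in_conv)
  then obtain gs where gs: "Inf ?S = enat (length gs)" "gs \<in> lists (letters G X)" "word_prod G gs = w"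
    by blast
  then have len: "length gs \<le> n" using le by (simp add: word_length_def)
  obtain ws where ws: "ws \<in> words" "length ws = length gs" "represents (wact ws) w"
    using word_prod_word[OF gs(2)] gs(3) by auto
  have "wact ws = f" using represents_determines_word[OF assms(1) ws(3) assms(2)] by (simp add: fun_eq_iff)
  then show "spelled f n" unfolding spelled_def using ws len by (intro bexI[of _ ws]) auto
next
  assume "spelled f n"
  then obtain ws where ws: "ws \<in> words" "length ws \<le> n" "wact ws = f" by (auto simp: spelled_def)
  obtain gs where gs: "gs \<in> lists (letters G X)" "length gs = length ws" "represents (wact ws) (word_prod G gs)"
    using word_word_prod[OF ws(1)] by blast
  have "word_prod G gs = w"
    using represents_determines_map[of "word_prod G gs" w ws] word_prod_word[OF gs(1)] gs(3) assms ws(3) by simp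
  then have "word_length G X w \<le> enat (length gs)" unfolding word_length_def using gs(1) by (intro Inf_lower) blast
  then show "word_length G X w \<le> enat n" using gs(2) ws(2) by (simp add: order_trans[of _ "enat (length gs)"])
qed

text \<open>Near \<open>\<infinity>\<close> every move is the translation by \<open>- p\<close>.\<close>

lemma word_parity_aux:
  "ws \<in> words \<Longrightarrow> \<exists>A c. (\<forall>s\<ge>A. wact ws s = s + P * of_int c) \<and> (even c \<longleftrightarrow> even (length ws))"
proof (induction ws)
  case Nil
  show ?case by (intro exI[of _ 0]) simp
next
  case (Cons l ws)
  then obtain A c where A: "\<And>s. s \<ge> A \<Longrightarrow> wact ws s = s + P * of_int c" "even c \<longleftrightarrow> even (length ws)" by auto
  have "fst l \<in> moves" using Cons.prems by simp
  then have far: "fwd (fst l) s = s - P" "bwd (fst l) s = s + P" if "s \<ge> 2 * P" for s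
    using that by (cases rule: moves_cases; simp add: merge_ge expand_ge N_def)+
  let ?e = "if snd l then - 1 else 1 :: int"
  have "wact (l # ws) s = s + P * of_int (?e + c)" if "s \<ge> max (2 * P) (A + P)" for s
  proof -
    have a: "act l s = s + P * of_int ?e" using far that by (simp add: act_def)
    then have "act l s \<ge> A" using that N_gt(5) by auto
    then show ?thesis using A(1) a by (simp add: algebra_simps)
  qed
  moreover have "even (?e + c) \<longleftrightarrow> even (length (l # ws))" using A(2) by simp
  ultimately show ?case by blast
qed

lemma word_parity:
  assumes "vs \<in> words" "ws \<in> words" "wact vs = wact ws"
  shows "even (length vs) \<longleftrightarrow> even (length ws)"
proof -
  obtain A c where A: "\<And>s. s \<ge> A \<Longrightarrow> wact vs s = s + P * of_int c" "even c \<longleftrightarrow> even (length vs)"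
    using word_parity_aux[OF assms(1)] by blast
  obtain B d where B: "\<And>s. s \<ge> B \<Longrightarrow> wact ws s = s + P * of_int d" "even d \<longleftrightarrow> even (length ws)"
    using word_parity_aux[OF assms(2)] by blast
  have "wact vs (max A B) = max A B + P * of_int c" "wact ws (max A B) = max A B + P * of_int d"
    using A(1) B(1) by simp_all
  then have "P * of_int c = P * of_int d" unfolding assms(3) by linarith
  then have "c = d" using N_gt(5) by simp
  then show ?thesis using A(2) B(2) by simp
qed

text \<open>The first hypothesis makes \<open>n\<close> a lower bound for the length of \<open>f\<close>. If the end of the path had length
at most \<open>n\<close>, two applications of \<open>shorten_expand\<close> and one translation would give a word for \<open>f\<close> of length
less than \<open>n\<close>.\<close>

lemma leaves_ball:
  assumes min: "\<And>m. m < n \<Longrightarrow> \<not> spelled f m"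
    and merge: "spelled (\<lambda>s. merge (int p - 1) (f s)) n"
  shows "\<not> spelled (\<lambda>s. wact [(Shift, True), (Last, False), (Last, False)] (f s)) n"
proof
  let ?E = "expand (int p - 1)"
  assume "spelled (\<lambda>s. wact [(Shift, True), (Last, False), (Last, False)] (f s)) n"
  then obtain ws where ws: "ws \<in> words" "length ws \<le> n" "\<And>s. wact ws s = ?E (?E (f s - P))"
    by (auto simp: spelled_def fun_eq_iff)
  obtain us where us: "us \<in> words" "length us \<le> n" "\<And>s. wact us s = merge (int p - 1) (f s)"
    using merge by (auto simp: spelled_def fun_eq_iff)
  have "\<exists>a k. \<forall>x\<in>{0..1}. ?E (wact us ((of_int a + x) / N ^ k)) = 2 * P - 1 + x"
  proof (rule ccontr)
    assume "\<not> ?thesis"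
    then obtain vs where vs: "vs \<in> words" "length vs < length us" "\<And>t. wact vs t = ?E (wact us t)"
      using shorten_merge[OF us(1)] by blast
    then have "wact vs = f" using us(3) by (simp add: fun_eq_iff)
    then have "spelled f (length vs)" using vs(1) by (auto simp: spelled_def)
    then show False using min[of "length vs"] vs us(2) by simp
  qed
  then obtain a k where "\<forall>x\<in>{0..1}. ?E (wact us ((of_int a + x) / N ^ k)) = 2 * P - 1 + x" by blast
  then have a: "f ((of_int a + x) / N ^ k) = 2 * P - 1 + x" if "0 \<le> x" "x \<le> 1" for x
    using us(3) that by simp
  have E: "?E (P - 1 + x) = P - 1 + N * x" if "0 \<le> x" "x \<le> 1" for x
    using that by (auto simp: expand_def mult.commute)
  have g1: "?E (f ((of_int a + x) / N ^ k) - P) = P - 1 + N * x" if "0 \<le> x" "x \<le> 1" for x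
  proof -
    have "f ((of_int a + x) / N ^ k) - P = P - 1 + x" using a[OF that] by simp
    then show ?thesis using E[OF that] by (simp only:)
  qed
  have "wact ws ((of_int (a * (int p + 1)) + y) / N ^ Suc k) = P - 1 + N * y" if y: "0 \<le> y" "y \<le> 1" for y
  proof -
    have "(of_int (a * (int p + 1)) + y) / N ^ Suc k = (of_int a + y / N) / N ^ k"
      using N_gt by (simp add: fold_N add_divide_distrib)
    moreover have "0 \<le> y / N" "y / N \<le> 1" using y N_gt by auto
    ultimately have "?E (f ((of_int (a * (int p + 1)) + y) / N ^ Suc k) - P) = P - 1 + y"
      using g1[of "y / N"] by simp
    then show ?thesis using ws(3) E[OF y] by simp
  qed
  from shorten_expand[OF ws(1) this] obtain vs where
    vs: "vs \<in> words" "length vs < length ws" "\<And>t. wact vs t = ?E (f t - P)" using ws(3) by auto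
  have "wact vs ((of_int a + x) / N ^ k) = P - 1 + N * x" if "0 \<le> x" "x \<le> 1" for x
    using vs(3) g1[OF that] by simp
  from shorten_expand[OF vs(1) this] obtain us where
    us: "us \<in> words" "length us < length vs" "\<And>t. wact us t = f t - P" using vs(3) by auto
  let ?us = "us @ [(Shift, False)]"
  have "?us \<in> words" "wact ?us = f" using us by (auto simp: fun_eq_iff)
  then have "spelled f (length ?us)" unfolding spelled_def by blast
  then show False using min[of "length ?us"] us(2) vs(2) ws(2) by simp
qed

lemma dead_end_depth_2:
  assumes "dead_end G X w"
  shows "dead_end_depth G X w = 2"
proof -
  have wc: "w \<in> thompson_carrier (p + 1)" using assms by (simp add: dead_end_def G_def thompson_group_def)
  then have w: "w \<in> fixing_maps" by (rule carrier_fixing_maps)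
  obtain ws0 where ws0: "ws0 \<in> words" "\<And>s. w (H (wact ws0 s)) = H s" using carrier_word[OF wc] by blast
  define f where "f = wact ws0"
  have rep: "represents f w" using ws0 by (simp add: represents_def f_def)
  have ex: "\<exists>n. spelled f n" using ws0(1) by (auto simp: spelled_def f_def)
  define n where "n = (LEAST n. spelled f n)"
  have n: "spelled f n" unfolding n_def using ex by (rule LeastI_ex)
  have min: "\<not> spelled f m" if "m < n" for m using that not_less_Least unfolding n_def by blast
  have wl: "word_length G X w = enat n"
  proof (rule antisym)
    show "word_length G X w \<le> enat n" using word_length_le_iff[OF w rep] n by simp
    show "enat n \<le> word_length G X w"
    proof (cases "word_length G X w")
      case (enat m)
      then have "spelled f m" using word_length_le_iff[OF w rep, of m] by simp
      then show ?thesis using min[of m] enat by (cases "m < n") auto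
    qed simp
  qed
  have ext: "word_length G X (w \<otimes>\<^bsub>G\<^esub> word_prod G gs) \<le> word_length G X w \<longleftrightarrow> spelled (\<lambda>s. wact us (f s)) n"
    if "gs \<in> lists (letters G X)" "represents (wact us) (word_prod G gs)" for gs us
    unfolding wl using word_prod_word[OF that(1)] that(2) w rep
    by (intro word_length_le_iff mult_fixing_maps represents_mult) auto
  have step1: "spelled (\<lambda>s. act l (f s)) n" if l: "fst l \<in> moves" for l
  proof -
    obtain g where g: "g \<in> letters G X" "represents (act l) g" using moves_letter[OF l] by blast
    have "word_length G X (w \<otimes>\<^bsub>G\<^esub> g) \<le> enat n" using assms g(1) by (simp add: dead_end_def wl)
    then show ?thesis
      using word_length_le_iff[OF mult_fixing_maps[OF w letter_moves(1)[OF g(1)]] represents_mult[OF w letter_moves(1)[OF g(1)] rep g(2)]]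
      by simp
  qed
  have step2: "spelled (\<lambda>s. act l' (act l (f s))) n" if l: "fst l \<in> moves" "fst l' \<in> moves" for l l'
  proof -
    obtain us where us: "us \<in> words" "length us \<le> n" "wact us = (\<lambda>s. act l (f s))"
      using step1[OF l(1)] by (auto simp: spelled_def)
    obtain vs where vs: "vs \<in> words" "length vs \<le> n" "wact vs = f" using n by (auto simp: spelled_def)
    have "spelled f (length vs)" using vs by (auto simp: spelled_def)
    then have "length vs = n" using min[of "length vs"] vs(2) by (cases "length vs < n") auto
    moreover have "even (length us) \<longleftrightarrow> even (length (vs @ [l]))"
      using us vs l by (intro word_parity) (auto simp: fun_eq_iff)
    ultimately have "length us \<noteq> n" by auto
    then show ?thesis unfolding spelled_def using us l
      by (intro bexI[of _ "us @ [l']"]) (auto simp: fun_eq_iff)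
  qed
  have short: "word_length G X (w \<otimes>\<^bsub>G\<^esub> word_prod G gs) \<le> word_length G X w"
    if gs: "gs \<in> lists (letters G X)" "length gs \<le> 2" for gs
  proof -
    obtain us where us: "us \<in> words" "length us = length gs" "represents (wact us) (word_prod G gs)"
      using word_prod_word[OF gs(1)] by blast
    have "spelled (\<lambda>s. wact us (f s)) n"
    proof (cases us)
      case Nil
      then show ?thesis using n by simp
    next
      case (Cons l vs)
      show ?thesis
      proof (cases vs)
        case Nil
        then show ?thesis using Cons step1[of l] us(1) by simp
      next
        case (Cons l' xs)
        then have "us = [l, l']" using \<open>us = l # vs\<close> us(2) gs(2) by (cases xs) auto
        then show ?thesis using step2[of l l'] us(1) by simp
      qed
    qed
    then show ?thesis using ext[OF gs(1) us(3)] by simp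
  qed
  let ?path = "[(Shift, True), (Last, False), (Last, False)]"
  have "?path \<in> words" by simp
  then obtain hs where hs: "hs \<in> lists (letters G X)" "length hs = length ?path" "represents (wact ?path) (word_prod G hs)"
    using word_word_prod by blast
  have "spelled (\<lambda>s. merge (int p - 1) (f s)) n" using step1[of "(Last, True)"] by simp
  then have "\<not> spelled (\<lambda>s. wact ?path (f s)) n" using min by (intro leaves_ball)
  then have long: "word_length G X (w \<otimes>\<^bsub>G\<^esub> word_prod G hs) > word_length G X w"
    using ext[OF hs(1,3)] by simp
  show ?thesis unfolding dead_end_depth_def
  proof (rule antisym)
    let ?M = "{enat m | m. (\<forall>gs\<in>lists (letters G X). length gs \<le> m \<longrightarrow>
         word_length G X (w \<otimes>\<^bsub>G\<^esub> word_prod G gs) \<le> word_length G X w) \<and>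
      (\<exists>gs\<in>lists (letters G X). length gs = m + 1 \<and>
         word_length G X (w \<otimes>\<^bsub>G\<^esub> word_prod G gs) > word_length G X w)}"
    have "\<exists>gs\<in>lists (letters G X). length gs = 2 + 1 \<and>
         word_length G X (w \<otimes>\<^bsub>G\<^esub> word_prod G gs) > word_length G X w"
      using hs(1,2) long by (intro bexI[of _ hs]) auto
    then have "enat 2 \<in> ?M" using short by blast
    then show "Inf ?M \<le> 2" by (simp add: Inf_lower numeral_eq_enat)
    show "2 \<le> Inf ?M"
    proof (rule Inf_greatest)
      fix x assume "x \<in> ?M"
      then obtain m gs where x: "x = enat m" and gs: "gs \<in> lists (letters G X)" "length gs = m + 1"
        "word_length G X (w \<otimes>\<^bsub>G\<^esub> word_prod G gs) > word_length G X w" by blast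
      have "\<not> length gs \<le> 2" using short[OF gs(1)] gs(3) by auto
      then show "2 \<le> x" using gs(2) x by (simp add: numeral_eq_enat)
    qed
  qed
qed

end

theorem theorem3p1:
  fixes p :: nat
  assumes "p \<ge> 1"
  shows "(\<forall>w. dead_end (thompson_group (p + 1)) (std_gens p) w \<longrightarrow>
            dead_end_depth (thompson_group (p + 1)) (std_gens p) w = 2) \<and>
         (\<forall>k::enat. k \<noteq> 2 \<longrightarrow> (\<nexists>w. pocket (thompson_group (p + 1)) (std_gens p) k w))"
proof -
  interpret tree_line p by unfold_locales (rule assms)
  show ?thesis using dead_end_depth_2 unfolding G_def by (auto simp: pocket_def)
qed

end
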